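(* Let $F$ be a field of characteristic zero, $r\ge 1$, $G=\mathbb{Z}^{r}$, and let $\mathcal{U}=UT_{2r}(F)$ with the finest $G$-grading and the symplectic involution. The $(G,\ast)$-identities of $\mathcal{U}$ follow from the identities $$[x_{1,0},x_{2,0}],\qquad x_{1,g}^{\ast}+x_{1,g}\ \text{ for } g\in G \text{ with } \dim\mathcal{U}_g=1,$$ together with the monomial identities of $\mathcal{U}$ of the form $x_{1,g_1}\cdots x_{n,g_n}$ with $n\le 3$ and $g_i\ne 0$ for all $i$; that is, these polynomials form a basis of $T_{G,\ast}(\mathcal{U})$. Moreover, for every $n\geq 1$ the images of the good monomials of degree $n$ under the canonical quotient map form a basis of $P_n^{G,\ast}/(P_n^{G,\ast}\cap T_{G,\ast}(\mathcal{U}))$.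
   Context: $UT_{2r}(F)$ is the algebra of $2r\times 2r$ upper triangular matrices, with elementary matrices $E_{i,j}$, $i\le j$. For an abelian group $G$ (written additively) the elementary grading induced by $(g_1,\dots,g_m)\in G^m$ on $UT_m(F)$ is the $G$-grading with $\deg E_{i,j}=g_i-g_j$. The finest grading on $UT_{2r}(F)$ is the elementary $\mathbb{Z}^r$-grading induced by $(e_1,\dots,e_r,0,e_r-e_{r-1},\dots,e_r-e_1)$, where $e_1,\dots,e_r$ is the standard basis of $\mathbb{Z}^r$. The reflection involution is the linear map with $E_{i,j}^\ast=E_{2r+1-j,2r+1-i}$; the symplectic involution is $a^s=Da^\ast D^{-1}$, $D=\mathrm{diag}(I_r,-I_r)$. It is graded (preserves each homogeneous component $\mathcal{U}_g$). $F_{G,\ast}\langle X\rangle$ is the free associative algebra on indeterminates $x_{i,g},x_{i,g}^\ast$ ($i\in\mathbb{N},g\in G$), graded with both of degree $g$, with involution exchanging $x_{i,g}$ and $x_{i,g}^\ast$. A polynomial is a $(G,\ast)$-identity for $\mathcal{U}$ if it vanishes under all substitutions of each $x_{i,g}$ by an element $a_{i,g}\in\mathcal{U}_g$ and of $x_{i,g}^\ast$ by the image of $a_{i,g}$ under the involution of $\mathcal{U}$; $T_{G,\ast}(\mathcal{U})$ is the set of these. A $T_{G,\ast}$-ideal is a two-sided ideal invariant under the involution and under all graded endomorphisms commuting with the involution; a subset $P$ is a basis for $T_{G,\ast}(\mathcal{U})$ if the smallest $T_{G,\ast}$-ideal containing $P$ is $T_{G,\ast}(\mathcal{U})$. $P_n^{G,\ast}$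 is the span of the monomials $x_{\sigma(1),g_1}^{\delta_1}\cdots x_{\sigma(n),g_n}^{\delta_n}$ with $\sigma\in S_n$, $g_i\in G$, $\delta_i\in\{\emptyset,\ast\}$ (here $x^{\emptyset}=x$). Good monomials (for $UT_{2r}(F)$). Write a monomial of $P_n^{G,\ast}$ as $M=M_1x_{u_1,g_1}^{\delta_1}M_2\cdots M_kx_{u_k,g_k}^{\delta_k}M_{k+1}$, $k\ge0$, with $g_1,\dots,g_k\neq0$ and $M_i=x_{k_{i,1},0}^{\delta_{i,1}}\cdots x_{k_{i,s_i},0}^{\delta_{i,s_i}}$ ($M_i=1$ if $s_i=0$). $M$ is good if it is not a $(G,\ast)$-identity for $\mathcal{U}$ and: (I) $k_{i,1}<\cdots<k_{i,s_i}$ for each $i$; (II) if $\dim\mathcal{U}_{g_i}=1$ then $\delta_i=\emptyset$ and $M_i=1$; (III) if $\dim\mathcal{U}_g=1$ for $g=g_i+g_{i+1}+\cdots+g_j$ with $i<j$, then $M_i=1$ and $u_i<u_j$. *)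

theory Defs
  imports
    "HOL-Library.Poly_Mapping"
    "HOL-Algebra.Ideal"
    "HOL-Combinatorics.Permutations"
    "Jordan_Normal_Form.VS_Connect"
begin

text \<open>The free associative algebra \<open>F\<^sub>G\<^sub>,\<^sub>*\<langle>X\<rangle>\<close> is the monoid algebra over the free
  monoid of words, i.e. the type of finitely supported functions from words to \<open>F\<close>, with the
  convolution product of \<^theory>\<open>HOL-Library.Poly_Mapping\<close>.  Since that product is tied to a
  type class for the (additively written) monoid, words are a wrapper around lists.
  It is the unital free algebra; the empty word is \<open>1\<close>.\<close>

text \<open>\<open>Letter i g False\<close> is \<open>x\<^sub>i\<^sub>,\<^sub>g\<close> and \<open>Letter i g True\<close> is its formal image under \<open>*\<close>.\<close>

datatype 'g letter = Letter (idx: nat) (ldeg: 'g) (starred: bool)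

datatype 'l word = Word (letters: "'l list")

instantiation word :: (type) monoid_add
begin

definition zero_word :: "'a word" where
  "zero_word = Word []"

definition plus_word :: "'a word \<Rightarrow> 'a word \<Rightarrow> 'a word" where
  "plus_word v w = Word (letters v @ letters w)"

instance
  by standard (simp_all add: zero_word_def plus_word_def)

end

type_synonym ('g, 'a) falg = "'g letter word \<Rightarrow>\<^sub>0 'a"

definition word_mono :: "'g letter list \<Rightarrow> ('g, 'a::field) falg" where
  "word_mono w = Poly_Mapping.single (Word w) 1"

text \<open>\<open>G\<close> is a subset of the type \<open>'g\<close>; only letters with degree in \<open>G\<close> are admitted.\<close>

definition words :: "'g set \<Rightarrow> 'g letter list set" where
  "words G = {w. \<forall>l\<in>set w. ldeg l \<in> G}"

definition free_alg :: "'g set \<Rightarrow> ('a::field, ('g, 'a) falg) module" where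
  "free_alg G = \<lparr>
     carrier = {p. \<forall>w\<in>Poly_Mapping.keys p. letters w \<in> words G},
     mult = (*), one = 1, zero = 0, add = (+),
     smult = (\<lambda>c p. Poly_Mapping.single 0 c * p)\<rparr>"

definition word_deg :: "'g letter list \<Rightarrow> 'g::comm_monoid_add" where
  "word_deg w = (\<Sum>l\<leftarrow>w. ldeg l)"

definition free_comp :: "'g::comm_monoid_add set \<Rightarrow> 'g \<Rightarrow> ('g, 'a::field) falg set" where
  "free_comp G g =
     {p \<in> carrier (free_alg G). \<forall>w\<in>Poly_Mapping.keys p. word_deg (letters w) = g}"

definition star_letter :: "'g letter \<Rightarrow> 'g letter" where
  "star_letter l = Letter (idx l) (ldeg l) (\<not> starred l)"

definition star_word :: "'g letter list \<Rightarrow> 'g letter list" where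
  "star_word w = rev (map star_letter w)"

definition star_poly :: "('g, 'a::field) falg \<Rightarrow> ('g, 'a) falg" where
  "star_poly p = (\<Sum>w\<in>Poly_Mapping.keys p.
     Poly_Mapping.single (Word (star_word (letters w))) (Poly_Mapping.lookup p w))"

definition graded_star_endo ::
    "'g::comm_monoid_add set \<Rightarrow> (('g, 'a::field) falg \<Rightarrow> ('g, 'a) falg) \<Rightarrow> bool" where
  "graded_star_endo G \<phi> \<longleftrightarrow>
     \<phi> \<in> Ring.ring_hom (free_alg G) (free_alg G) \<and>
     (\<forall>c. \<forall>p\<in>carrier (free_alg G).
        \<phi> (c \<odot>\<^bsub>free_alg G\<^esub> p) = c \<odot>\<^bsub>free_alg G\<^esub> \<phi> p) \<and>
     (\<forall>g\<in>G. \<phi> ` free_comp G g \<subseteq> free_comp G g) \<and>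
     (\<forall>p\<in>carrier (free_alg G). \<phi> (star_poly p) = star_poly (\<phi> p))"

definition T_star_ideal :: "'g::comm_monoid_add set \<Rightarrow> ('g, 'a::field) falg set \<Rightarrow> bool" where
  "T_star_ideal G I \<longleftrightarrow>
     ideal I (free_alg G) \<and> star_poly ` I \<subseteq> I \<and>
     (\<forall>\<phi>. graded_star_endo G \<phi> \<longrightarrow> \<phi> ` I \<subseteq> I)"

definition T_star_basis ::
    "'g::comm_monoid_add set \<Rightarrow> ('g, 'a::field) falg set \<Rightarrow> ('g, 'a) falg set \<Rightarrow> bool" where
  "T_star_basis G P T \<longleftrightarrow>
     T_star_ideal G T \<and> P \<subseteq> T \<and> (\<forall>I. T_star_ideal G I \<and> P \<subseteq> I \<longrightarrow> T \<subseteq> I)"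


text \<open>Evaluation in an algebra of \<open>m \<times> m\<close> matrices with involution \<open>star\<close>, where
  \<open>a i g\<close> is substituted for \<open>x\<^sub>i\<^sub>,\<^sub>g\<close>.\<close>

definition eval_word ::
    "nat \<Rightarrow> ('a::field mat \<Rightarrow> 'a mat) \<Rightarrow> (nat \<Rightarrow> 'g \<Rightarrow> 'a mat) \<Rightarrow> 'g letter list \<Rightarrow> 'a mat" where
  "eval_word m star a w = foldr (\<lambda>l B.
     (if starred l then star (a (idx l) (ldeg l)) else a (idx l) (ldeg l)) * B) w (1\<^sub>m m)"

definition eval_poly ::
    "nat \<Rightarrow> ('a::field mat \<Rightarrow> 'a mat) \<Rightarrow> (nat \<Rightarrow> 'g \<Rightarrow> 'a mat) \<Rightarrow> ('g, 'a) falg \<Rightarrow> 'a mat" where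
  "eval_poly m star a p = mat m m (\<lambda>ij. \<Sum>w\<in>Poly_Mapping.keys p.
     Poly_Mapping.lookup p w * eval_word m star a (letters w) $$ ij)"

definition T_star ::
    "'g set \<Rightarrow> nat \<Rightarrow> ('g \<Rightarrow> 'a::field mat set) \<Rightarrow> ('a mat \<Rightarrow> 'a mat) \<Rightarrow> ('g, 'a) falg set" where
  "T_star G m U star = {p \<in> carrier (free_alg G).
     \<forall>a. (\<forall>i. \<forall>g\<in>G. a i g \<in> U g) \<longrightarrow> eval_poly m star a p = 0\<^sub>m m m}"

text \<open>\<open>P\<^sub>n\<close>: the positions of a multilinear word are numbered from 1.\<close>

definition multilinear_words :: "'g set \<Rightarrow> nat \<Rightarrow> 'g letter list set" where
  "multilinear_words G n = {map (\<lambda>i. Letter (\<sigma> i) (g i) (\<delta> i)) [1..<Suc n] | \<sigma> g \<delta>.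
     \<sigma> permutes {1..n} \<and> (\<forall>i\<in>{1..n}. g i \<in> G)}"

definition multilinear :: "'g set \<Rightarrow> nat \<Rightarrow> ('g, 'a::field) falg set" where
  "multilinear G n =
     LinearCombinations.module.span class_ring (free_alg G) (word_mono ` multilinear_words G n)"


text \<open>The quotient vector space \<open>V / W\<close>.  The fields
  \<open>mult\<close> and \<open>one\<close> of the module record play no role.  The summand \<open>W\<close> in the scalar
  multiplication is needed for \<open>c = 0\<close> only.\<close>

definition quot_space :: "('a, 'v, 'm) module_scheme \<Rightarrow> 'v set \<Rightarrow> ('a, 'v set) module" where
  "quot_space V W = \<lparr>
     carrier = a_rcosets\<^bsub>V\<^esub> W, mult = undefined, one = undefined,
     zero = W, add = set_add V,
     smult = (\<lambda>c X. W <+>\<^bsub>V\<^esub> ((\<lambda>x. c \<odot>\<^bsub>V\<^esub> x) ` X))\<rparr>"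


text \<open>Rows, columns and list positions are numbered from 0, so \<open>E\<^sub>i\<^sub>,\<^sub>j\<close> is the
  matrix unit at position \<open>(i - 1, j - 1)\<close>.\<close>

definition UT :: "nat \<Rightarrow> 'a::field mat set" where
  "UT m = {A \<in> carrier_mat m m. upper_triangular A}"

text \<open>The span of the \<open>E\<^sub>i\<^sub>,\<^sub>j\<close>, \<open>i \<le> j\<close>, with \<open>\<gamma>\<^sub>i - \<gamma>\<^sub>j = g\<close>.\<close>

definition elem_comp :: "'g::ab_group_add list \<Rightarrow> 'g \<Rightarrow> 'a::field mat set" where
  "elem_comp \<gamma> g = {A \<in> UT (length \<gamma>).
     \<forall>i j. i \<le> j \<and> j < length \<gamma> \<and> A $$ (i, j) \<noteq> 0 \<longrightarrow> \<gamma> ! i - \<gamma> ! j = g}"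

definition reflection :: "nat \<Rightarrow> 'a::field mat \<Rightarrow> 'a mat" where
  "reflection r A = mat (2 * r) (2 * r) (\<lambda>(i, j). A $$ (2 * r - 1 - j, 2 * r - 1 - i))"

definition symp_diag :: "nat \<Rightarrow> 'a::field mat" where
  "symp_diag r = four_block_mat (1\<^sub>m r) (0\<^sub>m r r) (0\<^sub>m r r) (- 1\<^sub>m r)"

text \<open>Here \<^const>\<open>symp_diag\<close> is its own inverse.\<close>

definition symplectic :: "nat \<Rightarrow> 'a::field mat \<Rightarrow> 'a mat" where
  "symplectic r A = symp_diag r * reflection r A * symp_diag r"

text \<open>\<open>\<int>\<^sup>r\<close> as a subgroup of the finitely supported functions \<open>\<nat> \<Rightarrow> \<int>\<close>.\<close>

definition Zpow :: "nat \<Rightarrow> (nat \<Rightarrow>\<^sub>0 int) set" where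
  "Zpow r = {v. Poly_Mapping.keys v \<subseteq> {1..r}}"

abbreviation unit_vec_Z :: "nat \<Rightarrow> (nat \<Rightarrow>\<^sub>0 int)" ("\<e>") where
  "\<e> i \<equiv> Poly_Mapping.single i 1"

text \<open>\<open>(e\<^sub>1, \<dots>, e\<^sub>r, 0, e\<^sub>r - e\<^sub>r\<^sub>-\<^sub>1, \<dots>, e\<^sub>r - e\<^sub>1)\<close>\<close>

definition finest_tuple :: "nat \<Rightarrow> (nat \<Rightarrow>\<^sub>0 int) list" where
  "finest_tuple r = map \<e> [1..<Suc r] @ [0] @ map (\<lambda>i. \<e> r - \<e> i) (rev [1..<r])"

definition UT_comp :: "nat \<Rightarrow> (nat \<Rightarrow>\<^sub>0 int) \<Rightarrow> 'a::field mat set" where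
  "UT_comp r g = elem_comp (finest_tuple r) g"

definition UT_dim :: "'a::field itself \<Rightarrow> nat \<Rightarrow> (nat \<Rightarrow>\<^sub>0 int) \<Rightarrow> nat" where
  "UT_dim ty r g = vectorspace.dim class_ring
     ((module_mat ty (2 * r) (2 * r))\<lparr>carrier := UT_comp r g\<rparr>)"

definition UT_identities :: "nat \<Rightarrow> (nat \<Rightarrow>\<^sub>0 int, 'a::field) falg set" where
  "UT_identities r = T_star (Zpow r) (2 * r) (UT_comp r) (symplectic r)"

definition generators :: "nat \<Rightarrow> (nat \<Rightarrow>\<^sub>0 int, 'a::field) falg set" where
  "generators r =
     {word_mono [Letter 1 0 False, Letter 2 0 False] - word_mono [Letter 2 0 False, Letter 1 0 False]} \<union>
     {word_mono [Letter 1 g True] + word_mono [Letter 1 g False] | g. g \<in> Zpow r \<and> UT_dim TYPE('a) r g = 1} \<union>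
     {M. \<exists>n g. n \<in> {1..3} \<and> (\<forall>i\<in>{1..n}. g i \<in> Zpow r \<and> g i \<noteq> 0) \<and>
        M = word_mono (map (\<lambda>i. Letter i (g i) False) [1..<Suc n]) \<and> M \<in> UT_identities r}"

text \<open>Conditions (I)--(III) on the decomposition \<open>M\<^sub>1 x\<^sub>1 M\<^sub>2 \<dots> M\<^sub>k x\<^sub>k M\<^sub>k\<^sub>+\<^sub>1\<close> of a word, where
  the \<open>x\<^sub>i\<close> are the letters of nonzero degree.  The block \<open>Ms ! i\<close> immediately
  precedes the letter \<open>xs ! i\<close>.\<close>

definition good_word ::
    "('g \<Rightarrow> nat) \<Rightarrow> 'g::comm_monoid_add letter list \<Rightarrow> bool" where
  "good_word d w \<longleftrightarrow> (\<exists>Ms xs.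
     length Ms = length xs + 1 \<and>
     w = concat (map2 (\<lambda>M x. M @ [x]) (butlast Ms) xs) @ last Ms \<and>
     (\<forall>x\<in>set xs. ldeg x \<noteq> 0) \<and>
     (\<forall>M\<in>set Ms. \<forall>x\<in>set M. ldeg x = 0) \<and>
     (\<forall>M\<in>set Ms. sorted_wrt (<) (map idx M)) \<and>
     (\<forall>i<length xs. d (ldeg (xs ! i)) = 1 \<longrightarrow> \<not> starred (xs ! i) \<and> Ms ! i = []) \<and>
     (\<forall>i j. i < j \<and> j < length xs \<and> d (\<Sum>l=i..j. ldeg (xs ! l)) = 1 \<longrightarrow>
        Ms ! i = [] \<and> idx (xs ! i) < idx (xs ! j)))"

definition good_monomials :: "nat \<Rightarrow> nat \<Rightarrow> (nat \<Rightarrow>\<^sub>0 int, 'a::field) falg set" where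
  "good_monomials r n = {word_mono w | w.
     w \<in> multilinear_words (Zpow r) n \<and>
     word_mono w \<notin> (UT_identities r :: (nat \<Rightarrow>\<^sub>0 int, 'a) falg set) \<and>
     good_word (UT_dim TYPE('a) r) w}"

text \<open>The canonical map of \<open>V\<close> onto \<open>V / W\<close> sends \<open>v\<close> to \<open>W + v\<close>.  Being a basis is read
  for families: the elements of \<open>B\<close> have to stay distinct in the quotient.\<close>

definition basis_mod :: "('a::field, 'v, 'm) module_scheme \<Rightarrow> 'v set \<Rightarrow> 'v set \<Rightarrow> bool" where
  "basis_mod V W B \<longleftrightarrow>
     inj_on (\<lambda>v. W +>\<^bsub>V\<^esub> v) B \<and>
     vectorspace.basis class_ring (quot_space V W) ((\<lambda>v. W +>\<^bsub>V\<^esub> v) ` B)"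

end

theory Submission
  imports Defs
begin

text \<open>
  Under a substitution of generic matrices, the entry at \<open>(p, q)\<close> of the value of a word is, up to
  sign, the product of the matrix entries met along the unique path from \<open>p\<close> to \<open>q\<close> whose steps have
  the degrees of the letters. A degree \<open>g \<noteq> 0\<close> is realised only by some \<open>E\<^sub>i\<^sub>,\<^sub>j\<close> and its mirror image, and
  \<open>dim U\<^sub>g = 1\<close> means that the two coincide. The identities allow one to sort letters of degree 0, to
  replace a factor \<open>u\<close> of such a symmetric degree by \<open>- u\<^sup>*\<close>, and to move letters of degree 0 across
  \<open>u\<close>. A word that is minimal under these moves is good. Conversely, two good words using the same
  matrix entries between the same end points are equal: at the first position where they differ, both
  paths are at the same state \<open>p\<close>, and conditions (I)--(III) are violated in one of them, according to
  whether the paths reach the mirror image of \<open>p\<close>. Hence substituting matrix units shows that the good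
  monomials are independent modulo the identities. For an arbitrary identity one compares coefficients
  of the monomials in the generic entries; words with the same monomial agree up to sign modulo the
  listed identities, because after numbering the positions of their letters they have the same
  good form.
\<close>

section \<open>The free algebra\<close>

text \<open>The obstacle is that a matrix position does not reveal whether the letter using it is
  starred, so an entry determines a step of the path only up to mirroring. This is why uniqueness of
  good words is decided at a state \<open>p\<close> by asking whether the path reaches
  \<open>mir r p\<close>: the factors leading from a state to its mirror image are those to which
  conditions (II) and (III) apply. Rewriting is carried out only up to sign. The sign is recovered
  at the end by evaluating on matrices whose admissible entries are all 1. Such an evaluation says
  something about an ideal only if the ideal consists of identities; therefore an arbitrary ideal
  containing the generators is first intersected with the ideal of all identities. Characteristic
  zero is used when coefficients of monomials in the generic entries are compared: a polynomial
  function that vanishes on an infinite field has zero coefficients.\<close>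

lemma sum_singles: "p = (\<Sum>w\<in>Poly_Mapping.keys p. Poly_Mapping.single w (Poly_Mapping.lookup p w))"
  by (rule poly_mapping_eqI) (auto simp: lookup_sum lookup_single when_def in_keys_iff)

definition fcarrier :: "'g set \<Rightarrow> ('g, 'a::field) falg set" where
  "fcarrier G = {p. \<forall>w\<in>Poly_Mapping.keys p. letters w \<in> words G}"

lemma fcarrierI: "(\<And>w. w \<in> Poly_Mapping.keys p \<Longrightarrow> letters w \<in> words G) \<Longrightarrow> p \<in> fcarrier G"
  and fcarrierD: "p \<in> fcarrier G \<Longrightarrow> w \<in> Poly_Mapping.keys p \<Longrightarrow> letters w \<in> words G"
  by (auto simp: fcarrier_def)

lemma free_alg_simps [simp]:
  "carrier (free_alg G) = fcarrier G"
  "x \<otimes>\<^bsub>free_alg G\<^esub> y = x * y"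
  "\<one>\<^bsub>free_alg G\<^esub> = 1"
  "\<zero>\<^bsub>free_alg G\<^esub> = 0"
  "x \<oplus>\<^bsub>free_alg G\<^esub> y = x + y"
  "c \<odot>\<^bsub>free_alg G\<^esub> x = Poly_Mapping.single 0 c * x"
  by (simp_all add: free_alg_def fcarrier_def)

lemma words_append [simp]: "u @ v \<in> words G \<longleftrightarrow> u \<in> words G \<and> v \<in> words G"
  and words_Nil [simp]: "[] \<in> words G"
  and words_Cons [simp]: "l # w \<in> words G \<longleftrightarrow> ldeg l \<in> G \<and> w \<in> words G"
  by (auto simp: words_def)

lemma fcarrier_single [simp]: "letters w \<in> words G \<Longrightarrow> Poly_Mapping.single w c \<in> fcarrier G"
  by (simp add: fcarrier_def)

lemma fcarrier_zero [simp]: "0 \<in> fcarrier G"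
  and fcarrier_one [simp]: "1 \<in> fcarrier G"
  by (simp_all add: fcarrier_def zero_word_def)

lemma fcarrier_add [intro]: "p \<in> fcarrier G \<Longrightarrow> q \<in> fcarrier G \<Longrightarrow> p + q \<in> fcarrier G"
  using Poly_Mapping.keys_add[of p q] by (auto simp: fcarrier_def)

lemma fcarrier_uminus [intro]: "p \<in> fcarrier G \<Longrightarrow> - p \<in> fcarrier G"
  by (auto simp: fcarrier_def in_keys_iff)

lemma fcarrier_diff [intro]: "p \<in> fcarrier G \<Longrightarrow> q \<in> fcarrier G \<Longrightarrow> p - q \<in> fcarrier G"
  using fcarrier_add[of p G "- q"] fcarrier_uminus[of q G] by simp

lemma fcarrier_mult [intro]: "p \<in> fcarrier G \<Longrightarrow> q \<in> fcarrier G \<Longrightarrow> p * q \<in> fcarrier G"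
  using keys_mult[of p q] by (fastforce simp: fcarrier_def plus_word_def)

lemma fcarrier_smult [intro]: "p \<in> fcarrier G \<Longrightarrow> Poly_Mapping.single 0 c * p \<in> fcarrier G"
  by (rule fcarrier_mult) (simp_all add: zero_word_def)

lemma fcarrier_sum [intro]: "(\<And>x. x \<in> A \<Longrightarrow> f x \<in> fcarrier G) \<Longrightarrow> sum f A \<in> fcarrier G"
  by (induction A rule: infinite_finite_induct) auto

lemma fcarrier_word_mono [simp]: "w \<in> words G \<Longrightarrow> word_mono w \<in> fcarrier G"
  by (simp add: word_mono_def)

lemma mult_single_words:
  "Poly_Mapping.single v c * Poly_Mapping.single w d
     = Poly_Mapping.single (Word (letters v @ letters w)) (c * d :: 'a::field)"
  by (simp add: mult_single plus_word_def)

lemma smult_single: "Poly_Mapping.single 0 c * Poly_Mapping.single w d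
    = Poly_Mapping.single w (c * d :: 'a::field)"
  by (simp add: mult_single)

lemma word_mono_append: "word_mono (u @ v) = word_mono u * word_mono v"
  by (simp add: word_mono_def mult_single_words)

lemma word_mono_Nil: "word_mono [] = 1"
  using single_one by (simp add: word_mono_def flip: zero_word_def)

lemma single_eq_smult: "Poly_Mapping.single w c = Poly_Mapping.single 0 c * word_mono (letters w)"
  by (simp add: word_mono_def smult_single)

lemma ring_free_alg: "ring (free_alg G)"
proof (rule ringI)
  show "abelian_group (free_alg G)"
  proof (rule abelian_groupI)
    show "\<exists>y\<in>carrier (free_alg G). y \<oplus>\<^bsub>free_alg G\<^esub> x = \<zero>\<^bsub>free_alg G\<^esub>" if "x \<in> carrier (free_alg G)" for x
      using that fcarrier_uminus[of x] by (intro bexI[of _ "- x"]) simp_all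
  qed (auto simp: algebra_simps intro: fcarrier_add fcarrier_zero)
  show "monoid (free_alg G)"
    by (rule monoidI)
      (auto simp: algebra_simps intro: fcarrier_mult fcarrier_one)
qed (auto simp: algebra_simps)

lemma a_inv_free_alg:
  assumes "x \<in> fcarrier G"
  shows "\<ominus>\<^bsub>free_alg G\<^esub> x = - x"
proof -
  interpret ring "free_alg G" by (rule ring_free_alg)
  show ?thesis
    using assms fcarrier_uminus[OF assms] by (intro minus_equality) simp_all
qed

lemma ideal_free_algI:
  assumes "I \<subseteq> fcarrier G" "0 \<in> I"
    and add: "\<And>p q. p \<in> I \<Longrightarrow> q \<in> I \<Longrightarrow> p + q \<in> I"
    and neg: "\<And>p. p \<in> I \<Longrightarrow> - p \<in> I"
    and "\<And>p c. p \<in> I \<Longrightarrow> c \<in> fcarrier G \<Longrightarrow> c * p \<in> I"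
    and "\<And>p c. p \<in> I \<Longrightarrow> c \<in> fcarrier G \<Longrightarrow> p * c \<in> I"
  shows "ideal I (free_alg G)"
proof (rule idealI[OF ring_free_alg])
  interpret ring "free_alg G" by (rule ring_free_alg)
  show "subgroup I (add_monoid (free_alg G))"
  proof (rule add.subgroupI)
    show "I \<noteq> {}" using assms(2) by blast
    fix a b assume a: "a \<in> I" and b: "b \<in> I"
    then show "\<ominus>\<^bsub>free_alg G\<^esub> a \<in> I"
      using neg assms(1) by (subst a_inv_free_alg) auto
    from a b show "a \<oplus>\<^bsub>free_alg G\<^esub> b \<in> I" using add by simp
  qed (use assms in auto)
qed (use assms in auto)

lemma
  assumes "T_star_ideal G I"
  shows T_star_ideal_carrier: "I \<subseteq> fcarrier G"
    and T_star_ideal_zero: "0 \<in> I"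
    and T_star_ideal_add: "p \<in> I \<Longrightarrow> q \<in> I \<Longrightarrow> p + q \<in> I"
    and T_star_ideal_uminus: "p \<in> I \<Longrightarrow> - p \<in> I"
    and T_star_ideal_diff: "p \<in> I \<Longrightarrow> q \<in> I \<Longrightarrow> p - q \<in> I"
    and T_star_ideal_lmult: "p \<in> I \<Longrightarrow> c \<in> fcarrier G \<Longrightarrow> c * p \<in> I"
    and T_star_ideal_rmult: "p \<in> I \<Longrightarrow> c \<in> fcarrier G \<Longrightarrow> p * c \<in> I"
    and T_star_ideal_endo: "p \<in> I \<Longrightarrow> graded_star_endo G \<phi> \<Longrightarrow> \<phi> p \<in> I"
proof -
  interpret ideal I "free_alg G" using assms by (simp add: T_star_ideal_def)
  show carr: "I \<subseteq> fcarrier G" using a_subset by simp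
  show "0 \<in> I" using additive_subgroup.zero_closed[OF is_additive_subgroup] by simp
  show plus: "p + q \<in> I" if "p \<in> I" "q \<in> I" for p q
    using additive_subgroup.a_closed[OF is_additive_subgroup] that by simp
  show neg: "- p \<in> I" if "p \<in> I" for p
    using additive_subgroup.a_inv_closed[OF is_additive_subgroup that]
    by (metis a_inv_free_alg carr subsetD that)
  show "p - q \<in> I" if "p \<in> I" "q \<in> I" for p q
    using plus[OF that(1) neg[OF that(2)]] by simp
  show "c * p \<in> I" if "p \<in> I" "c \<in> fcarrier G" for p c using I_l_closed that by simp
  show "p * c \<in> I" if "p \<in> I" "c \<in> fcarrier G" for p c using I_r_closed that by simp
  show "p \<in> I \<Longrightarrow> graded_star_endo G \<phi> \<Longrightarrow> \<phi> p \<in> I" for p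
    using assms by (auto simp: T_star_ideal_def)
qed

lemma T_star_ideal_smult:
  "T_star_ideal G I \<Longrightarrow> p \<in> I \<Longrightarrow> Poly_Mapping.single 0 c * p \<in> I"
  by (rule T_star_ideal_lmult) (simp_all add: zero_word_def)

lemma T_star_ideal_sum:
  "T_star_ideal G I \<Longrightarrow> (\<And>x. x \<in> A \<Longrightarrow> f x \<in> I) \<Longrightarrow> sum f A \<in> I"
  by (induction A rule: infinite_finite_induct) (auto intro: T_star_ideal_zero T_star_ideal_add)

text \<open>Used at the end to shrink an arbitrary ideal containing the generators to one that
  consists of identities, so that its elements can be evaluated.\<close>

lemma T_star_ideal_Int:
  assumes I: "T_star_ideal G I" and J: "T_star_ideal G J"
  shows "T_star_ideal G (I \<inter> J)"
proof -
  have "ideal (I \<inter> J) (free_alg G)"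
    using T_star_ideal_carrier[OF I]
    by (intro ideal_free_algI)
      (auto intro: T_star_ideal_zero T_star_ideal_add T_star_ideal_uminus T_star_ideal_lmult
        T_star_ideal_rmult I J)
  then show ?thesis
    using I J unfolding T_star_ideal_def by blast
qed

section \<open>Linear extension of maps on words\<close>

definition lin_ext :: "('w \<Rightarrow> 'a \<Rightarrow> 'b::comm_monoid_add) \<Rightarrow> ('w \<Rightarrow>\<^sub>0 'a::zero) \<Rightarrow> 'b" where
  "lin_ext f p = (\<Sum>w\<in>Poly_Mapping.keys p. f w (Poly_Mapping.lookup p w))"

context
  fixes f :: "'w \<Rightarrow> 'a::comm_monoid_add \<Rightarrow> 'b::comm_monoid_add"
  assumes f_zero: "\<And>w. f w 0 = 0" and f_add: "\<And>w x y. f w (x + y) = f w x + f w y"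
begin

lemma lin_ext_superset:
  assumes "finite A" "Poly_Mapping.keys p \<subseteq> A"
  shows "lin_ext f p = (\<Sum>w\<in>A. f w (Poly_Mapping.lookup p w))"
  unfolding lin_ext_def using assms f_zero
  by (intro sum.mono_neutral_left) (auto simp: in_keys_iff)

lemma lin_ext_add: "lin_ext f (p + q) = lin_ext f p + lin_ext f q"
  using Poly_Mapping.keys_add[of p q]
  by (simp add: lin_ext_superset[of "Poly_Mapping.keys p \<union> Poly_Mapping.keys q"]
      lookup_add f_add sum.distrib)

lemma lin_ext_single: "lin_ext f (Poly_Mapping.single w c) = f w c"
  by (simp add: lin_ext_superset[of "{w}"])

lemma lin_ext_zero: "lin_ext f 0 = 0"
  by (simp add: lin_ext_def)

lemma lin_ext_sum: "lin_ext f (sum h A) = (\<Sum>x\<in>A. lin_ext f (h x))"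
  by (induction A rule: infinite_finite_induct) (simp_all add: lin_ext_zero lin_ext_add)

end

lemma lin_ext_scale:
  fixes g :: "'w \<Rightarrow> 'a::field"
  shows "lin_ext (\<lambda>w c. c * g w) (p + q) = lin_ext (\<lambda>w c. c * g w) p + lin_ext (\<lambda>w c. c * g w) q"
    and "lin_ext (\<lambda>w c. c * g w) (Poly_Mapping.single w c) = c * g w"
    and "lin_ext (\<lambda>w c. c * g w) 0 = 0"
  by (rule lin_ext_add lin_ext_single lin_ext_zero; simp add: algebra_simps)+

text \<open>Both the involution (\<open>star_word\<close>) and the substitution endomorphisms
  (\<open>subst_word\<close>) are linear extensions of maps on words, so they share their linearity
  facts.\<close>

definition map_words :: "('g letter list \<Rightarrow> 'g letter list) \<Rightarrow> ('g, 'a::field) falg \<Rightarrow> ('g, 'a) falg" where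
  "map_words \<theta> = lin_ext (\<lambda>w. Poly_Mapping.single (Word (\<theta> (letters w))))"

lemma map_words_add: "map_words \<theta> (p + q) = map_words \<theta> p + map_words \<theta> q"
  and map_words_single: "map_words \<theta> (Poly_Mapping.single w c) = Poly_Mapping.single (Word (\<theta> (letters w))) c"
  and map_words_zero: "map_words \<theta> 0 = 0"
  and map_words_sum: "map_words \<theta> (sum h A) = (\<Sum>x\<in>A. map_words \<theta> (h x))"
  unfolding map_words_def
  by (rule lin_ext_add lin_ext_single lin_ext_zero lin_ext_sum; simp add: single_add)+

lemma map_words_word_mono: "map_words \<theta> (word_mono w) = word_mono (\<theta> w)"
  by (simp add: word_mono_def map_words_single)

lemma map_words_diff: "map_words \<theta> (p - q) = map_words \<theta> p - map_words \<theta> q"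
  by (metis add_diff_cancel_right' diff_add_cancel map_words_add)

lemma star_poly_eq: "star_poly = map_words star_word"
  by (rule ext) (simp add: star_poly_def map_words_def lin_ext_def)

lemma keys_map_words:
  assumes "u \<in> Poly_Mapping.keys (map_words \<theta> p)"
  obtains w where "w \<in> Poly_Mapping.keys p" "letters u = \<theta> (letters w)"
proof -
  have "Poly_Mapping.keys (map_words \<theta> p)
      \<subseteq> (\<Union>w\<in>Poly_Mapping.keys p. Poly_Mapping.keys (Poly_Mapping.single (Word (\<theta> (letters w))) (Poly_Mapping.lookup p w)))"
    unfolding map_words_def lin_ext_def by (rule Poly_Mapping.keys_sum)
  with assms show ?thesis
    using that by (auto split: if_splits)
qed

lemma fcarrier_induct:
  assumes "p \<in> fcarrier G"
    and "P 0" "\<And>w c. w \<in> words G \<Longrightarrow> P (Poly_Mapping.single (Word w) c)"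
    and "\<And>p q. p \<in> fcarrier G \<Longrightarrow> q \<in> fcarrier G \<Longrightarrow> P p \<Longrightarrow> P q \<Longrightarrow> P (p + q)"
  shows "P p"
proof -
  have "P (\<Sum>w\<in>A. Poly_Mapping.single w (Poly_Mapping.lookup p w))"
    if "finite A" "A \<subseteq> Poly_Mapping.keys p" for A
    using that
  proof (induction A rule: finite_induct)
    case (insert w A)
    have "letters w \<in> words G" using assms(1) insert.prems by (auto dest: fcarrierD)
    moreover have "(\<Sum>w\<in>A. Poly_Mapping.single w (Poly_Mapping.lookup p w)) \<in> fcarrier G"
      using assms(1) insert.prems by (intro fcarrier_sum fcarrier_single) (auto dest: fcarrierD)
    ultimately show ?case
      using insert assms(3)[of "letters w"] by (simp add: assms(4))
  qed (simp add: assms(2))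
  from this[OF finite_keys order_refl] show ?thesis
    using sum_singles[of p] by simp
qed

lemma map_words_mult:
  assumes "\<And>u v. \<theta> (u @ v) = \<theta> u @ \<theta> v"
  shows "map_words \<theta> (p * q) = map_words \<theta> p * map_words \<theta> q"
proof -
  have "map_words \<theta> (p * q) = (\<Sum>v\<in>Poly_Mapping.keys p. \<Sum>w\<in>Poly_Mapping.keys q.
      Poly_Mapping.single (Word (\<theta> (letters v))) (Poly_Mapping.lookup p v) *
      Poly_Mapping.single (Word (\<theta> (letters w))) (Poly_Mapping.lookup q w))"
    by (subst sum_singles[of p], subst sum_singles[of q])
      (simp add: sum_distrib_left sum_distrib_right map_words_sum mult_single_words map_words_single
        assms sum.swap[of _ "Poly_Mapping.keys q"])
  also have "\<dots> = map_words \<theta> p * map_words \<theta> q"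
    by (simp add: map_words_def lin_ext_def sum_distrib_left sum_distrib_right
        sum.swap[of _ "Poly_Mapping.keys q"])
  finally show ?thesis .
qed

lemma map_words_comp: "map_words \<theta> (map_words \<eta> p) = map_words (\<theta> \<circ> \<eta>) p"
  by (subst (1 2) sum_singles[of p]) (simp add: map_words_sum map_words_single)

text \<open>Replacing each variable by a word of its degree is enough to derive all consequences of
  the generators; the image of a starred variable is forced by compatibility with the
  involution.\<close>

definition subst_word :: "(nat \<Rightarrow> 'g \<Rightarrow> 'g letter list) \<Rightarrow> 'g letter list \<Rightarrow> 'g letter list" where
  "subst_word \<sigma> w = concat (map (\<lambda>l. if starred l then star_word (\<sigma> (idx l) (ldeg l))
     else \<sigma> (idx l) (ldeg l)) w)"

lemma star_letter_simps [simp]: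
  "idx (star_letter l) = idx l" "ldeg (star_letter l) = ldeg l"
  "starred (star_letter l) = (\<not> starred l)" "star_letter (star_letter l) = l"
  by (simp_all add: star_letter_def)

lemma star_word_simps [simp]:
  "star_word [] = []" "star_word (u @ v) = star_word v @ star_word u"
  "star_word (star_word w) = w"
  by (simp_all add: star_word_def rev_map comp_def)

lemma star_word_Cons: "star_word (l # w) = star_word w @ [star_letter l]"
  by (simp add: star_word_def)

lemma star_word_single [simp]: "star_word [l] = [star_letter l]"
  by (simp add: star_word_def)

lemma star_word_in_words [simp]: "star_word w \<in> words G \<longleftrightarrow> w \<in> words G"
  by (auto simp: words_def star_word_def)

lemma word_deg_simps [simp]:
  "word_deg [] = 0" "word_deg (l # w) = ldeg l + word_deg w"
  "word_deg (u @ v) = word_deg u + word_deg v"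
  by (simp_all add: word_deg_def)

lemma word_deg_star [simp]: "word_deg (star_word w) = word_deg w"
  by (induction w) (simp_all add: star_word_Cons add.commute)

lemma subst_word_simps [simp]:
  "subst_word \<sigma> [] = []" "subst_word \<sigma> (u @ v) = subst_word \<sigma> u @ subst_word \<sigma> v"
  "subst_word \<sigma> (l # w) = (if starred l then star_word (\<sigma> (idx l) (ldeg l))
     else \<sigma> (idx l) (ldeg l)) @ subst_word \<sigma> w"
  by (simp_all add: subst_word_def)

lemma subst_word_star: "subst_word \<sigma> (star_word w) = star_word (subst_word \<sigma> w)"
  by (induction w) (simp_all add: star_word_Cons)

lemma graded_star_endo_subst:
  assumes "\<And>i g. g \<in> G \<Longrightarrow> \<sigma> i g \<in> words G \<and> word_deg (\<sigma> i g) = g"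
  shows "graded_star_endo G (map_words (subst_word \<sigma>) :: ('g::comm_monoid_add, 'a::field) falg \<Rightarrow> _)"
proof -
  let ?\<theta> = "subst_word \<sigma>"
  have words: "?\<theta> w \<in> words G \<and> word_deg (?\<theta> w) = word_deg w" if "w \<in> words G" for w
    using that assms by (induction w) auto
  have closed: "map_words ?\<theta> p \<in> fcarrier G" if "p \<in> fcarrier G" for p :: "('g, 'a) falg"
    using that words by (auto intro!: fcarrierI elim!: keys_map_words dest!: fcarrierD)
  have "map_words ?\<theta> 1 = (1 :: ('g, 'a) falg)"
    using map_words_word_mono[of ?\<theta> "[]"] by (simp add: word_mono_Nil)
  then have "map_words ?\<theta> \<in> Ring.ring_hom (free_alg G) (free_alg G :: ('a, ('g, 'a) falg) module)"
    using closed by (intro ring_hom_memI) (auto simp: map_words_add map_words_mult)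
  moreover have "map_words ?\<theta> (c \<odot>\<^bsub>free_alg G\<^esub> p) = c \<odot>\<^bsub>free_alg G\<^esub> map_words ?\<theta> p" for c and p :: "('g, 'a) falg"
    using map_words_single[of ?\<theta> 0 c] by (simp add: map_words_mult zero_word_def)
  moreover have "map_words ?\<theta> ` free_comp G g \<subseteq> (free_comp G g :: ('g, 'a) falg set)" for g
    using closed words by (fastforce simp: free_comp_def elim!: keys_map_words dest!: fcarrierD)
  moreover have "map_words ?\<theta> (star_poly p) = star_poly (map_words ?\<theta> p)" for p :: "('g, 'a) falg"
    by (simp add: star_poly_eq map_words_comp comp_def subst_word_star)
  ultimately show ?thesis
    unfolding graded_star_endo_def by blast
qed

section \<open>The finest grading\<close>

definition gam :: "nat \<Rightarrow> nat \<Rightarrow> (nat \<Rightarrow>\<^sub>0 int)" where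
  "gam r i = finest_tuple r ! i"

text \<open>The reflection moves the entry at \<open>(i, j)\<close> to
  \<open>(mir r j, mir r i)\<close>.\<close>

definition mir :: "nat \<Rightarrow> nat \<Rightarrow> nat" where
  "mir r i = 2 * r - 1 - i"

lemma length_finest_tuple: "r \<ge> 1 \<Longrightarrow> length (finest_tuple r) = 2 * r"
  by (simp add: finest_tuple_def)

lemma gam_left: "i < r \<Longrightarrow> gam r i = \<e> (i + 1)"
  by (simp add: gam_def finest_tuple_def nth_append del: upt_Suc)

lemma gam_right:
  assumes "r \<le> i" "i < 2 * r"
  shows "gam r i = \<e> r - \<e> (2 * r - i)"
proof (cases "i = r")
  case True
  then show ?thesis
    by (simp add: gam_def finest_tuple_def nth_append del: upt_Suc)
next
  case False
  define k where "k = i - r - 1"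
  have "i = r + 1 + k" "k < r - 1"
    using assms False by (auto simp: k_def)
  moreover from this have "rev [1..<r] ! k = 2 * r - i"
    by (simp add: rev_nth)
  ultimately show ?thesis
    by (simp add: gam_def finest_tuple_def nth_append rev_map del: upt_Suc)
qed

lemma mir_mir [simp]: "i < 2 * r \<Longrightarrow> mir r (mir r i) = i"
  and mir_less [simp]: "i < 2 * r \<Longrightarrow> mir r i < 2 * r"
  by (auto simp: mir_def)

lemma mir_neq: "i < 2 * r \<Longrightarrow> mir r i \<noteq> i"
  unfolding mir_def by presburger

lemma mir_inject [simp]: "i < 2 * r \<Longrightarrow> j < 2 * r \<Longrightarrow> mir r i = mir r j \<longleftrightarrow> i = j"
  by (auto simp: mir_def)

lemma mir_less_mir: "i < 2 * r \<Longrightarrow> j < 2 * r \<Longrightarrow> mir r i < mir r j \<longleftrightarrow> j < i"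
  and mir_le_mir: "i < 2 * r \<Longrightarrow> j < 2 * r \<Longrightarrow> mir r i \<le> mir r j \<longleftrightarrow> j \<le> i"
  by (auto simp: mir_def)

text \<open>This explains the shape of the tuple: the labels of mirrored states add up to the
  constant e_r, so a position and its mirror image have the same degree and the involution is
  graded.\<close>

lemma gam_mir: "i < 2 * r \<Longrightarrow> gam r (mir r i) = \<e> r - gam r i"
proof (cases "i < r")
  case True
  then have "r \<le> mir r i" "2 * r - mir r i = i + 1" "mir r i < 2 * r"
    by (auto simp: mir_def)
  then show ?thesis using True by (simp add: gam_left gam_right)
next
  case False
  assume "i < 2 * r"
  with False have "mir r i < r" "mir r i + 1 = 2 * r - i"
    by (auto simp: mir_def)
  then show ?thesis using False \<open>i < 2 * r\<close> by (simp only: gam_left gam_right) simp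
qed

lemma gam_diff_mir:
  "i < 2 * r \<Longrightarrow> j < 2 * r \<Longrightarrow> gam r (mir r j) - gam r (mir r i) = gam r i - gam r j"
  by (simp add: gam_mir)

lemma lookup_unit: "Poly_Mapping.lookup (\<e> i) k = (if i = k then 1 else 0)"
  by (simp add: lookup_single when_def)

lemma unit_eq_iff [simp]: "\<e> i = \<e> j \<longleftrightarrow> i = j"
  by (metis lookup_unit zero_neq_one)

lemma unit_sum2_eqD:
  assumes "\<e> a + \<e> b = \<e> c + \<e> d"
  shows "a = c \<and> b = d \<or> a = d \<and> b = c"
proof -
  have *: "(if a = k then 1 else 0) + (if b = k then 1 else 0)
      = (if c = k then 1 else 0) + (if d = k then 1 else (0::int))" for k
    using arg_cong[OF assms, of "\<lambda>p. Poly_Mapping.lookup p k"] by (simp only: lookup_add lookup_unit)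
  show ?thesis using *[of a] *[of b] by (auto split: if_splits)
qed

text \<open>The sum of the coordinates is 2 on the left and 3 on the right.\<close>

lemma unit_sum_neq: "\<e> a + \<e> b \<noteq> \<e> c + \<e> d + \<e> f"
proof
  define s where "s = (\<lambda>p :: nat \<Rightarrow>\<^sub>0 int. lin_ext (\<lambda>w c. c * (1::int)) p)"
  have add: "s (p + q) = s p + s q" and single: "s (\<e> i) = 1" for p q i
    unfolding s_def by (subst lin_ext_add lin_ext_single; simp)+
  assume "\<e> a + \<e> b = \<e> c + \<e> d + \<e> f"
  then have "s (\<e> a + \<e> b) = s (\<e> c + \<e> d + \<e> f)" by simp
  then show False by (simp add: add single)
qed

lemma gam_diff_left: "i < j \<Longrightarrow> j < r \<Longrightarrow> gam r i - gam r j = \<e> (i + 1) - \<e> (j + 1)"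
  by (simp add: gam_left)

lemma gam_diff_cross:
  assumes "i < r" "r \<le> j" "j < 2 * r"
  shows "gam r i - gam r j = \<e> (i + 1) + \<e> (mir r j + 1) - \<e> r"
proof -
  have "mir r j < r" using assms by (auto simp: mir_def)
  then show ?thesis
    using gam_mir[of "mir r j" r] assms by (simp add: gam_left)
qed

text \<open>A step inside the first half has degree e_a - e_b, with coordinate sum 0; a step into
  the second half has degree e_a + e_b - e_r, with coordinate sum 1. Within each kind the indices
  can be read off, in the second kind only up to order, and exchanging them amounts to
  mirroring.\<close>

lemma gam_diff_eqD:
  assumes c: "c < d" "d < 2 * r" and c': "c' < d'" "d' < 2 * r"
    and eq: "gam r c - gam r d = gam r c' - gam r d'"
  shows "c' = c \<and> d' = d \<or> c' = mir r d \<and> d' = mir r c"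
proof -
  have *: "c' = c \<and> d' = d \<or> c' = mir r d \<and> d' = mir r c"
    if "c < r" "c' < r" "c < d" "d < 2 * r" "c' < d'" "d' < 2 * r"
      "gam r c - gam r d = gam r c' - gam r d'" for c d c' d'
  proof -
    consider "d < r" "d' < r" | "d < r" "r \<le> d'" | "r \<le> d" "d' < r" | "r \<le> d" "r \<le> d'"
      by linarith
    then show ?thesis
    proof cases
      case 1
      then have "\<e> (c + 1) + \<e> (d' + 1) = \<e> (c' + 1) + \<e> (d + 1)"
        using that by (simp add: gam_diff_left algebra_simps)
      from unit_sum2_eqD[OF this] that show ?thesis by auto
    next
      case 2
      then have "\<e> (c + 1) + \<e> r = \<e> (c' + 1) + \<e> (mir r d' + 1) + \<e> (d + 1)"
        using that by (simp add: gam_diff_left gam_diff_cross algebra_simps)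
      with unit_sum_neq show ?thesis by blast
    next
      case 3
      then have "\<e> (c' + 1) + \<e> r = \<e> (c + 1) + \<e> (mir r d + 1) + \<e> (d' + 1)"
        using that by (simp add: gam_diff_left gam_diff_cross algebra_simps)
      with unit_sum_neq show ?thesis by blast
    next
      case 4
      then have "\<e> (c + 1) + \<e> (mir r d + 1) = \<e> (c' + 1) + \<e> (mir r d' + 1)"
        using that by (simp add: gam_diff_cross algebra_simps)
      from unit_sum2_eqD[OF this] that show ?thesis by (auto simp: mir_def)
    qed
  qed
  \<comment> \<open>The mirror image of a step that starts in the second half starts in the first
    half and has the same degree. Here the second step is mirrored if necessary, below the first
    one.\<close>
  have **: "c' = c \<and> d' = d \<or> c' = mir r d \<and> d' = mir r c"
    if "c < r" "c < d" "d < 2 * r" "c' < d'" "d' < 2 * r"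
      "gam r c - gam r d = gam r c' - gam r d'" for c d c' d'
  proof (cases "c' < r")
    case False
    then have "mir r d' < r" "mir r d' < mir r c'" "mir r c' < 2 * r"
      using that by (auto simp: mir_def)
    with *[of c "mir r d'" d "mir r c'"] that
    have "mir r d' = c \<and> mir r c' = d \<or> mir r d' = mir r d \<and> mir r c' = mir r c"
      by (simp add: gam_diff_mir)
    then show ?thesis using that by (metis less_trans mir_mir)
  qed (use * that in blast)
  show ?thesis
  proof (cases "c < r")
    case False
    then have "mir r d < r" "mir r d < mir r c" "mir r c < 2 * r"
      using c by (auto simp: mir_def)
    with **[of "mir r d" "mir r c" c' d'] c c' eq
    have "c' = mir r d \<and> d' = mir r c \<or> c' = c \<and> d' = d"
      by (simp add: gam_diff_mir)
    then show ?thesis by blast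
  qed (use ** c c' eq in blast)
qed

text \<open>Makes paths deterministic: a state and a degree leave at most one next state.\<close>

lemma gam_inj:
  assumes "c < 2 * r" "d < 2 * r" "gam r c = gam r d"
  shows "c = d"
proof -
  have *: "\<not> c < d" if "c < 2 * r" "d < 2 * r" "gam r c = gam r d" for c d
  proof
    assume "c < d"
    show False
    proof (cases "d < r")
      case True
      then show False using that \<open>c < d\<close> by (simp add: gam_left)
    next
      case d: False
      show False
      proof (cases "c < r")
        case True
        then have "\<e> (c + 1) + \<e> (mir r d + 1) = \<e> r"
          using that d gam_diff_cross[of c r d] by simp
        then have "\<e> r + \<e> r = \<e> (c + 1) + \<e> (mir r d + 1) + \<e> r" by simp
        with unit_sum_neq show False by blast
      next
        case False
        then have "mir r d < mir r c" "mir r c < r"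
          using that \<open>c < d\<close> by (auto simp: mir_def)
        moreover have "gam r (mir r d) = gam r (mir r c)"
          using that by (simp add: gam_mir)
        ultimately show False by (simp add: gam_left)
      qed
    qed
  qed
  show ?thesis using *[of c d] *[of d c] assms by force
qed

section \<open>Homogeneous components and their dimensions\<close>

lemma Zpow_zero [simp]: "0 \<in> Zpow r"
  by (simp add: Zpow_def)

lemma Zpow_add [intro]: "g \<in> Zpow r \<Longrightarrow> h \<in> Zpow r \<Longrightarrow> g + h \<in> Zpow r"
  using Poly_Mapping.keys_add[of g h] by (auto simp: Zpow_def)

lemma word_deg_Zpow: "w \<in> words (Zpow r) \<Longrightarrow> word_deg w \<in> Zpow r"
  by (induction w) auto

text \<open>A position is read as a step from its row to its column; the paths of the proof are
  composed of such steps. Diagonal positions are loops of degree 0.\<close>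

definition edges :: "nat \<Rightarrow> (nat \<Rightarrow>\<^sub>0 int) \<Rightarrow> (nat \<times> nat) set" where
  "edges r g = {(c, d). c \<le> d \<and> d < 2 * r \<and> gam r c - gam r d = g}"

lemma UT_comp_iff:
  assumes "r \<ge> 1"
  shows "A \<in> UT_comp r g \<longleftrightarrow> A \<in> carrier_mat (2 * r) (2 * r) \<and>
    (\<forall>i<2*r. \<forall>j<2*r. A $$ (i, j) \<noteq> 0 \<longrightarrow> (i, j) \<in> edges r g)"
proof -
  have *: "A \<in> UT_comp r g \<longleftrightarrow> A \<in> carrier_mat (2 * r) (2 * r) \<and> (\<forall>i<2*r. \<forall>j<i. A $$ (i, j) = 0) \<and>
      (\<forall>i j. i \<le> j \<and> j < 2*r \<and> A $$ (i, j) \<noteq> 0 \<longrightarrow> gam r i - gam r j = g)"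
  proof (cases "A \<in> carrier_mat (2 * r) (2 * r)")
    case True
    then have "upper_triangular A \<longleftrightarrow> (\<forall>i<2*r. \<forall>j<i. A $$ (i, j) = 0)"
      by (simp only: upper_triangular_def carrier_matD(1))
    then show ?thesis
      by (simp only: UT_comp_def elem_comp_def UT_def gam_def length_finest_tuple[OF assms] True
          mem_Collect_eq conj_assoc simp_thms)
  qed (simp add: UT_comp_def elem_comp_def UT_def length_finest_tuple[OF assms])
  have "(\<forall>i<2*r. \<forall>j<i. A $$ (i, j) = 0) \<and>
      (\<forall>i j. i \<le> j \<and> j < 2*r \<and> A $$ (i, j) \<noteq> 0 \<longrightarrow> gam r i - gam r j = g) \<longleftrightarrow>
      (\<forall>i<2*r. \<forall>j<2*r. A $$ (i, j) \<noteq> 0 \<longrightarrow> (i, j) \<in> edges r g)" (is "?L \<longleftrightarrow> ?R")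
  proof
    assume L: ?L
    show ?R
    proof (intro allI impI)
      fix i j assume ij: "i < 2 * r" "j < 2 * r" "A $$ (i, j) \<noteq> 0"
      with L have "\<not> j < i" by blast
      with L ij have "i \<le> j" "gam r i - gam r j = g" by auto
      with ij show "(i, j) \<in> edges r g" by (simp add: edges_def)
    qed
  next
    assume R: ?R
    have "A $$ (i, j) = 0" if "i < 2 * r" "j < i" for i j
    proof (rule ccontr)
      assume "A $$ (i, j) \<noteq> 0"
      moreover have "j < 2 * r" using that by linarith
      ultimately have "(i, j) \<in> edges r g" using R that(1) by blast
      with that show False by (simp add: edges_def)
    qed
    moreover have "gam r i - gam r j = g" if "i \<le> j" "j < 2 * r" "A $$ (i, j) \<noteq> 0" for i j
    proof -
      have "i < 2 * r" using that by linarith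
      with R that have "(i, j) \<in> edges r g" by blast
      then show ?thesis by (simp add: edges_def)
    qed
    ultimately show ?L by blast
  qed
  with * show ?thesis by (simp only: )
qed

text \<open>These are the degrees of the positions above the diagonal that mirroring fixes;
  \<open>UT_dim_eq_1\<close> identifies them with the degrees of one-dimensional components.\<close>

definition symm_degree :: "nat \<Rightarrow> (nat \<Rightarrow>\<^sub>0 int) \<Rightarrow> bool" where
  "symm_degree r g \<longleftrightarrow> (\<exists>c. c < mir r c \<and> mir r c < 2 * r \<and> g = gam r c - gam r (mir r c))"

lemma edges_symm_degree:
  assumes "c < mir r c" "mir r c < 2 * r"
  shows "edges r (gam r c - gam r (mir r c)) = {(c, mir r c)}"
proof -
  have "a = c \<and> b = mir r c" if ab: "a \<le> b" "b < 2 * r" "gam r a - gam r b = gam r c - gam r (mir r c)" for a b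
  proof -
    have "a \<noteq> b" using ab gam_inj[of c r "mir r c"] assms by auto
    with gam_diff_eqD[of c "mir r c" r a b] ab assms show ?thesis by auto
  qed
  then show ?thesis using assms by (auto simp: edges_def)
qed

lemma mirror_edge:
  "(c, d) \<in> edges r g \<Longrightarrow> (mir r d, mir r c) \<in> edges r g"
  by (auto simp: edges_def gam_diff_mir mir_le_mir)

lemma finite_edges: "finite (edges r g)"
  by (rule finite_subset[of _ "{..<2*r} \<times> {..<2*r}"]) (auto simp: edges_def)

text \<open>Mirroring permutes the positions of a given degree, so a single position must be its own
  mirror image.\<close>

lemma card_edges_eq_1:
  assumes "r \<ge> 1"
  shows "card (edges r g) = 1 \<longleftrightarrow> symm_degree r g"
proof
  assume "card (edges r g) = 1"
  then obtain c d where cd: "edges r g = {(c, d)}" by (auto simp: card_1_singleton_iff)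
  then have e: "(c, d) \<in> edges r g" by simp
  from mirror_edge[OF this] cd have "c = mir r d" "d = mir r c" by simp_all
  moreover have "c \<le> d" "d < 2 * r" "g = gam r c - gam r d" using e by (auto simp: edges_def)
  ultimately show "symm_degree r g"
    unfolding symm_degree_def using mir_neq[of c r] by (intro exI[of _ c]) force
next
  assume "symm_degree r g"
  then show "card (edges r g) = 1" by (auto simp: symm_degree_def edges_symm_degree)
qed

definition unit_mat :: "nat \<Rightarrow> nat \<times> nat \<Rightarrow> 'a::field mat" where
  "unit_mat m e = mat m m (\<lambda>ij. if ij = e then 1 else 0)"

lemma unit_mat_inj: "inj_on (unit_mat m :: _ \<Rightarrow> 'a::field mat) ({..<m} \<times> {..<m})"
proof (rule inj_onI)
  fix x y assume xy: "x \<in> {..<m} \<times> {..<m}" "y \<in> {..<m} \<times> {..<m}"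
    and "unit_mat m x = (unit_mat m y :: 'a mat)"
  then have "unit_mat m x $$ x = (unit_mat m y :: 'a mat) $$ x" by simp
  with xy show "x = y" by (auto simp: unit_mat_def split: if_splits)
qed

text \<open>The matrix units at the positions in \<open>edges r g\<close> form a basis of the
  component; the coordinates demanded by the criterion for a basis are the matrix entries.\<close>

lemma UT_dim_eq_card:
  assumes "r \<ge> 1"
  shows "UT_dim TYPE('a::field) r g = card (edges r g)"
proof -
  let ?m = "2 * r"
  let ?M = "module_mat TYPE('a) ?m ?m"
  let ?V = "?M\<lparr>carrier := UT_comp r g\<rparr>"
  let ?E = "edges r g"
  have sub: "?E \<subseteq> {..<?m} \<times> {..<?m}" by (auto simp: edges_def)
  interpret M: vectorspace class_ring ?M by (rule matrix_vs)
  have sm: "LinearCombinations.submodule class_ring (UT_comp r g) ?M"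
  proof (rule LinearCombinations.submodule.intro)
    show "UT_comp r g \<subseteq> carrier ?M"
      using UT_comp_iff[OF assms] by (auto simp: module_mat_simps)
    show "v \<oplus>\<^bsub>?M\<^esub> w \<in> UT_comp r g" if "v \<in> UT_comp r g" "w \<in> UT_comp r g" for v w
      using that by (simp add: UT_comp_iff[OF assms] module_mat_simps) fastforce
    show "c \<odot>\<^bsub>?M\<^esub> v \<in> UT_comp r g" if "v \<in> UT_comp r g" for c v
      using that by (auto simp: UT_comp_iff[OF assms] module_mat_simps)
  qed (simp_all add: module_mat_simps M.module_axioms UT_comp_iff[OF assms])
  interpret V: vectorspace class_ring ?V
    using M.subspace_is_vs[of "UT_comp r g"] sm by (simp add: VectorSpace.subspace_def M.vectorspace_axioms)
  let ?B = "unit_mat ?m ` ?E :: 'a mat set"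
  have BV: "?B \<subseteq> UT_comp r g"
    using sub by (auto simp: UT_comp_iff[OF assms] unit_mat_def split: if_splits)
  have fin: "finite ?B" using finite_edges by blast
  \<comment> \<open>The abstract sum of the restricted vector space is computed entry by entry,
    since \<open>lincomb\<close> is defined through it.\<close>
  have fs: "finsum ?V f A \<in> UT_comp r g \<and> (\<forall>i<?m. \<forall>j<?m. finsum ?V f A $$ (i, j) = (\<Sum>x\<in>A. f x $$ (i, j)))"
    if "finite A" "f \<in> A \<rightarrow> UT_comp r g" for f and A :: "'a mat set"
    using that
  proof (induction A rule: finite_induct)
    case empty
    then show ?case using V.zero_closed by (simp add: module_mat_simps)
  next
    case (insert x A)
    then have eq: "finsum ?V f (insert x A) = f x + finsum ?V f A"
      by (subst V.finsum_insert) (auto simp: module_mat_simps)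
    have mem: "f x \<in> UT_comp r g" "finsum ?V f A \<in> UT_comp r g" using insert by auto
    have sum: "f x + finsum ?V f A \<in> UT_comp r g"
      using V.add.m_closed[of "f x" "finsum ?V f A"] mem by (simp add: module_mat_simps)
    have car: "finsum ?V f A \<in> carrier_mat ?m ?m"
      using mem unfolding UT_comp_iff[OF assms] by blast
    have IH: "finsum ?V f A $$ (i, j) = (\<Sum>x\<in>A. f x $$ (i, j))" if "i < ?m" "j < ?m" for i j
      using insert that by simp
    have "(f x + finsum ?V f A) $$ (i, j) = (\<Sum>x\<in>insert x A. f x $$ (i, j))"
      if "i < ?m" "j < ?m" for i j
      using that insert.hyps carrier_matD[OF car] by (simp only: index_add_mat(1) IH sum.insert[OF insert.hyps(1,2)])
    then show ?case
      unfolding eq using sum by blast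
  qed
  have lc: "V.lincomb a ?B = (v :: 'a mat) \<longleftrightarrow> (\<forall>e\<in>?E. a (unit_mat ?m e) = v $$ e)"
    if v: "v \<in> UT_comp r g" for a v
  proof -
    have *: "V.lincomb a ?B $$ e = (if e \<in> ?E then a (unit_mat ?m e) else 0)"
      and mem: "V.lincomb a ?B \<in> UT_comp r g" if e: "e \<in> {..<?m} \<times> {..<?m}" for e
    proof -
      have f: "(\<lambda>v. a v \<cdot>\<^sub>m v) \<in> ?B \<rightarrow> UT_comp r g"
        using BV by (auto simp: UT_comp_iff[OF assms] subset_iff)
      show "V.lincomb a ?B \<in> UT_comp r g"
        unfolding V.lincomb_def using fs[OF fin f] by (simp add: module_mat_simps)
      have "V.lincomb a ?B $$ e = (\<Sum>x\<in>?B. (a x \<cdot>\<^sub>m x) $$ e)"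
        unfolding V.lincomb_def using fs[OF fin f] e by (auto simp: module_mat_simps)
      also have "\<dots> = (\<Sum>x\<in>?E. (a (unit_mat ?m x) \<cdot>\<^sub>m unit_mat ?m x) $$ e)"
        using unit_mat_inj sub by (subst sum.reindex) (auto intro: inj_on_subset)
      also have "\<dots> = (\<Sum>x\<in>?E. if x = e then a (unit_mat ?m x) else 0)"
        using e by (intro sum.cong) (auto simp: unit_mat_def split: if_splits)
      also have "\<dots> = (if e \<in> ?E then a (unit_mat ?m e) else 0)"
        using finite_edges by simp
      finally show "V.lincomb a ?B $$ e = (if e \<in> ?E then a (unit_mat ?m e) else 0)" .
    qed
    show ?thesis
    proof
      assume "V.lincomb a ?B = v"
      then show "\<forall>e\<in>?E. a (unit_mat ?m e) = v $$ e" using * sub by (metis (no_types) subsetD)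
    next
      assume R: "\<forall>e\<in>?E. a (unit_mat ?m e) = v $$ e"
      have "V.lincomb a ?B \<in> carrier_mat ?m ?m" "v \<in> carrier_mat ?m ?m"
        using mem[of "(0,0)"] v assms unfolding UT_comp_iff[OF assms] by simp_all
      then show "V.lincomb a ?B = v"
      proof (intro eq_matI)
        fix i j assume "i < dim_row v" "j < dim_col v"
        then have ij: "i < ?m" "j < ?m" using \<open>v \<in> carrier_mat ?m ?m\<close> by auto
        then have "v $$ (i, j) = 0" if "(i, j) \<notin> ?E"
          using v that unfolding UT_comp_iff[OF assms] by blast
        then show "V.lincomb a ?B $$ (i, j) = v $$ (i, j)"
          using *[of "(i, j)"] R ij by simp
      qed auto
    qed
  qed
  have "V.basis ?B"
  proof (subst V.basis_criterion)
    show "\<forall>v. v \<in> carrier ?V \<longrightarrow> (\<exists>!a. a \<in> ?B \<rightarrow>\<^sub>E carrier class_ring \<and> V.lincomb a ?B = v)"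
    proof (intro allI impI)
      fix v assume "v \<in> carrier ?V"
      then have v: "v \<in> UT_comp r g" by simp
      let ?a = "restrict (\<lambda>x. v $$ the_inv_into ({..<?m} \<times> {..<?m}) (unit_mat ?m) x) ?B"
      have inv: "the_inv_into ({..<?m} \<times> {..<?m}) (unit_mat ?m :: _ \<Rightarrow> 'a mat) (unit_mat ?m e) = e"
        if "e \<in> ?E" for e
        using sub that by (intro the_inv_into_f_f[OF unit_mat_inj]) auto
      show "\<exists>!a. a \<in> ?B \<rightarrow>\<^sub>E carrier class_ring \<and> V.lincomb a ?B = v"
      proof (rule ex1I[of _ ?a])
        show "?a \<in> ?B \<rightarrow>\<^sub>E carrier class_ring \<and> V.lincomb ?a ?B = v"
          by (simp add: lc[OF v] inv)
      next
        fix a assume "a \<in> ?B \<rightarrow>\<^sub>E carrier class_ring \<and> V.lincomb a ?B = v"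
        then have a: "a \<in> extensional ?B" "\<forall>e\<in>?E. a (unit_mat ?m e) = v $$ e"
          by (simp_all add: lc[OF v] PiE_def)
        show "a = ?a"
        proof (rule extensionalityI[OF a(1)])
          fix x assume "x \<in> ?B"
          then obtain e where "e \<in> ?E" "x = unit_mat ?m e" by blast
          then show "a x = ?a x" using a(2) inv by simp
        qed simp
      qed
    qed
  qed (use fin BV in auto)
  then have "V.dim = card ?B" using V.dim_basis fin by blast
  also have "\<dots> = card ?E" using sub by (intro card_image inj_on_subset[OF unit_mat_inj])
  finally show ?thesis by (simp add: UT_dim_def)
qed

lemma UT_dim_eq_1: "r \<ge> 1 \<Longrightarrow> UT_dim TYPE('a::field) r g = 1 \<longleftrightarrow> symm_degree r g"
  by (simp only: UT_dim_eq_card card_edges_eq_1)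

lemma symm_degree_nonzero: "symm_degree r g \<Longrightarrow> g \<noteq> 0"
  using gam_inj[of _ r "mir r _"] unfolding symm_degree_def by (metis eq_iff_diff_eq_0 less_trans less_irrefl)

section \<open>The symplectic involution and traces of words\<close>

text \<open>The diagonal of D. Its sign changes under \<open>mir\<close>, and therefore the
  involution is -1 on the positions fixed by mirroring.\<close>

definition sgn_half :: "nat \<Rightarrow> nat \<Rightarrow> 'a::field" where
  "sgn_half r i = (if i < r then 1 else - 1)"

lemma sgn_half_sq [simp]: "sgn_half r i * sgn_half r i = 1"
  by (simp add: sgn_half_def)

lemma sgn_half_sq_left [simp]: "sgn_half r i * (sgn_half r i * x) = x"
  by (simp flip: mult.assoc)

lemma sgn_half_mir: "i < 2 * r \<Longrightarrow> sgn_half r (mir r i) = - sgn_half r i"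
  by (auto simp: sgn_half_def mir_def)

lemma symp_diag_eq: "symp_diag r = mat_diag (2 * r) (sgn_half r)"
  unfolding symp_diag_def mat_diag_def
  by (rule eq_matI) (auto simp: sgn_half_def four_block_mat_def Let_def)

lemma reflection_carrier [simp]: "reflection r A \<in> carrier_mat (2 * r) (2 * r)"
  by (simp add: reflection_def)

lemma symplectic_carrier [simp]: "symplectic r A \<in> carrier_mat (2 * r) (2 * r)"
  by (rule carrier_matI) (simp_all add: symplectic_def symp_diag_eq mat_diag_def)

lemma symplectic_index:
  assumes "i < 2 * r" "j < 2 * r"
  shows "symplectic r A $$ (i, j) = sgn_half r i * sgn_half r j * A $$ (mir r j, mir r i)"
proof -
  have "symplectic r A = mat (2 * r) (2 * r) (\<lambda>(i, j). sgn_half r i * reflection r A $$ (i, j))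
      * mat_diag (2 * r) (sgn_half r)"
    by (simp only: symplectic_def symp_diag_eq mat_diag_mult_left[OF reflection_carrier])
  also have "\<dots> = mat (2 * r) (2 * r) (\<lambda>(i, j). sgn_half r i * reflection r A $$ (i, j) * sgn_half r j)"
    by (subst mat_diag_mult_right) (auto intro!: eq_matI)
  finally show ?thesis using assms by (simp add: reflection_def mir_def)
qed

lemma symplectic_dims [simp]: "dim_row (symplectic r A) = 2 * r" "dim_col (symplectic r A) = 2 * r"
  using symplectic_carrier[of r A] by (auto simp del: symplectic_carrier)

lemma symplectic_symplectic:
  assumes "A \<in> carrier_mat (2 * r) (2 * r)"
  shows "symplectic r (symplectic r A) = A"
  using assms
  by (intro eq_matI) (auto simp: symplectic_index sgn_half_mir mult.assoc)

lemma bij_mir: "bij_betw (mir r) {..<2 * r} {..<2 * r}"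
  by (rule bij_betwI[of _ _ _ "mir r"]) auto

text \<open>Each summand contains the sign of the intermediate index twice, so the signs of D inside
  the product cancel; the sum is then reindexed by \<open>mir\<close>.\<close>

lemma symplectic_mult:
  assumes A: "A \<in> carrier_mat (2 * r) (2 * r)" and B: "B \<in> carrier_mat (2 * r) (2 * r)"
  shows "symplectic r (A * B) = symplectic r B * symplectic r A"
proof (rule eq_matI)
  fix i j assume "i < dim_row (symplectic r B * symplectic r A)" "j < dim_col (symplectic r B * symplectic r A)"
  then have ij: "i < 2 * r" "j < 2 * r" by simp_all
  have "(symplectic r B * symplectic r A) $$ (i, j)
      = (\<Sum>k\<in>{..<2*r}. symplectic r B $$ (i, k) * symplectic r A $$ (k, j))"
    using ij by (simp add: scalar_prod_def lessThan_atLeast0)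
  also have "\<dots> = (\<Sum>k\<in>{..<2*r}. sgn_half r i * sgn_half r j * (A $$ (mir r j, mir r k) * B $$ (mir r k, mir r i)))"
  proof (intro sum.cong refl)
    fix k assume "k \<in> {..<2*r}"
    then have "symplectic r B $$ (i, k) * symplectic r A $$ (k, j)
      = (sgn_half r i * sgn_half r k * B $$ (mir r k, mir r i)) * (sgn_half r k * sgn_half r j * A $$ (mir r j, mir r k))"
      using ij by (simp add: symplectic_index)
    also have "\<dots> = sgn_half r k * (sgn_half r k * (sgn_half r i * sgn_half r j * (A $$ (mir r j, mir r k) * B $$ (mir r k, mir r i))))"
      by (simp only: mult_ac)
    finally show "symplectic r B $$ (i, k) * symplectic r A $$ (k, j)
      = sgn_half r i * sgn_half r j * (A $$ (mir r j, mir r k) * B $$ (mir r k, mir r i))"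
      by (simp only: sgn_half_sq_left)
  qed
  also have "\<dots> = sgn_half r i * sgn_half r j * (\<Sum>k\<in>{..<2*r}. A $$ (mir r j, mir r k) * B $$ (mir r k, mir r i))"
    by (simp add: sum_distrib_left)
  also have "(\<Sum>k\<in>{..<2*r}. A $$ (mir r j, mir r k) * B $$ (mir r k, mir r i))
      = (\<Sum>k\<in>{..<2*r}. A $$ (mir r j, k) * B $$ (k, mir r i))"
    by (rule sum.reindex_bij_betw[OF bij_mir])
  also have "\<dots> = (A * B) $$ (mir r j, mir r i)"
    using ij A B by (simp add: scalar_prod_def lessThan_atLeast0)
  finally show "symplectic r (A * B) $$ (i, j) = (symplectic r B * symplectic r A) $$ (i, j)"
    using ij by (simp add: symplectic_index)
qed auto

lemma UT_compD:
  assumes "r \<ge> 1" "A \<in> UT_comp r g"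
  shows "A \<in> carrier_mat (2 * r) (2 * r)"
    and "i < 2 * r \<Longrightarrow> j < 2 * r \<Longrightarrow> (i, j) \<notin> edges r g \<Longrightarrow> A $$ (i, j) = 0"
  using assms(2) unfolding UT_comp_iff[OF assms(1)] by blast+

lemma edges_mir_iff:
  "i < 2 * r \<Longrightarrow> j < 2 * r \<Longrightarrow> (mir r j, mir r i) \<in> edges r g \<longleftrightarrow> (i, j) \<in> edges r g"
  using mirror_edge[of i j r g] mirror_edge[of "mir r j" "mir r i" r g] by auto

lemma UT_comp_symplectic:
  assumes "r \<ge> 1" "A \<in> UT_comp r g"
  shows "symplectic r A \<in> UT_comp r g"
proof -
  have "(i, j) \<in> edges r g" if "i < 2 * r" "j < 2 * r" "symplectic r A $$ (i, j) \<noteq> 0" for i j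
  proof -
    have "A $$ (mir r j, mir r i) \<noteq> 0" using that by (auto simp: symplectic_index)
    then show ?thesis using UT_compD(2)[OF assms, of "mir r j" "mir r i"] that edges_mir_iff by auto
  qed
  then show ?thesis unfolding UT_comp_iff[OF assms(1)] by simp
qed

section \<open>Paths followed by words\<close>

definition letter_edge :: "nat \<Rightarrow> 'g letter \<Rightarrow> nat \<Rightarrow> nat \<Rightarrow> nat \<times> nat" where
  "letter_edge r l c d = (if starred l then (mir r d, mir r c) else (c, d))"

text \<open>\<open>trace r p w es q\<close>: the degrees of the letters of \<open>w\<close> lead from row \<open>p\<close> to column \<open>q\<close>, and \<open>es\<close>
  lists the positions of the entries of the substituted matrices that are used.  A starred letter
  uses the mirrored position.\<close>

fun trace :: "nat \<Rightarrow> nat \<Rightarrow> (nat \<Rightarrow>\<^sub>0 int) letter list \<Rightarrow> (nat \<times> nat) list \<Rightarrow> nat \<Rightarrow> bool" where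
  "trace r p [] es q \<longleftrightarrow> es = [] \<and> p = q \<and> p < 2 * r"
| "trace r p (l # w) es q \<longleftrightarrow> (\<exists>d es'. (p, d) \<in> edges r (ldeg l) \<and>
     es = letter_edge r l p d # es' \<and> trace r d w es' q)"

lemma edgesD: "(c, d) \<in> edges r g \<Longrightarrow> c \<le> d \<and> c < 2 * r \<and> d < 2 * r \<and> gam r c - gam r d = g"
  by (simp add: edges_def)

lemma edges_det:
  assumes "(p, d) \<in> edges r g" "(p, d') \<in> edges r g"
  shows "d = d'"
proof -
  have "gam r d = gam r p - g" if "(p, d) \<in> edges r g" for d
    unfolding edgesD[OF that, THEN conjunct2, THEN conjunct2, THEN conjunct2, symmetric]
    by (simp add: diff_diff_eq2)
  then have "gam r d = gam r d'" using assms by metis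
  then show ?thesis by (rule gam_inj[rotated 2]) (use assms edgesD in blast)+
qed

lemma edges_codet:
  assumes "(c, p) \<in> edges r g" "(c', p) \<in> edges r g"
  shows "c = c'"
  using edges_det[OF mirror_edge[OF assms(1)] mirror_edge[OF assms(2)]] assms
  by (metis edgesD mir_mir)

lemma edges_zero: "(c, d) \<in> edges r 0 \<longleftrightarrow> c = d \<and> c < 2 * r"
  using gam_inj[of c r d] by (auto simp: edges_def)

lemma edges_nonzero: "(c, d) \<in> edges r g \<Longrightarrow> g \<noteq> 0 \<longleftrightarrow> c < d"
  using edges_zero[of c d r] by (auto simp: edges_def)

lemma trace_le: "trace r p w es q \<Longrightarrow> p \<le> q \<and> q < 2 * r"
  by (induction w arbitrary: p es) (use edgesD in fastforce)+

lemma trace_length: "trace r p w es q \<Longrightarrow> length es = length w"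
  by (induction w arbitrary: p es) auto

lemma trace_deg: "trace r p w es q \<Longrightarrow> word_deg w = gam r p - gam r q"
proof (induction w arbitrary: p es)
  case (Cons l w)
  then obtain d es' where "(p, d) \<in> edges r (ldeg l)" "trace r d w es' q" by auto
  then show ?case using Cons.IH edgesD[of p d r "ldeg l"] by (metis diff_add_cancel add_diff_eq word_deg_simps(2))
qed simp

lemma trace_append:
  "trace r p (u @ v) es q \<longleftrightarrow> (\<exists>d es1 es2. trace r p u es1 d \<and> trace r d v es2 q \<and> es = es1 @ es2)"
proof (induction u arbitrary: p es)
  case Nil
  then show ?case using trace_le by fastforce
next
  case (Cons l u)
  show ?case by (auto simp: Cons) (metis append_Cons)+
qed

lemma trace_det: "trace r p w es q \<Longrightarrow> trace r p w es' q' \<Longrightarrow> es = es' \<and> q = q'"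
proof (induction w arbitrary: p es es')
  case (Cons l w)
  then show ?case using edges_det by fastforce
qed simp

text \<open>The sign that D contributes at the starred letters. It is separated from the product of
  the entries because words are rewritten only up to sign.\<close>

definition trace_sign :: "nat \<Rightarrow> (nat \<Rightarrow>\<^sub>0 int) letter list \<Rightarrow> (nat \<times> nat) list \<Rightarrow> 'a::field" where
  "trace_sign r w es =
     prod_list (map (\<lambda>(l, e). if starred l then sgn_half r (fst e) * sgn_half r (snd e) else 1) (zip w es))"

lemma trace_sign_cases: "trace_sign r w es = (1 :: 'a::field) \<or> trace_sign r w es = (- 1 :: 'a)"
proof (induction w arbitrary: es)
  case (Cons l w)
  note IH = Cons.IH
  show ?case
  proof (cases es)
    case (Cons e es')
    then have "trace_sign r (l # w) es =
        (if starred l then sgn_half r (fst e) * sgn_half r (snd e) else 1) * (trace_sign r w es' :: 'a)"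
      by (simp add: trace_sign_def)
    with IH[of es'] show ?thesis by (auto simp: sgn_half_def)
  qed (simp add: trace_sign_def)
qed (simp add: trace_sign_def)

section \<open>Evaluation of words and polynomials\<close>

abbreviation ueval :: "nat \<Rightarrow> (nat \<Rightarrow> 'g \<Rightarrow> 'a::field mat) \<Rightarrow> 'g letter list \<Rightarrow> 'a mat" where
  "ueval r a w \<equiv> eval_word (2 * r) (symplectic r) a w"

definition letter_val :: "nat \<Rightarrow> (nat \<Rightarrow> 'g \<Rightarrow> 'a::field mat) \<Rightarrow> 'g letter \<Rightarrow> 'a mat" where
  "letter_val r a l = (if starred l then symplectic r (a (idx l) (ldeg l)) else a (idx l) (ldeg l))"

lemma ueval_simps [simp]:
  "ueval r a [] = 1\<^sub>m (2 * r)"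
  "ueval r a (l # w) = letter_val r a l * ueval r a w"
  by (simp_all add: eval_word_def letter_val_def)

context
  fixes r :: nat and a :: "nat \<Rightarrow> (nat \<Rightarrow>\<^sub>0 int) \<Rightarrow> 'a::field mat"
  assumes r: "r \<ge> 1" and a: "\<And>i g. a i g \<in> UT_comp r g"
begin

lemma letter_val_comp: "letter_val r a l \<in> UT_comp r (ldeg l)"
  using a[of "idx l" "ldeg l"] UT_comp_symplectic[OF r a[of "idx l" "ldeg l"]] by (simp add: letter_val_def)

lemma letter_val_carrier [simp]: "letter_val r a l \<in> carrier_mat (2 * r) (2 * r)"
  using UT_compD(1)[OF r letter_val_comp] .

lemma ueval_carrier [simp]: "ueval r a w \<in> carrier_mat (2 * r) (2 * r)"
  by (induction w) (auto intro: mult_carrier_mat[of _ _ "2 * r"])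

lemma ueval_append: "ueval r a (u @ v) = ueval r a u * ueval r a v"
proof (induction u)
  case (Cons l u)
  then show ?case by simp (subst assoc_mult_mat[of _ "2*r" "2*r" _ "2*r" _ "2*r"]; simp)
qed (simp add: left_mult_one_mat[OF ueval_carrier])

lemma ueval_star: "ueval r a (star_word w) = symplectic r (ueval r a w)"
proof (induction w)
  case Nil
  show ?case
    by (rule eq_matI) (auto simp: symplectic_index)
next
  case (Cons l w)
  have "letter_val r a (star_letter l) = symplectic r (letter_val r a l)"
    using UT_compD(1)[OF r a] by (simp add: letter_val_def symplectic_symplectic)
  then show ?case
    by (simp add: star_word_Cons ueval_append Cons symplectic_mult right_mult_one_mat[OF symplectic_carrier])
qed

text \<open>In row \<open>p\<close> a matrix of degree \<open>ldeg l\<close> has at most the entry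
  at \<open>(p, d)\<close>, so the sum in the matrix product reduces to one term.\<close>

lemma ueval_Cons_edge:
  assumes "(p, d) \<in> edges r (ldeg l)" "q < 2 * r"
  shows "ueval r a (l # w) $$ (p, q) = letter_val r a l $$ (p, d) * ueval r a w $$ (d, q)"
proof -
  have "ueval r a (l # w) $$ (p, q) = (\<Sum>k\<in>{..<2*r}. letter_val r a l $$ (p, k) * ueval r a w $$ (k, q))"
    using edgesD[OF assms(1)] assms(2) carrier_matD[OF letter_val_carrier] carrier_matD[OF ueval_carrier]
    by (simp add: scalar_prod_def lessThan_atLeast0)
  also have "\<dots> = (\<Sum>k\<in>{..<2*r}. if k = d then letter_val r a l $$ (p, d) * ueval r a w $$ (d, q) else 0)"
    using UT_compD(2)[OF r letter_val_comp, of p _ l] edges_det[OF assms(1)] edgesD[OF assms(1)]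
    by (intro sum.cong) auto
  also have "\<dots> = letter_val r a l $$ (p, d) * ueval r a w $$ (d, q)"
    using edgesD[OF assms(1)] by simp
  finally show ?thesis .
qed

lemma ueval_no_edge:
  assumes "\<And>d. (p, d) \<notin> edges r (ldeg l)" "p < 2 * r" "q < 2 * r"
  shows "ueval r a (l # w) $$ (p, q) = 0"
proof -
  have "ueval r a (l # w) $$ (p, q) = (\<Sum>k\<in>{..<2*r}. letter_val r a l $$ (p, k) * ueval r a w $$ (k, q))"
    using assms carrier_matD[OF letter_val_carrier] carrier_matD[OF ueval_carrier]
    by (simp add: scalar_prod_def lessThan_atLeast0)
  also have "\<dots> = 0"
    using UT_compD(2)[OF r letter_val_comp, of p _ l] assms by (intro sum.neutral) auto
  finally show ?thesis .
qed

lemma ueval_trace: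
  assumes "trace r p w es q"
  shows "ueval r a w $$ (p, q)
    = trace_sign r w es * prod_list (map (\<lambda>(l, e). a (idx l) (ldeg l) $$ e) (zip w es))"
  using assms
proof (induction w arbitrary: p es)
  case (Cons l w)
  then obtain d es' where d: "(p, d) \<in> edges r (ldeg l)" and
    es: "es = (if starred l then (mir r d, mir r p) else (p, d)) # es'" and tr: "trace r d w es' q"
    by (auto simp: letter_edge_def)
  \<comment> \<open>The signs of D at \<open>p\<close> and at \<open>d\<close> both change under
    mirroring, so their product may be read off at the mirrored position.\<close>
  have "letter_val r a l $$ (p, d) = (if starred l then sgn_half r (mir r d) * sgn_half r (mir r p) else 1)
      * a (idx l) (ldeg l) $$ (if starred l then (mir r d, mir r p) else (p, d))"
    using edgesD[OF d] by (simp add: letter_val_def symplectic_index sgn_half_mir)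
  moreover have "prod_list (map (\<lambda>(l, e). a (idx l) (ldeg l) $$ e) (zip (l # w) es))
      = a (idx l) (ldeg l) $$ (if starred l then (mir r d, mir r p) else (p, d))
        * prod_list (map (\<lambda>(l, e). a (idx l) (ldeg l) $$ e) (zip w es'))"
    by (simp add: es)
  moreover have "trace_sign r (l # w) es = (if starred l then sgn_half r (mir r d) * sgn_half r (mir r p) else 1)
      * (trace_sign r w es' :: 'a)"
    by (simp add: es trace_sign_def)
  moreover have "q < 2 * r" using trace_le[OF tr] by simp
  ultimately show ?case
    by (simp only: ueval_Cons_edge[OF d] Cons.IH[OF tr] mult.assoc mult.left_commute)
qed (simp add: trace_sign_def)

lemma ueval_no_trace:
  assumes "\<And>es. \<not> trace r p w es q" "p < 2 * r" "q < 2 * r"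
  shows "ueval r a w $$ (p, q) = 0"
  using assms
proof (induction w arbitrary: p)
  case (Cons l w)
  show ?case
  proof (cases "\<exists>d. (p, d) \<in> edges r (ldeg l)")
    case True
    then obtain d where d: "(p, d) \<in> edges r (ldeg l)" by blast
    then have "ueval r a w $$ (d, q) = 0" using Cons edgesD[OF d] by auto
    then show ?thesis using ueval_Cons_edge[OF d Cons.prems(3)] by simp
  next
    case False
    then show ?thesis using ueval_no_edge Cons.prems by blast
  qed
qed auto

lemma ueval_comp:
  shows "ueval r a w \<in> UT_comp r (word_deg w)"
proof -
  have "(p, q) \<in> edges r (word_deg w)" if pq: "p < 2 * r" "q < 2 * r" "ueval r a w $$ (p, q) \<noteq> 0" for p q
  proof -
    obtain es where "trace r p w es q" using ueval_no_trace[of p w q] pq by metis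
    from trace_deg[OF this] trace_le[OF this] show ?thesis by (simp add: edges_def)
  qed
  then show ?thesis unfolding UT_comp_iff[OF r] using ueval_carrier by blast
qed

end

abbreviation ueval_poly :: "nat \<Rightarrow> (nat \<Rightarrow> 'g \<Rightarrow> 'a::field mat) \<Rightarrow> ('g, 'a) falg \<Rightarrow> 'a mat" where
  "ueval_poly r a p \<equiv> eval_poly (2 * r) (symplectic r) a p"

lemma ueval_poly_index:
  "i < 2 * r \<Longrightarrow> j < 2 * r \<Longrightarrow>
    ueval_poly r a p $$ (i, j) = lin_ext (\<lambda>w c. c * ueval r a (letters w) $$ (i, j)) p"
  by (simp add: eval_poly_def lin_ext_def)

lemma ueval_poly_carrier [simp]: "ueval_poly r a p \<in> carrier_mat (2 * r) (2 * r)"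
  by (simp add: eval_poly_def)

lemma ueval_poly_dims [simp]: "dim_row (ueval_poly r a p) = 2 * r" "dim_col (ueval_poly r a p) = 2 * r"
  by (simp_all add: eval_poly_def)

lemma ueval_poly_add: "ueval_poly r a (p + q) = ueval_poly r a p + ueval_poly r a q"
  by (rule eq_matI) (simp_all add: ueval_poly_index lin_ext_scale)

lemma ueval_poly_zero: "ueval_poly r a 0 = 0\<^sub>m (2 * r) (2 * r)"
  by (rule eq_matI) (simp_all add: ueval_poly_index lin_ext_scale)

lemma ueval_poly_single:
  "i < 2 * r \<Longrightarrow> j < 2 * r \<Longrightarrow>
    ueval_poly r a (Poly_Mapping.single w c) $$ (i, j) = c * ueval r a (letters w) $$ (i, j)"
  by (simp add: ueval_poly_index lin_ext_scale)

lemma ueval_poly_single_mat: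
  assumes "ueval r a (letters w) \<in> carrier_mat (2 * r) (2 * r)"
  shows "ueval_poly r a (Poly_Mapping.single w c) = c \<cdot>\<^sub>m ueval r a (letters w)"
  using assms by (intro eq_matI) (auto simp: ueval_poly_single)

lemma ueval_poly_word_mono:
  assumes "ueval r a w \<in> carrier_mat (2 * r) (2 * r)"
  shows "ueval_poly r a (word_mono w) = ueval r a w"
  using assms by (intro eq_matI) (auto simp: word_mono_def ueval_poly_single)

lemma symplectic_add:
  assumes "A \<in> carrier_mat (2 * r) (2 * r)" "B \<in> carrier_mat (2 * r) (2 * r)"
  shows "symplectic r (A + B) = symplectic r A + symplectic r B"
  using assms by (intro eq_matI) (auto simp: symplectic_index distrib_left)

lemma symplectic_smult:
  assumes "A \<in> carrier_mat (2 * r) (2 * r)"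
  shows "symplectic r (c \<cdot>\<^sub>m A) = c \<cdot>\<^sub>m symplectic r A"
  using assms by (intro eq_matI) (auto simp: symplectic_index)

context
  fixes r :: nat and a :: "nat \<Rightarrow> (nat \<Rightarrow>\<^sub>0 int) \<Rightarrow> 'a::field mat"
  assumes r: "r \<ge> 1" and a: "\<And>i g. a i g \<in> UT_comp r g"
begin

lemmas ueval_carrier' [simp] = ueval_carrier[where a=a, OF r a]

lemma ueval_poly_mult: "ueval_poly r a (p * q) = ueval_poly r a p * ueval_poly r a q"
proof -
  have single: "ueval_poly r a (Poly_Mapping.single v c * q)
      = ueval_poly r a (Poly_Mapping.single v c) * ueval_poly r a q" for v c
  proof (rule fcarrier_induct[of q UNIV])
    show "q \<in> fcarrier UNIV" by (simp add: fcarrier_def words_def)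
    show "ueval_poly r a (Poly_Mapping.single v c * 0)
        = ueval_poly r a (Poly_Mapping.single v c) * ueval_poly r a 0"
      by (simp add: ueval_poly_zero)
  next
    fix w :: "(nat \<Rightarrow>\<^sub>0 int) letter list" and d :: 'a
    let ?V = "ueval r a (letters v)" and ?W = "ueval r a w"
    have "ueval_poly r a (Poly_Mapping.single v c * Poly_Mapping.single (Word w) d) = (c * d) \<cdot>\<^sub>m (?V * ?W)"
      by (simp only: mult_single_words ueval_poly_single_mat[OF ueval_carrier'] word.sel ueval_append[where a=a, OF r a])
    also have "\<dots> = (c \<cdot>\<^sub>m ?V) * (d \<cdot>\<^sub>m ?W)"
      by (subst mult_smult_assoc_mat[of _ "2*r" "2*r" _ "2*r"], simp, simp,
          subst mult_smult_distrib[of _ "2*r" "2*r" _ "2*r"], simp, simp)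
        (rule eq_matI; simp add: mult.assoc)
    finally show "ueval_poly r a (Poly_Mapping.single v c * Poly_Mapping.single (Word w) d)
        = ueval_poly r a (Poly_Mapping.single v c) * ueval_poly r a (Poly_Mapping.single (Word w) d)"
      by (simp add: ueval_poly_single_mat)
  next
    fix p q assume "ueval_poly r a (Poly_Mapping.single v c * p)
        = ueval_poly r a (Poly_Mapping.single v c) * ueval_poly r a p"
      "ueval_poly r a (Poly_Mapping.single v c * q)
        = ueval_poly r a (Poly_Mapping.single v c) * ueval_poly r a q"
    then show "ueval_poly r a (Poly_Mapping.single v c * (p + q))
        = ueval_poly r a (Poly_Mapping.single v c) * ueval_poly r a (p + q)"
      by (simp add: distrib_left ueval_poly_add
          mult_add_distrib_mat[OF ueval_poly_carrier ueval_poly_carrier ueval_poly_carrier])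
  qed
  show ?thesis
  proof (rule fcarrier_induct[of p UNIV])
    show "p \<in> fcarrier UNIV" by (simp add: fcarrier_def words_def)
    show "ueval_poly r a (0 * q) = ueval_poly r a 0 * ueval_poly r a q"
      by (simp add: ueval_poly_zero)
    fix p p' assume "ueval_poly r a (p * q) = ueval_poly r a p * ueval_poly r a q"
      "ueval_poly r a (p' * q) = ueval_poly r a p' * ueval_poly r a q"
    then show "ueval_poly r a ((p + p') * q) = ueval_poly r a (p + p') * ueval_poly r a q"
      by (simp add: distrib_right ueval_poly_add
          add_mult_distrib_mat[OF ueval_poly_carrier ueval_poly_carrier ueval_poly_carrier])
  qed (rule single)
qed

lemma ueval_poly_star: "ueval_poly r a (star_poly p) = symplectic r (ueval_poly r a p)"
proof (rule fcarrier_induct[of p UNIV])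
  show "p \<in> fcarrier UNIV" by (simp add: fcarrier_def words_def)
  show "ueval_poly r a (star_poly 0) = symplectic r (ueval_poly r a 0)"
    by (rule eq_matI) (simp_all add: star_poly_eq map_words_zero ueval_poly_zero symplectic_index)
  show "ueval_poly r a (star_poly (Poly_Mapping.single (Word w) c))
      = symplectic r (ueval_poly r a (Poly_Mapping.single (Word w) c))" for w c
    by (simp add: star_poly_eq map_words_single ueval_poly_single_mat ueval_star[where a=a, OF r a] symplectic_smult)
qed (simp add: star_poly_eq map_words_add ueval_poly_add symplectic_add)

lemma ueval_poly_comp:
  assumes "p \<in> free_comp G g"
  shows "ueval_poly r a p \<in> UT_comp r g"
proof -
  have "(i, j) \<in> edges r g" if ij: "i < 2 * r" "j < 2 * r" "ueval_poly r a p $$ (i, j) \<noteq> 0" for i j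
  proof (rule ccontr)
    assume "(i, j) \<notin> edges r g"
    have "ueval r a (letters w) $$ (i, j) = 0" if "w \<in> Poly_Mapping.keys p" for w
      using UT_compD(2)[OF r ueval_comp[where a=a, OF r a], of i j "letters w"] that assms ij \<open>(i, j) \<notin> edges r g\<close>
      by (auto simp: free_comp_def)
    then have "ueval_poly r a p $$ (i, j) = 0"
      using ij by (simp add: ueval_poly_index lin_ext_def)
    with ij show False by simp
  qed
  then show ?thesis
    unfolding UT_comp_iff[OF r] using ueval_poly_carrier by blast
qed

end

lemma zero_UT_comp: "r \<ge> 1 \<Longrightarrow> 0\<^sub>m (2 * r) (2 * r) \<in> UT_comp r g"
  by (simp add: UT_comp_iff)

lemma ueval_cong:
  "(\<And>i g. g \<in> G \<Longrightarrow> a i g = b i g) \<Longrightarrow> w \<in> words G \<Longrightarrow> eval_word m st a w = eval_word m st b w"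
  by (induction w) (auto simp: eval_word_def)

lemma UT_identities_iff:
  assumes "r \<ge> 1"
  shows "p \<in> UT_identities r \<longleftrightarrow> p \<in> fcarrier (Zpow r) \<and>
    (\<forall>a. (\<forall>i g. a i g \<in> UT_comp r g) \<longrightarrow> ueval_poly r a p = 0\<^sub>m (2 * r) (2 * r))"
proof -
  have "ueval_poly r a p = 0\<^sub>m (2 * r) (2 * r)"
    if p: "p \<in> fcarrier (Zpow r)" and *: "\<forall>a. (\<forall>i g. a i g \<in> UT_comp r g) \<longrightarrow> ueval_poly r a p = 0\<^sub>m (2 * r) (2 * r)"
      and a: "\<forall>i. \<forall>g\<in>Zpow r. a i g \<in> UT_comp r g" for a
  proof -
    define b where "b i g = (if g \<in> Zpow r then a i g else 0\<^sub>m (2 * r) (2 * r))" for i g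
    have "ueval_poly r b p = 0\<^sub>m (2 * r) (2 * r)"
    proof -
      have "b i g \<in> UT_comp r g" for i g
        using a by (simp add: b_def zero_UT_comp[OF assms])
      with * show ?thesis by blast
    qed
    moreover have "ueval_poly r a p = ueval_poly r b p"
      unfolding eval_poly_def
    proof (intro cong_mat refl sum.cong)
      fix i j w assume "w \<in> Poly_Mapping.keys p"
      then have "ueval r a (letters w) = ueval r b (letters w)"
        using p by (intro ueval_cong[of "Zpow r"]) (auto simp: b_def dest: fcarrierD)
      then show "Poly_Mapping.lookup p w * ueval r a (letters w) $$ (i, j)
          = Poly_Mapping.lookup p w * ueval r b (letters w) $$ (i, j)" by simp
    qed
    ultimately show ?thesis by simp
  qed
  then show ?thesis
    unfolding UT_identities_def T_star_def by auto
qed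

text \<open>Universal property of the free algebra: an evaluation composed with the endomorphism is
  determined by the values \<open>b\<close> of the images of the unstarred variables, because the
  endomorphism commutes with the involution. Invariance of the identities under endomorphisms
  follows.\<close>

lemma graded_star_endo_eval:
  assumes r: "r \<ge> 1" and a: "\<And>i g. a i g \<in> UT_comp r g"
    and \<phi>: "graded_star_endo (Zpow r) \<phi>"
  obtains b where "\<And>i g. b i g \<in> UT_comp r g"
    "\<And>p. p \<in> fcarrier (Zpow r) \<Longrightarrow> ueval_poly r a (\<phi> p) = ueval_poly r b (p :: (_, 'a::field) falg)"
proof -
  let ?G = "Zpow r"
  define b where "b i g = (if g \<in> ?G then ueval_poly r a (\<phi> (word_mono [Letter i g False])) else 0\<^sub>m (2 * r) (2 * r))" for i g
  have hom: "\<phi> \<in> Ring.ring_hom (free_alg ?G) (free_alg ?G :: ('a, (_, 'a) falg) module)"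
    using \<phi> by (simp add: graded_star_endo_def)
  have hom_one: "\<phi> 1 = 1" and hom_mult: "\<phi> (p * q) = \<phi> p * \<phi> q"
    and hom_add: "\<phi> (p + q) = \<phi> p + \<phi> q" if "p \<in> fcarrier ?G" "q \<in> fcarrier ?G" for p q
    using ring_hom_one[OF hom] ring_hom_mult[OF hom] ring_hom_add[OF hom] that by simp_all
  have hom_zero: "\<phi> 0 = 0"
    using hom_add[of 0 0] by simp
  have smult: "\<phi> (Poly_Mapping.single 0 c * p) = Poly_Mapping.single 0 c * \<phi> p"
    and star: "\<phi> (star_poly p) = star_poly (\<phi> p)" if "p \<in> fcarrier ?G" for c p
    using \<phi> that unfolding graded_star_endo_def by auto
  have b: "b i g \<in> UT_comp r g" for i g
  proof (cases "g \<in> ?G")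
    case True
    have "word_mono [Letter i g False] \<in> (free_comp ?G g :: (_, 'a) falg set)"
      using True by (simp add: free_comp_def word_mono_def fcarrier_def)
    then have "\<phi> (word_mono [Letter i g False]) \<in> free_comp ?G g"
      using \<phi> True unfolding graded_star_endo_def by blast
    from ueval_poly_comp[where a=a, OF r a this] show ?thesis using True by (simp add: b_def)
  qed (simp add: b_def zero_UT_comp[where r=r, OF r])
  have letter: "ueval_poly r a (\<phi> (word_mono [l])) = letter_val r b l" if l: "ldeg l \<in> ?G" for l
  proof (cases "starred l")
    case True
    have "word_mono [l] = star_poly (word_mono [star_letter l] :: (_, 'a) falg)"
      by (simp add: star_poly_eq map_words_word_mono)
    then have "ueval_poly r a (\<phi> (word_mono [l])) = symplectic r (ueval_poly r a (\<phi> (word_mono [star_letter l])))"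
      using l by (simp add: star ueval_poly_star[where a=a, OF r a])
    then show ?thesis
      using True l by (simp add: letter_val_def b_def star_letter_def)
  next
    case False
    then show ?thesis
      using l by (cases l) (simp add: letter_val_def b_def)
  qed
  have word: "ueval_poly r a (\<phi> (word_mono w)) = ueval r b w" if "w \<in> words ?G" for w
    using that
  proof (induction w)
    case Nil
    have "\<phi> (word_mono []) = word_mono []"
      using hom_one[of 0 0] by (simp add: word_mono_Nil)
    then show ?case
      using ueval_poly_word_mono[of r a "[]"] by simp
  next
    case (Cons l w)
    have "\<phi> (word_mono (l # w)) = \<phi> (word_mono [l]) * \<phi> (word_mono w)"
      using Cons.prems hom_mult[of "word_mono [l]" "word_mono w"]
      by (simp flip: word_mono_append)
    then show ?case
      using Cons letter by (simp add: ueval_poly_mult[where a=a, OF r a])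
  qed
  have "ueval_poly r a (\<phi> p) = ueval_poly r b p" if "p \<in> fcarrier ?G" for p
    using that
  proof (rule fcarrier_induct)
    show "ueval_poly r a (\<phi> 0) = ueval_poly r b 0"
      using hom_zero by (simp add: ueval_poly_zero)
  next
    fix w c assume w: "w \<in> words ?G"
    then have "ueval_poly r a (\<phi> (Poly_Mapping.single (Word w) c))
        = ueval_poly r a (Poly_Mapping.single 0 c) * ueval r b w"
      using single_eq_smult[of "Word w" c] word
      by (simp add: smult ueval_poly_mult[where a=a, OF r a])
    also have "\<dots> = c \<cdot>\<^sub>m ueval r b w"
      using ueval_carrier[where a=b, OF r b, of w]
      by (simp add: ueval_poly_single_mat zero_word_def mult_smult_assoc_mat[of _ "2*r" "2*r" _ "2*r"]
          left_mult_one_mat[of _ "2*r" "2*r"])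
    also have "\<dots> = ueval_poly r b (Poly_Mapping.single (Word w) c)"
      using ueval_carrier[where a=b, OF r b, of w] by (simp add: ueval_poly_single_mat)
    finally show "ueval_poly r a (\<phi> (Poly_Mapping.single (Word w) c))
        = ueval_poly r b (Poly_Mapping.single (Word w) c)" .
  next
    fix p q assume "p \<in> fcarrier ?G" "q \<in> fcarrier ?G" "ueval_poly r a (\<phi> p) = ueval_poly r b p"
      "ueval_poly r a (\<phi> q) = ueval_poly r b q"
    moreover from this have "\<phi> (p + q) = \<phi> p + \<phi> q" using hom_add[of p q] by simp
    ultimately show "ueval_poly r a (\<phi> (p + q)) = ueval_poly r b (p + q)"
      by (simp add: ueval_poly_add)
  qed
  with b that show ?thesis by blast
qed

lemma star_poly_fcarrier: "p \<in> fcarrier G \<Longrightarrow> star_poly p \<in> fcarrier G"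
  unfolding star_poly_eq by (auto intro!: fcarrierI elim!: keys_map_words dest!: fcarrierD)

lemma T_star_ideal_UT_identities:
  assumes r: "r \<ge> 1"
  shows "T_star_ideal (Zpow r) (UT_identities r :: (_, 'a::field) falg set)"
proof -
  let ?G = "Zpow r" and ?T = "UT_identities r :: (nat \<Rightarrow>\<^sub>0 int, 'a) falg set"
  note iff = UT_identities_iff[OF r]
  have "ideal ?T (free_alg ?G)"
  proof (rule ideal_free_algI)
    show "?T \<subseteq> fcarrier ?G" "0 \<in> ?T" by (auto simp: iff ueval_poly_zero)
    show add: "p + q \<in> ?T" if "p \<in> ?T" "q \<in> ?T" for p q
      using that by (auto simp: iff ueval_poly_add)
    show lm: "c * p \<in> ?T" if "p \<in> ?T" "c \<in> fcarrier ?G" for p c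
      using that by (auto simp: iff ueval_poly_mult[where r=r, OF r])
    show "p * c \<in> ?T" if "p \<in> ?T" "c \<in> fcarrier ?G" for p c
      using that by (auto simp: iff ueval_poly_mult[where r=r, OF r])
    show "- p \<in> ?T" if "p \<in> ?T" for p
      using lm[OF that, of "- 1"] by (simp add: fcarrier_uminus)
  qed
  moreover have "star_poly p \<in> ?T" if "p \<in> ?T" for p
  proof -
    have "symplectic r (0\<^sub>m (2 * r) (2 * r)) = (0\<^sub>m (2 * r) (2 * r) :: 'a mat)"
      by (rule eq_matI) (simp_all add: symplectic_index)
    with that show ?thesis
      by (auto simp: iff ueval_poly_star[OF r] star_poly_fcarrier)
  qed
  moreover have "\<phi> p \<in> ?T" if \<phi>: "graded_star_endo ?G \<phi>" and p: "p \<in> ?T" for \<phi> p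
  proof -
    have "\<phi> p \<in> fcarrier ?G"
      using \<phi> p unfolding graded_star_endo_def iff by (auto dest!: ring_hom_closed)
    moreover have "ueval_poly r a (\<phi> p) = 0\<^sub>m (2 * r) (2 * r)" if a: "\<And>i g. a i g \<in> UT_comp r g" for a
      using graded_star_endo_eval[where a=a, OF r a \<phi>] p unfolding iff by metis
    ultimately show ?thesis by (simp add: iff)
  qed
  ultimately show ?thesis unfolding T_star_ideal_def by blast
qed

section \<open>Good words\<close>

text \<open>For a prefix \<open>w\<close> that ends just before a letter of nonzero degree, this
  says that the block M_i in front of that letter is empty.\<close>

definition ends_nonzero :: "'g::zero letter list \<Rightarrow> bool" where
  "ends_nonzero w \<longleftrightarrow> w = [] \<or> ldeg (last w) \<noteq> 0"

text \<open>Conditions (I)--(III) phrased through factorisations of the word, so that they can be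
  checked without its decomposition into blocks.\<close>

definition normal_word :: "('g \<Rightarrow> bool) \<Rightarrow> 'g::comm_monoid_add letter list \<Rightarrow> bool" where
  "normal_word S w \<longleftrightarrow>
     (\<forall>U y z V. w = U @ [y, z] @ V \<longrightarrow> ldeg y = 0 \<longrightarrow> ldeg z = 0 \<longrightarrow> idx y < idx z) \<and>
     (\<forall>U x V. w = U @ [x] @ V \<longrightarrow> S (ldeg x) \<longrightarrow> \<not> starred x \<and> ends_nonzero U) \<and>
     (\<forall>U x A y V. w = U @ [x] @ A @ [y] @ V \<longrightarrow> ldeg x \<noteq> 0 \<longrightarrow> ldeg y \<noteq> 0 \<longrightarrow>
        S (word_deg ([x] @ A @ [y])) \<longrightarrow> idx x < idx y \<and> ends_nonzero U)"

lemma normal_wordD: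
  assumes "normal_word S w"
  shows "w = U @ [y, z] @ V \<Longrightarrow> ldeg y = 0 \<Longrightarrow> ldeg z = 0 \<Longrightarrow> idx y < idx z"
    and "w = U @ [x] @ V \<Longrightarrow> S (ldeg x) \<Longrightarrow> \<not> starred x \<and> ends_nonzero U"
    and "w = U @ [x] @ A @ [y] @ V \<Longrightarrow> ldeg x \<noteq> 0 \<Longrightarrow> ldeg y \<noteq> 0 \<Longrightarrow>
        S (word_deg ([x] @ A @ [y])) \<Longrightarrow> idx x < idx y \<and> ends_nonzero U"
proof -
  note * = assms[unfolded normal_word_def]
  show "w = U @ [y, z] @ V \<Longrightarrow> ldeg y = 0 \<Longrightarrow> ldeg z = 0 \<Longrightarrow> idx y < idx z"
    by (rule *[THEN conjunct1, rule_format])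
  show "w = U @ [x] @ V \<Longrightarrow> S (ldeg x) \<Longrightarrow> \<not> starred x \<and> ends_nonzero U"
    by (rule *[THEN conjunct2, THEN conjunct1, rule_format])
  show "w = U @ [x] @ A @ [y] @ V \<Longrightarrow> ldeg x \<noteq> 0 \<Longrightarrow> ldeg y \<noteq> 0 \<Longrightarrow>
        S (word_deg ([x] @ A @ [y])) \<Longrightarrow> idx x < idx y \<and> ends_nonzero U"
    by (rule *[THEN conjunct2, THEN conjunct2, rule_format])
qed

text \<open>Cutting off a prefix can only shorten the block in front of a letter, and the conditions
  ask for empty blocks. This permits induction along the word.\<close>

lemma normal_word_suffix:
  assumes "normal_word S (W @ w)"
  shows "normal_word S w"
proof -
  have e: "ends_nonzero (W @ U) \<Longrightarrow> ends_nonzero U" for U :: "'a letter list"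
    by (auto simp: ends_nonzero_def split: if_splits)
  show ?thesis
    unfolding normal_word_def
  proof (intro conjI allI impI)
    fix U y z V assume "w = U @ [y, z] @ V" "ldeg y = 0" "ldeg z = 0"
    then show "idx y < idx z" using normal_wordD(1)[OF assms, of "W @ U" y z V] by simp
  next
    fix U x V assume "w = U @ [x] @ V" "S (ldeg x)"
    then show "\<not> starred x" "ends_nonzero U"
      using normal_wordD(2)[OF assms, of "W @ U" x V] e by auto
  next
    fix U x A y V assume "w = U @ [x] @ A @ [y] @ V" "ldeg x \<noteq> 0" "ldeg y \<noteq> 0" "S (word_deg ([x] @ A @ [y]))"
    then show "idx x < idx y" "ends_nonzero U"
      using normal_wordD(3)[OF assms, of "W @ U" x A y V] e by auto
  qed
qed

section \<open>Decomposition into blocks of degree-zero letters\<close>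

definition join_blocks :: "'l list list \<Rightarrow> 'l list \<Rightarrow> 'l list" where
  "join_blocks Ms xs = concat (map2 (\<lambda>M x. M @ [x]) (butlast Ms) xs) @ last Ms"

definition block_decomp :: "'g::zero letter list list \<Rightarrow> 'g letter list \<Rightarrow> bool" where
  "block_decomp Ms xs \<longleftrightarrow> length Ms = length xs + 1 \<and> (\<forall>x\<in>set xs. ldeg x \<noteq> 0) \<and>
     (\<forall>M\<in>set Ms. \<forall>x\<in>set M. ldeg x = 0)"

lemma good_word_iff:
  "good_word d w \<longleftrightarrow> (\<exists>Ms xs. block_decomp Ms xs \<and> w = join_blocks Ms xs \<and>
     (\<forall>M\<in>set Ms. sorted_wrt (<) (map idx M)) \<and>
     (\<forall>i<length xs. d (ldeg (xs ! i)) = 1 \<longrightarrow> \<not> starred (xs ! i) \<and> Ms ! i = []) \<and>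
     (\<forall>i j. i < j \<and> j < length xs \<and> d (\<Sum>l=i..j. ldeg (xs ! l)) = 1 \<longrightarrow>
        Ms ! i = [] \<and> idx (xs ! i) < idx (xs ! j)))"
  unfolding good_word_def join_blocks_def block_decomp_def by blast

lemma join_blocks_single [simp]: "join_blocks [M] [] = M"
  by (simp add: join_blocks_def)

lemma join_blocks_Cons [simp]: "Ms \<noteq> [] \<Longrightarrow> join_blocks (M # Ms) (x # xs) = M @ x # join_blocks Ms xs"
  by (simp add: join_blocks_def)

lemma join_blocks_append:
  "length Ms1 = length xs1 + 1 \<Longrightarrow> length Ms2 = length xs2 + 1 \<Longrightarrow>
    join_blocks (Ms1 @ Ms2) (xs1 @ [x] @ xs2) = join_blocks Ms1 xs1 @ [x] @ join_blocks Ms2 xs2"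
proof (induction xs1 arbitrary: Ms1)
  case Nil
  then obtain M where "Ms1 = [M]" by (auto simp: length_Suc_conv)
  moreover have "Ms2 \<noteq> []" using Nil by auto
  ultimately show ?case by simp
next
  case (Cons y xs1)
  then obtain M Ms where Ms: "Ms1 = M # Ms" "length Ms = length xs1 + 1" by (auto simp: length_Suc_conv)
  then have "Ms \<noteq> []" by auto
  with Cons.IH[OF Ms(2) Cons.prems(2)] Ms(1) show ?case by simp
qed

lemma block_decomp_append:
  "length Ms1 = length xs1 + 1 \<Longrightarrow> length Ms2 = length xs2 + 1 \<Longrightarrow>
    block_decomp (Ms1 @ Ms2) (xs1 @ [x] @ xs2)
      \<longleftrightarrow> block_decomp Ms1 xs1 \<and> ldeg x \<noteq> 0 \<and> block_decomp Ms2 xs2"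
  by (auto simp: block_decomp_def)

lemma block_decomp_length: "block_decomp Ms xs \<Longrightarrow> length Ms = length xs + 1"
  by (simp add: block_decomp_def)

lemma block_decomp_ConsE:
  assumes "block_decomp Ms (x # xs)"
  obtains M Ns where "Ms = M # Ns" "Ns \<noteq> []" "\<forall>l\<in>set M. ldeg l = 0" "ldeg x \<noteq> 0" "block_decomp Ns xs"
proof (cases Ms)
  case (Cons M Ns)
  moreover from this assms have "Ns \<noteq> []" by (auto simp: block_decomp_def)
  ultimately show ?thesis using that[of M Ns] assms by (auto simp: block_decomp_def)
qed (use assms in \<open>simp add: block_decomp_def\<close>)

lemma block_decomp_exists: "\<exists>Ms xs. block_decomp Ms xs \<and> w = join_blocks Ms xs"
proof (induction w)
  case Nil
  show ?case by (rule exI[of _ "[[]]"], rule exI[of _ "[]"]) (simp add: block_decomp_def)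
next
  case (Cons l w)
  then obtain Ms xs where IH: "block_decomp Ms xs" "w = join_blocks Ms xs" by blast
  then obtain M Ms' where Ms: "Ms = M # Ms'" "length Ms' = length xs"
    by (auto simp: block_decomp_def length_Suc_conv)
  show ?case
  proof (cases "ldeg l = 0")
    case True
    then have "block_decomp ((l # M) # Ms') xs" using IH Ms by (auto simp: block_decomp_def)
    moreover have "l # w = join_blocks ((l # M) # Ms') xs"
      using IH Ms by (cases xs; cases Ms') (auto simp: join_blocks_def)
    ultimately show ?thesis by blast
  next
    case False
    then have "block_decomp ([] # Ms) (l # xs)" using IH by (auto simp: block_decomp_def)
    moreover have "l # w = join_blocks ([] # Ms) (l # xs)" using IH Ms by simp
    ultimately show ?thesis by blast
  qed
qed

lemma zero_block_unique:
  assumes "M @ x # u = M' @ x' # u'" "\<forall>l\<in>set M. P l" "\<forall>l\<in>set M'. P l" "\<not> P x" "\<not> P x'"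
  shows "M = M' \<and> x = x' \<and> u = u'"
proof -
  have "takeWhile P (M @ x # u) = M" "takeWhile P (M' @ x' # u') = M'"
    using assms(2-) by (simp_all add: takeWhile_append2)
  with assms(1) show ?thesis by auto
qed

text \<open>Allows the existentially quantified decomposition in \<open>good_word\<close> to be
  identified with one obtained from a factorisation of the word.\<close>

lemma block_decomp_unique:
  "block_decomp Ms xs \<Longrightarrow> block_decomp Ms' xs' \<Longrightarrow> join_blocks Ms xs = join_blocks Ms' xs' \<Longrightarrow>
    Ms = Ms' \<and> xs = xs'"
proof (induction xs arbitrary: Ms Ms' xs')
  case Nil
  then obtain M where M: "Ms = [M]" by (auto simp: block_decomp_def length_Suc_conv)
  show ?case
  proof (cases xs')
    case Nil
    then show ?thesis using Nil.prems M by (auto simp: block_decomp_def length_Suc_conv)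
  next
    case (Cons x ys)
    with Nil.prems obtain N Ns where N: "Ms' = N # Ns" "Ns \<noteq> []" by (blast elim: block_decomp_ConsE)
    then have "x \<in> set M" using Nil.prems M Cons by auto
    moreover have "ldeg x \<noteq> 0" using Nil.prems Cons by (auto simp: block_decomp_def)
    ultimately show ?thesis using Nil.prems M by (auto simp: block_decomp_def)
  qed
next
  case (Cons x xs)
  from Cons.prems obtain M Ns where M: "Ms = M # Ns" "Ns \<noteq> []" by (blast elim: block_decomp_ConsE)
  show ?case
  proof (cases xs')
    case Nil
    then obtain M' where M': "Ms' = [M']" using Cons.prems by (auto simp: block_decomp_def length_Suc_conv)
    then have "M' = M @ x # join_blocks Ns xs" using Cons.prems M Nil by simp
    then have "x \<in> set M'" by simp
    moreover have "ldeg x \<noteq> 0" using Cons.prems by (auto simp: block_decomp_def)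
    ultimately show ?thesis using Cons.prems M' by (auto simp: block_decomp_def)
  next
    case (Cons x' ys)
    with Cons.prems obtain M' Ns' where M': "Ms' = M' # Ns'" "Ns' \<noteq> []" by (blast elim: block_decomp_ConsE)
    have "M @ x # join_blocks Ns xs = M' @ x' # join_blocks Ns' ys"
      using Cons.prems M M' Cons by simp
    from zero_block_unique[OF this, of "\<lambda>l. ldeg l = 0"]
    have "M = M' \<and> x = x' \<and> join_blocks Ns xs = join_blocks Ns' ys"
      using Cons.prems M M' Cons by (auto simp: block_decomp_def)
    moreover have "block_decomp Ns xs" "block_decomp Ns' ys"
      using Cons.prems M M' Cons by (auto simp: block_decomp_def)
    ultimately show ?thesis
      using Cons.IH[of Ns Ns' ys] M M' Cons by simp
  qed
qed

lemma ends_nonzero_join_blocks: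
  assumes "block_decomp Ms xs"
  shows "ends_nonzero (join_blocks Ms xs) \<longleftrightarrow> last Ms = []"
  using assms
proof (induction xs arbitrary: Ms)
  case Nil
  then obtain M where M: "Ms = [M]" by (auto simp: block_decomp_def length_Suc_conv)
  then have "\<forall>x\<in>set M. ldeg x = 0" using Nil by (simp add: block_decomp_def)
  then show ?case using M by (cases "M = []") (simp_all add: ends_nonzero_def)
next
  case (Cons x xs)
  from Cons.prems obtain M Ns where M: "Ms = M # Ns" "Ns \<noteq> []" by (blast elim: block_decomp_ConsE)
  have bd: "block_decomp Ns xs" "ldeg x \<noteq> 0" using Cons.prems M by (auto simp: block_decomp_def)
  have "ends_nonzero (M @ x # u) \<longleftrightarrow> ends_nonzero u" for u
    using bd(2) by (auto simp: ends_nonzero_def)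
  with Cons.IH[OF bd(1)] M show ?case by simp
qed

lemma word_deg_join_blocks:
  assumes "block_decomp Ms xs"
  shows "word_deg (join_blocks Ms xs) = sum_list (map ldeg xs)"
  using assms
proof (induction xs arbitrary: Ms)
  case Nil
  then obtain M where M: "Ms = [M]" by (auto simp: block_decomp_def length_Suc_conv)
  moreover have "(\<forall>x\<in>set M. ldeg x = 0) \<Longrightarrow> word_deg M = 0" for M :: "'a letter list"
    by (induction M) auto
  ultimately show ?case using Nil by (simp add: block_decomp_def)
next
  case (Cons x xs)
  from Cons.prems obtain M Ns where M: "Ms = M # Ns" "Ns \<noteq> []" by (blast elim: block_decomp_ConsE)
  have bd: "block_decomp Ns xs" "\<forall>x\<in>set M. ldeg x = 0" using Cons.prems M by (auto simp: block_decomp_def)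
  moreover have "(\<forall>x\<in>set M. ldeg x = 0) \<Longrightarrow> word_deg M = 0" for M :: "'a letter list"
    by (induction M) auto
  ultimately show ?case using Cons.IH M by simp
qed

lemma join_blocks_in_block:
  assumes "M \<in> set Ms" "length Ms = length xs + 1"
  shows "\<exists>U V. join_blocks Ms xs = U @ M @ V"
  using assms
proof (induction xs arbitrary: Ms)
  case Nil
  then show ?case by (auto simp: length_Suc_conv intro: exI[of _ "[]"])
next
  case (Cons x xs)
  then obtain N Ns where N: "Ms = N # Ns" "length Ns = length xs + 1" by (auto simp: length_Suc_conv)
  then have "Ns \<noteq> []" by auto
  show ?case
  proof (cases "M = N")
    case True
    then show ?thesis using N \<open>Ns \<noteq> []\<close> by (auto intro: exI[of _ "[]"])
  next
    case False
    then have "M \<in> set Ns" using Cons.prems N by simp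
    then obtain U V where "join_blocks Ns xs = U @ M @ V" using Cons.IH N(2) by blast
    then have "join_blocks Ms (x # xs) = (N @ x # U) @ M @ V" using N \<open>Ns \<noteq> []\<close> by simp
    then show ?thesis by blast
  qed
qed

text \<open>Unlike in \<open>join_blocks_append\<close>, no separate letter stands between the two
  words: the last block of the first, \<open>Z\<close> and the first block of the second fuse into
  one block. It is applied to two neighbours of degree 0.\<close>

lemma join_blocks_merge:
  assumes "length Ms1 = length xs1 + 1" "length Ms2 = length xs2 + 1"
  shows "join_blocks (butlast Ms1 @ [last Ms1 @ Z @ hd Ms2] @ tl Ms2) (xs1 @ xs2)
    = join_blocks Ms1 xs1 @ Z @ join_blocks Ms2 xs2"
  using assms
proof (induction xs1 arbitrary: Ms1)
  case Nil
  then obtain M where M: "Ms1 = [M]" by (auto simp: length_Suc_conv)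
  obtain N Ns where N: "Ms2 = N # Ns" "length Ns = length xs2" using Nil by (auto simp: length_Suc_conv)
  show ?case using M N by (cases xs2; cases Ns) (auto simp: join_blocks_def)
next
  case (Cons y xs1)
  then obtain M Ms where Ms: "Ms1 = M # Ms" "length Ms = length xs1 + 1" by (auto simp: length_Suc_conv)
  then have "Ms \<noteq> []" by auto
  with Cons.IH[OF Ms(2) Cons.prems(2)] Ms(1) show ?case by simp
qed

text \<open>Converts the sum over an interval of positions in condition (III) into a sum over the
  letters of a factor.\<close>

lemma sum_nth_middle:
  fixes f :: "'b \<Rightarrow> 'c::comm_monoid_add"
  assumes "ys \<noteq> []"
  shows "(\<Sum>l=length us..length us + length ys - 1. f ((us @ ys @ vs) ! l)) = sum_list (map f ys)"
proof -
  obtain m where m: "length ys = Suc m" using assms by (cases ys) auto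
  have "(\<Sum>l=length us..length us + length ys - 1. f ((us @ ys @ vs) ! l))
      = (\<Sum>l=0+length us..m+length us. f ((us @ ys @ vs) ! l))"
    by (simp add: m add.commute)
  also have "\<dots> = (\<Sum>l=0..m. f (ys ! l))"
    unfolding sum.shift_bounds_cl_nat_ivl
    by (intro sum.cong) (auto simp: nth_append m)
  also have "\<dots> = sum_list (map f ys)"
    by (simp add: sum_list_sum_nth m atLeast0AtMost atLeast0LessThan lessThan_Suc_atMost)
  finally show ?thesis .
qed

text \<open>Condition (II) concerns letters of nonzero degree only; \<open>\<not> S 0\<close>
  ensures that the corresponding clause of \<open>normal_word\<close> does so, too. From left to
  right, decompositions of the parts of a factorisation are joined and compared with the given
  one.\<close>

lemma good_word_iff_normal_word:
  assumes S: "\<And>g. d g = 1 \<longleftrightarrow> S g" and S0: "\<not> S 0"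
  shows "good_word d w \<longleftrightarrow> normal_word S (w :: 'g::comm_monoid_add letter list)"
proof
  assume "good_word d w"
  then obtain Ms xs where bd: "block_decomp Ms xs" and w: "w = join_blocks Ms xs" and
    I: "\<And>M. M \<in> set Ms \<Longrightarrow> sorted_wrt (<) (map idx M)" and
    II: "\<And>i. i < length xs \<Longrightarrow> S (ldeg (xs ! i)) \<Longrightarrow> \<not> starred (xs ! i) \<and> Ms ! i = []" and
    III: "\<And>i j. i < j \<Longrightarrow> j < length xs \<Longrightarrow> S (\<Sum>l=i..j. ldeg (xs ! l)) \<Longrightarrow>
        Ms ! i = [] \<and> idx (xs ! i) < idx (xs ! j)"
    unfolding good_word_iff S by blast
  show "normal_word S w"
    unfolding normal_word_def
  proof (intro conjI allI impI)
    fix U y z V assume eq: "w = U @ [y, z] @ V" and yz: "ldeg y = 0" "ldeg z = 0"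
    obtain M1 x1 where 1: "block_decomp M1 x1" "U = join_blocks M1 x1" using block_decomp_exists by blast
    obtain M2 x2 where 2: "block_decomp M2 x2" "V = join_blocks M2 x2" using block_decomp_exists by blast
    let ?Ms = "butlast M1 @ [last M1 @ [y, z] @ hd M2] @ tl M2"
    have ne: "M1 \<noteq> []" "M2 \<noteq> []" using 1 2 by (auto simp: block_decomp_def)
    have "block_decomp ?Ms (x1 @ x2)"
      using 1 2 yz ne by (auto simp: block_decomp_def dest: in_set_butlastD list.set_sel)
    moreover have "w = join_blocks ?Ms (x1 @ x2)"
      using join_blocks_merge[of M1 x1 M2 x2 "[y, z]"] 1 2 eq by (simp add: block_decomp_length)
    ultimately have "Ms = ?Ms" using block_decomp_unique bd w by blast
    then have "sorted_wrt (<) (map idx (last M1 @ [y, z] @ hd M2))" by (intro I) simp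
    then show "idx y < idx z" by (simp add: sorted_wrt_append)
  next
    fix U x V assume eq: "w = U @ [x] @ V" and x: "S (ldeg x)"
    obtain M1 x1 where 1: "block_decomp M1 x1" "U = join_blocks M1 x1" using block_decomp_exists by blast
    obtain M2 x2 where 2: "block_decomp M2 x2" "V = join_blocks M2 x2" using block_decomp_exists by blast
    have "ldeg x \<noteq> 0" using x S0 by auto
    then have "block_decomp (M1 @ M2) (x1 @ [x] @ x2)"
      using 1 2 by (subst block_decomp_append) (auto simp: block_decomp_length)
    moreover have "w = join_blocks (M1 @ M2) (x1 @ [x] @ x2)"
      using 1 2 eq by (subst join_blocks_append) (auto simp: block_decomp_length)
    ultimately have *: "Ms = M1 @ M2 \<and> xs = x1 @ [x] @ x2" using block_decomp_unique bd w by blast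
    moreover have "M1 ! length x1 = last M1"
      using 1 by (subst last_conv_nth) (auto simp: block_decomp_def)
    ultimately have "xs ! length x1 = x" "Ms ! length x1 = last M1" "length x1 < length xs"
      using 1 by (auto simp: nth_append block_decomp_length)
    with II[of "length x1"] x have "\<not> starred x \<and> last M1 = []" by simp
    then show "\<not> starred x" "ends_nonzero U"
      using 1(2) ends_nonzero_join_blocks[OF 1(1)] by auto
  next
    fix U x A y V assume eq: "w = U @ [x] @ A @ [y] @ V" and xy: "ldeg x \<noteq> 0" "ldeg y \<noteq> 0"
      and deg: "S (word_deg ([x] @ A @ [y]))"
    obtain M1 x1 where 1: "block_decomp M1 x1" "U = join_blocks M1 x1" using block_decomp_exists by blast
    obtain M2 x2 where 2: "block_decomp M2 x2" "A = join_blocks M2 x2" using block_decomp_exists by blast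
    obtain M3 x3 where 3: "block_decomp M3 x3" "V = join_blocks M3 x3" using block_decomp_exists by blast
    have l: "length M1 = length x1 + 1" "length M2 = length x2 + 1" "length M3 = length x3 + 1"
      "length (M2 @ M3) = length (x2 @ [y] @ x3) + 1"
      using 1 2 3 by (auto simp: block_decomp_length)
    have "block_decomp (M1 @ M2 @ M3) (x1 @ [x] @ x2 @ [y] @ x3)"
      using 1 2 3 xy l by (subst block_decomp_append; simp; subst block_decomp_append[simplified]; simp)
    moreover have "w = join_blocks (M1 @ M2 @ M3) (x1 @ [x] @ x2 @ [y] @ x3)"
      unfolding eq 1(2) 2(2) 3(2) join_blocks_append[OF l(1,4)] join_blocks_append[OF l(2,3)] by simp
    ultimately have *: "Ms = M1 @ M2 @ M3 \<and> xs = x1 @ [x] @ x2 @ [y] @ x3"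
      using block_decomp_unique bd w by blast
    \<comment> \<open>Positions of \<open>x\<close> and \<open>y\<close> among the letters of
      nonzero degree.\<close>
    let ?i = "length x1" and ?j = "length x1 + length ([x] @ x2 @ [y]) - 1"
    have "M1 ! length x1 = last M1"
      using l(1) by (subst last_conv_nth) auto
    then have nth: "xs ! ?i = x" "xs ! ?j = y" "Ms ! ?i = last M1"
      using * l by (auto simp: nth_append)
    have "xs = x1 @ ([x] @ x2 @ [y]) @ x3" using * by simp
    then have "(\<Sum>l=?i..?j. ldeg (xs ! l)) = sum_list (map ldeg ([x] @ x2 @ [y]))"
      using sum_nth_middle[where f=ldeg and ys="[x] @ x2 @ [y]" and us=x1 and vs=x3] by (simp only: append_is_Nil_conv list.simps simp_thms)
    also have "\<dots> = word_deg ([x] @ A @ [y])"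
      using 2(2) word_deg_join_blocks[OF 2(1)] by simp
    finally have "S (\<Sum>l=?i..?j. ldeg (xs ! l))" using deg by simp
    moreover have "?i < ?j" "?j < length xs" using * by simp_all
    ultimately have "last M1 = [] \<and> idx x < idx y" using III[of ?i ?j] nth by simp
    then show "idx x < idx y" "ends_nonzero U" using 1(2) ends_nonzero_join_blocks[OF 1(1)] by auto
  qed
next
  assume nw: "normal_word S w"
  obtain Ms xs where bd: "block_decomp Ms xs" "w = join_blocks Ms xs" using block_decomp_exists by blast
  have len: "length Ms = length xs + 1" using bd by (simp add: block_decomp_length)
  have I: "sorted_wrt (<) (map idx M)" if M: "M \<in> set Ms" for M
  proof -
    obtain U V where UV: "w = U @ M @ V" using join_blocks_in_block[OF M len] bd by blast
    \<comment> \<open>\<open>normal_word\<close> compares neighbours only; transitivity extends this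
      to the whole block.\<close>
    have "idx (M ! k) < idx (M ! Suc k)" if k: "Suc k < length M" for k
    proof -
      have "M = take k M @ [M ! k, M ! Suc k] @ drop (Suc (Suc k)) M"
        using k by (simp add: Cons_nth_drop_Suc)
      then have "w = (U @ take k M) @ [M ! k, M ! Suc k] @ drop (Suc (Suc k)) M @ V"
        using UV by (metis append.assoc)
      moreover have "ldeg (M ! k) = 0" "ldeg (M ! Suc k) = 0"
        using bd M k by (auto simp: block_decomp_def)
      ultimately show ?thesis using normal_wordD(1)[OF nw] by blast
    qed
    then show ?thesis by (simp add: sorted_wrt_iff_nth_Suc_transp transp_on_less)
  qed
  have split: "\<exists>V. w = join_blocks (take (Suc i) Ms) (take i xs) @ [xs ! i] @ V
      \<and> V = join_blocks (drop (Suc i) Ms) (drop (Suc i) xs)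
      \<and> (ends_nonzero (join_blocks (take (Suc i) Ms) (take i xs)) \<longleftrightarrow> Ms ! i = [])"
    if i: "i < length xs" for i
  proof -
    have l: "length (take (Suc i) Ms) = length (take i xs) + 1"
      "length (drop (Suc i) Ms) = length (drop (Suc i) xs) + 1" using i len by auto
    have xs: "xs = take i xs @ [xs ! i] @ drop (Suc i) xs" using i by (simp add: id_take_nth_drop)
    have "w = join_blocks (take (Suc i) Ms @ drop (Suc i) Ms) (take i xs @ [xs ! i] @ drop (Suc i) xs)"
      using bd xs by simp
    moreover have "block_decomp (take (Suc i) Ms @ drop (Suc i) Ms) (take i xs @ [xs ! i] @ drop (Suc i) xs)"
      using bd xs by simp
    then have "block_decomp (take (Suc i) Ms) (take i xs)"
      using block_decomp_append[OF l] by blast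
    then have "ends_nonzero (join_blocks (take (Suc i) Ms) (take i xs)) \<longleftrightarrow> last (take (Suc i) Ms) = []"
      by (rule ends_nonzero_join_blocks)
    moreover have "last (take (Suc i) Ms) = Ms ! i"
      using i len by (simp add: take_Suc_conv_app_nth)
    ultimately show ?thesis using join_blocks_append[OF l] by simp
  qed
  have II: "\<not> starred (xs ! i) \<and> Ms ! i = []" if "i < length xs" "S (ldeg (xs ! i))" for i
    using split[OF that(1)] normal_wordD(2)[OF nw _ that(2)] by blast
  have III: "Ms ! i = [] \<and> idx (xs ! i) < idx (xs ! j)"
    if ij: "i < j" "j < length xs" "S (\<Sum>l=i..j. ldeg (xs ! l))" for i j
  proof -
    obtain V where V: "w = join_blocks (take (Suc i) Ms) (take i xs) @ [xs ! i] @ V"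
      "V = join_blocks (drop (Suc i) Ms) (drop (Suc i) xs)"
      "ends_nonzero (join_blocks (take (Suc i) Ms) (take i xs)) \<longleftrightarrow> Ms ! i = []"
      using split[of i] ij by auto
    define Ns ys where N: "Ns = drop (Suc i) Ms" and ys: "ys = drop (Suc i) xs"
    define k where "k = j - Suc i"
    have k: "j = Suc i + k" "k < length ys" using ij by (auto simp: k_def ys)
    have l: "length (take (Suc k) Ns) = length (take k ys) + 1"
      "length (drop (Suc k) Ns) = length (drop (Suc k) ys) + 1" using k len by (auto simp: N ys)
    have xs: "ys = take k ys @ [xs ! j] @ drop (Suc k) ys"
      using k id_take_nth_drop[of k ys] by (simp add: ys)
    have xs': "xs = take i xs @ [xs ! i] @ ys" using ij by (simp add: ys id_take_nth_drop)
    have l': "length (take (Suc i) Ms) = length (take i xs) + 1" "length Ns = length ys + 1"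
      using ij len by (auto simp: N ys)
    have "block_decomp (take (Suc i) Ms @ Ns) (take i xs @ [xs ! i] @ ys)"
      using bd xs' by (simp add: N)
    then have "block_decomp Ns ys" and nzi: "ldeg (xs ! i) \<noteq> 0" using block_decomp_append[OF l'] by blast+
    then have "block_decomp (take (Suc k) Ns @ drop (Suc k) Ns) (take k ys @ [xs ! j] @ drop (Suc k) ys)"
      using xs by simp
    then have bdA: "block_decomp (take (Suc k) Ns) (take k ys)" and nzj: "ldeg (xs ! j) \<noteq> 0"
      using block_decomp_append[OF l] by blast+
    let ?A = "join_blocks (take (Suc k) Ns) (take k ys)"
    have "V = join_blocks (take (Suc k) Ns @ drop (Suc k) Ns) (take k ys @ [xs ! j] @ drop (Suc k) ys)"
      unfolding V(2)[folded N ys] append_take_drop_id by (rule arg_cong[OF xs])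
    then have V': "V = ?A @ [xs ! j] @ join_blocks (drop (Suc k) Ns) (drop (Suc k) ys)"
      using join_blocks_append[OF l] by simp
    have "word_deg ([xs ! i] @ ?A @ [xs ! j]) = sum_list (map ldeg ([xs ! i] @ take k ys @ [xs ! j]))"
      using word_deg_join_blocks[OF bdA] by simp
    also have "\<dots> = (\<Sum>l=length (take i xs)..length (take i xs) + length ([xs ! i] @ take k ys @ [xs ! j]) - 1.
        ldeg ((take i xs @ ([xs ! i] @ take k ys @ [xs ! j]) @ drop (Suc k) ys) ! l))"
      by (rule sum_nth_middle[symmetric]) simp
    also have "take i xs @ ([xs ! i] @ take k ys @ [xs ! j]) @ drop (Suc k) ys = xs"
      using xs xs' by (metis append.assoc)
    also have "length (take i xs) = i" using ij by simp
    also have "i + length ([xs ! i] @ take k ys @ [xs ! j]) - 1 = j"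
      using k by simp
    finally have "S (word_deg ([xs ! i] @ ?A @ [xs ! j]))" using ij by simp
    moreover have "w = join_blocks (take (Suc i) Ms) (take i xs) @ [xs ! i] @ ?A @ [xs ! j]
        @ join_blocks (drop (Suc k) Ns) (drop (Suc k) ys)"
      using V(1) V' by simp
    ultimately show ?thesis using normal_wordD(3)[OF nw _ nzi nzj] V(3) by blast
  qed
  show "good_word d w"
    unfolding good_word_iff S using bd I II III by blast
qed

section \<open>Uniqueness of normal words with a given trace\<close>

text \<open>The generic entries in the monomial of a word, as pairs of variable and position. The
  degree is omitted because the position determines it; a set loses nothing as long as the variables
  are distinct.\<close>

definition trace_vars :: "(nat \<Rightarrow>\<^sub>0 int) letter list \<Rightarrow> (nat \<times> nat) list \<Rightarrow> (nat \<times> nat \<times> nat) set" where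
  "trace_vars w es = set (zip (map idx w) es)"

lemma trace_vars_Cons [simp]: "trace_vars (l # w) (e # es) = insert (idx l, e) (trace_vars w es)"
  by (simp add: trace_vars_def)

lemma trace_vars_idx: "(k, e) \<in> trace_vars w es \<Longrightarrow> k \<in> idx ` set w"
  by (auto simp: trace_vars_def dest: set_zip_leftD)

lemma trace_varsE:
  assumes "trace r p w es q" "(k, e) \<in> trace_vars w es"
  obtains A y B s t esA where "w = A @ [y] @ B" "idx y = k" "trace r p A esA s"
    "(s, t) \<in> edges r (ldeg y)" "e = letter_edge r y s t"
  using assms
proof (induction w arbitrary: p es thesis)
  case Nil
  then show ?case by (simp add: trace_vars_def)
next
  case (Cons l w)
  from Cons.prems(2) obtain d es' where d: "(p, d) \<in> edges r (ldeg l)"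
    and es: "es = letter_edge r l p d # es'" and tr: "trace r d w es' q" by auto
  show ?case
  proof (cases "(k, e) = (idx l, letter_edge r l p d)")
    case True
    then show ?thesis using Cons.prems(1)[of "[]" l w "[]" p d] d edgesD[OF d] by simp
  next
    case False
    then have "(k, e) \<in> trace_vars w es'" using Cons.prems(3) unfolding es trace_vars_Cons by blast
    from Cons.IH[OF _ tr this] obtain A y B s t esA where *: "w = A @ [y] @ B" "idx y = k"
      "trace r d A esA s" "(s, t) \<in> edges r (ldeg y)" "e = letter_edge r y s t" by metis
    then have "trace r p (l # A) (letter_edge r l p d # esA) s" using d by auto
    from Cons.prems(1)[OF _ *(2) this *(4,5), of B] *(1) show ?thesis by simp
  qed
qed

text \<open>The position does not tell whether the letter is starred; this ambiguity is what the
  rest of the section has to resolve.\<close>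

lemma letter_edge_cases:
  assumes "letter_edge r y s t = letter_edge r z c d" "s < 2 * r" "t < 2 * r" "c < 2 * r" "d < 2 * r"
  shows "s = c \<and> t = d \<or> s = mir r d \<and> t = mir r c"
  using assms by (auto simp: letter_edge_def split: if_splits)

lemma trace_zero:
  assumes "trace r p w es p" "l \<in> set w"
  shows "ldeg l = 0"
  using assms
proof (induction w arbitrary: es)
  case (Cons m w)
  then obtain d es' where d: "(p, d) \<in> edges r (ldeg m)" and tr: "trace r d w es' p" by auto
  have "d = p" using edgesD[OF d] trace_le[OF tr] by simp
  with d have "ldeg m = 0" using edges_nonzero[OF d] by auto
  then show ?case using Cons tr \<open>d = p\<close> by auto
qed simp

lemma trace_all_zero:
  assumes "trace r p w es q" "\<forall>l\<in>set w. ldeg l = 0"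
  shows "p = q"
  using assms by (induction w arbitrary: p es) (auto simp: edges_zero)

lemma word_deg_all_zero: "\<forall>l\<in>set w. ldeg l = 0 \<Longrightarrow> word_deg w = 0"
  by (induction w) auto

section \<open>Reaching the mirrored state\<close>

abbreviation normal_wd :: "nat \<Rightarrow> (nat \<Rightarrow>\<^sub>0 int) letter list \<Rightarrow> bool" where
  "normal_wd r \<equiv> normal_word (symm_degree r)"

text \<open>Through this fact conditions (II) and (III) apply to every factor that leads from a
  state to its mirror image.\<close>

lemma trace_mir_symm:
  assumes "trace r p w es (mir r p)"
  shows "p < mir r p" "symm_degree r (word_deg w)"
proof -
  have "p < 2 * r" "p \<le> mir r p" "mir r p < 2 * r"
    using trace_le[OF assms] by auto
  then show "p < mir r p" using mir_neq[of p r] by simp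
  with trace_deg[OF assms] \<open>mir r p < 2 * r\<close> show "symm_degree r (word_deg w)"
    by (auto simp: symm_degree_def)
qed

text \<open>The first and the last letter of nonzero degree in \<open>W\<close> enclose a factor of
  symmetric degree, so by (III), or by (II) if they coincide, the block before the first one is
  empty.\<close>

lemma symm_path_head:
  assumes nw: "normal_wd r (W @ B)" and tr: "trace r p W es (mir r p)"
  shows "W \<noteq> []" "ldeg (hd W) \<noteq> 0"
proof -
  note symm = trace_mir_symm[OF tr]
  have "\<exists>x\<in>set W. ldeg x \<noteq> 0"
    using trace_all_zero[OF tr] symm(1) by auto
  then obtain Z x R where W: "W = Z @ x # R" and x: "ldeg x \<noteq> 0" and Z: "\<forall>z\<in>set Z. ldeg z = 0"
    using split_list_first_prop[of W "\<lambda>x. ldeg x \<noteq> 0"] by metis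
  have "ends_nonzero Z"
  proof (cases "\<exists>y\<in>set R. ldeg y \<noteq> 0")
    case True
    then obtain R1 y Z2 where R: "R = R1 @ y # Z2" and y: "ldeg y \<noteq> 0" and Z2: "\<forall>z\<in>set Z2. ldeg z = 0"
      using split_list_last_prop[of R "\<lambda>x. ldeg x \<noteq> 0"] by metis
    have "word_deg ([x] @ R1 @ [y]) = word_deg W"
      using W R by (simp add: word_deg_all_zero[OF Z] word_deg_all_zero[OF Z2])
    moreover have "W @ B = Z @ [x] @ R1 @ [y] @ Z2 @ B" using W R by simp
    ultimately show ?thesis
      using normal_wordD(3)[OF nw _ x y] symm(2) by metis
  next
    case False
    then have "ldeg x = word_deg W"
      using W by (simp add: word_deg_all_zero[OF Z] word_deg_all_zero[of R])
    moreover have "W @ B = Z @ [x] @ R @ B" using W by simp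
    ultimately show ?thesis
      using normal_wordD(2)[OF nw] symm(2) by metis
  qed
  then have "Z = []" using Z by (cases "Z = []") (simp_all add: ends_nonzero_def)
  with W x show "W \<noteq> []" "ldeg (hd W) \<noteq> 0" by simp_all
qed

lemma zero_run_sorted:
  assumes nw: "normal_wd r ([l] @ A @ [y] @ B)" and "ldeg l = 0" "\<forall>z\<in>set A. ldeg z = 0" "ldeg y = 0"
  shows "idx l < idx y"
  using assms
proof (induction A arbitrary: l)
  case Nil
  then show ?case using normal_wordD(1)[OF Nil.prems(1), of "[]" l y B] by simp
next
  case (Cons a A)
  have "idx l < idx a" using normal_wordD(1)[OF Cons.prems(1), of "[]" l a "A @ [y] @ B"] Cons.prems by simp
  also have "idx a < idx y"
    using Cons.IH[of a] normal_word_suffix[of _ "[l]" "[a] @ A @ [y] @ B"] Cons.prems by simp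
  finally show ?case .
qed

definition visits :: "nat \<Rightarrow> nat \<Rightarrow> (nat \<Rightarrow>\<^sub>0 int) letter list \<Rightarrow> nat \<Rightarrow> bool" where
  "visits r p w c \<longleftrightarrow> (\<exists>A B es. w = A @ B \<and> trace r p A es c)"

lemma visits_letter:
  assumes "w = A @ [y] @ B" "trace r p A es s" "(s, t) \<in> edges r (ldeg y)"
  shows "visits r p w s" "visits r p w t"
proof -
  show "visits r p w s" using assms unfolding visits_def by blast
  have "trace r s [y] [letter_edge r y s t] t" using assms(3) edgesD[OF assms(3)] by auto
  then have "trace r p (A @ [y]) (es @ [letter_edge r y s t]) t"
    using assms(2) unfolding trace_append by blast
  moreover have "w = (A @ [y]) @ B" using assms(1) by simp
  ultimately show "visits r p w t" unfolding visits_def by blast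
qed

text \<open>A trace leaves a state only once, because states increase along letters of nonzero degree.\<close>

lemma leaves_once:
  assumes "A @ [y] @ B = A' @ [y'] @ B'" "trace r p A es c" "trace r p A' es' c"
    "(c, t) \<in> edges r (ldeg y)" "c < t" "(c, t') \<in> edges r (ldeg y')" "c < t'"
  shows "y = y'"
proof -
  have *: False if asm: "A' = A @ [y] @ C" "trace r p A es c" "trace r p A' es' c"
    "(c, t) \<in> edges r (ldeg y)" "c < t" for A A' y C es es' t
  proof -
    obtain d es1 es2 where d: "trace r p A es1 d" "trace r d ([y] @ C) es2 c"
      using asm(3) unfolding asm(1) trace_append[of r p A] by blast
    then have "d = c" using trace_det[OF d(1) asm(2)] by simp
    with d obtain es3 d' where d': "(c, d') \<in> edges r (ldeg y)" "trace r d' C es3 c" by auto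
    then have "d' = t" using edges_det asm(4) by blast
    with trace_le[OF d'(2)] asm(5) show False by simp
  qed
  from assms(1) consider us where "A' = A @ us" "us @ [y'] @ B' = [y] @ B" | us where "A = A' @ us" "us @ [y] @ B = [y'] @ B'"
    by (auto simp: append_eq_append_conv2)
  then show ?thesis
  proof cases
    case 1
    then show ?thesis
    proof (cases us)
      case (Cons u us')
      then have "A' = A @ [y] @ us'" using 1 by simp
      from *[OF this assms(2,3,4,5)] show ?thesis ..
    qed simp
  next
    case 2
    then show ?thesis
    proof (cases us)
      case (Cons u us')
      then have "A = A' @ [y'] @ us'" using 2 by simp
      from *[OF this assms(3,2,6,7)] show ?thesis ..
    qed simp
  qed
qed

text \<open>Let \<open>z\<close> be the last letter of nonzero degree before \<open>w'\<close>
  reaches \<open>mir r p\<close>. In \<open>w\<close> its variable makes the same step, which ends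
  at \<open>mir r p\<close>, or the mirrored step, which leaves \<open>p\<close>. In the latter
  case, unless the step leads from \<open>p\<close> to \<open>mir r p\<close>, the variable of the
  first step out of \<open>p\<close> in \<open>w'\<close> is considered as well: mirrored, its step
  ends at \<open>mir r p\<close>; unmirrored, it would be a second step out of
  \<open>p\<close>.\<close>

lemma visits_mir_transfer:
  assumes tr: "trace r p w es q" and tr': "trace r p w' es' q"
    and vars: "trace_vars w es = trace_vars w' es'" and dist: "distinct (map idx w')"
    and vis: "visits r p w' (mir r p)"
  shows "visits r p w (mir r p)"
proof -
  obtain A B esA where w': "w' = A @ B" and A: "trace r p A esA (mir r p)"
    using vis unfolding visits_def by blast
  note symm = trace_mir_symm[OF A]
  have p2: "p < 2 * r" using trace_le[OF A] symm by simp
  \<comment> \<open>Every step of \<open>w'\<close> is made in \<open>w\<close> by the same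
    variable, directly or mirrored.\<close>
  have var: "\<exists>A' y' B' esA'. w = A' @ [y'] @ B' \<and> idx y' = idx y \<and>
      ((\<exists>e. trace r p A' e s) \<and> (s, t) \<in> edges r (ldeg y') \<or>
       (\<exists>e. trace r p A' e (mir r t)) \<and> (mir r t, mir r s) \<in> edges r (ldeg y'))"
    if w: "w' = C @ [y] @ D" "trace r p C eC s" "(s, t) \<in> edges r (ldeg y)" for C y D eC s t
  proof -
    have "trace r p (C @ [y] @ D) es' q" using tr' w by simp
    then obtain d e1 e2 where e: "trace r p C e1 d" "trace r d ([y] @ D) e2 q" "es' = e1 @ e2"
      unfolding trace_append[of r p C] by blast
    then have "d = s" using w trace_det by blast
    with e obtain d' e3 where "(s, d') \<in> edges r (ldeg y)" "e2 = letter_edge r y s d' # e3" by auto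
    moreover from this have "d' = t" using edges_det w(3) by blast
    ultimately have "(idx y, letter_edge r y s t) \<in> trace_vars w' es'"
      using e w trace_length[OF e(1)] by (simp add: trace_vars_def)
    then have "(idx y, letter_edge r y s t) \<in> trace_vars w es" using vars by simp
    from trace_varsE[OF tr this] obtain A' y' B' s' t' esA' where
      *: "w = A' @ [y'] @ B'" "idx y' = idx y" "trace r p A' esA' s'" "(s', t') \<in> edges r (ldeg y')"
        "letter_edge r y s t = letter_edge r y' s' t'" by metis
    have "s' = s \<and> t' = t \<or> s' = mir r t \<and> t' = mir r s"
      using letter_edge_cases[OF *(5)[symmetric]] edgesD[OF *(4)] edgesD[OF w(3)] by simp
    with * show ?thesis by blast
  qed
  have "\<exists>x\<in>set A. ldeg x \<noteq> 0" using trace_all_zero[OF A] symm(1) by auto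
  then obtain A1 z Z where Az: "A = A1 @ z # Z" and z: "ldeg z \<noteq> 0" and Z: "\<forall>l\<in>set Z. ldeg l = 0"
    using split_list_last_prop[of A "\<lambda>x. ldeg x \<noteq> 0"] by metis
  obtain x e1 e2 where A1: "trace r p A1 e1 x" and "trace r x (z # Z) e2 (mir r p)"
    using A unfolding Az trace_append by blast
  then obtain t e3 where t: "(x, t) \<in> edges r (ldeg z)" "trace r t Z e3 (mir r p)" by auto
  have "t = mir r p" using trace_all_zero[OF t(2) Z] .
  with t have xp: "(x, mir r p) \<in> edges r (ldeg z)" by simp
  have w'z: "w' = A1 @ [z] @ (Z @ B)" using w' Az by simp
  from var[OF w'z A1 xp] obtain A' y B' where y: "w = A' @ [y] @ B'" "idx y = idx z" and
    cases: "(\<exists>e. trace r p A' e x) \<and> (x, mir r p) \<in> edges r (ldeg y) \<or>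
       (\<exists>e. trace r p A' e p) \<and> (p, mir r x) \<in> edges r (ldeg y)"
    unfolding mir_mir[OF p2] by metis
  from cases show ?thesis
  proof
    assume "(\<exists>e. trace r p A' e x) \<and> (x, mir r p) \<in> edges r (ldeg y)"
    then show ?thesis using visits_letter[OF y(1)] by blast
  next
    assume "(\<exists>e. trace r p A' e p) \<and> (p, mir r x) \<in> edges r (ldeg y)"
    then obtain eA' where A': "trace r p A' eA' p" and px: "(p, mir r x) \<in> edges r (ldeg y)" by blast
    show ?thesis
    proof (cases "x = p")
      case True
      then show ?thesis using visits_letter(2)[OF y(1) A' px] by simp
    next
      case False
      have "\<exists>x\<in>set A1. ldeg x \<noteq> 0" using trace_all_zero[OF A1] False by auto
      then obtain Z1 z' R where Az': "A1 = Z1 @ z' # R" and z': "ldeg z' \<noteq> 0" and Z1: "\<forall>l\<in>set Z1. ldeg l = 0"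
        using split_list_first_prop[of A1 "\<lambda>x. ldeg x \<noteq> 0"] by metis
      obtain c e1 e2 where c: "trace r p Z1 e1 c" "trace r c (z' # R) e2 x"
        using A1 unfolding Az' trace_append by blast
      have "c = p" using trace_all_zero[OF c(1) Z1] by simp
      with c obtain d where pd: "trace r p Z1 e1 p" "(p, d) \<in> edges r (ldeg z')" by auto
      have ne: "idx z' \<noteq> idx z" using dist w'z Az' by auto
      have "w' = Z1 @ [z'] @ (R @ [z] @ Z @ B)" using w'z Az' by simp
      from var[OF this pd] obtain A2 y2 B2 where y2: "w = A2 @ [y2] @ B2" "idx y2 = idx z'" and
        cases2: "(\<exists>e. trace r p A2 e p) \<and> (p, d) \<in> edges r (ldeg y2) \<or>
         (\<exists>e. trace r p A2 e (mir r d)) \<and> (mir r d, mir r p) \<in> edges r (ldeg y2)" by metis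
      from cases2 show ?thesis
      proof
        assume "(\<exists>e. trace r p A2 e (mir r d)) \<and> (mir r d, mir r p) \<in> edges r (ldeg y2)"
        then show ?thesis using visits_letter[OF y2(1)] by blast
      next
        assume "(\<exists>e. trace r p A2 e p) \<and> (p, d) \<in> edges r (ldeg y2)"
        then obtain eA2 where A2: "trace r p A2 eA2 p" and pd2: "(p, d) \<in> edges r (ldeg y2)" by blast
        have "p < d" using edges_nonzero[OF pd(2)] z' by simp
        have "x < mir r p" using edges_nonzero[OF xp] z by simp
        then have "p < mir r x" using p2 edgesD[OF xp] mir_less_mir[of "mir r p" r x] by simp
        \<comment> \<open>A path leaves \<open>p\<close> only once by a letter of nonzero degree,
          but \<open>y\<close> and \<open>y2\<close> have different variables.\<close>
        have "y = y2"
          using leaves_once[OF _ A' A2 px \<open>p < mir r x\<close> pd2 \<open>p < d\<close>] y(1) y2(1) by metis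
        with ne y(2) y2(2) show ?thesis by simp
      qed
    qed
  qed
qed

text \<open>The head \<open>l\<close> of a normal word at state \<open>p\<close> is compared with a letter \<open>l'\<close> that heads another word
  with the same trace variables; whether the word reaches the mirrored state decides everything.\<close>

lemma normal_head_compare:
  assumes nw: "normal_wd r (l # X)" and tr: "trace r p (l # X) es q"
    and var: "(k, e) \<in> trace_vars (l # X) es" and k: "k \<noteq> idx l"
    and e: "e = letter_edge r l' p d'" and d': "(p, d') \<in> edges r g"
  shows "visits r p (l # X) (mir r p) \<Longrightarrow> ldeg l \<noteq> 0"
    and "visits r p (l # X) (mir r p) \<Longrightarrow> p < d' \<Longrightarrow> idx l < k"
    and "\<not> visits r p (l # X) (mir r p) \<Longrightarrow> ldeg l = 0"
    and "\<not> visits r p (l # X) (mir r p) \<Longrightarrow> p = d' \<Longrightarrow> idx l < k"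
proof -
  from trace_varsE[OF tr var] obtain A y B s t esA where y: "l # X = A @ [y] @ B" "idx y = k"
    "trace r p A esA s" "(s, t) \<in> edges r (ldeg y)" "e = letter_edge r y s t" by metis
  have st: "s = p \<and> t = d' \<or> s = mir r d' \<and> t = mir r p"
    using letter_edge_cases[where y=y and s=s and t=t and z=l' and c=p and d=d' and r=r] y(5) e edgesD[OF y(4)] edgesD[OF d'] by simp
  obtain A0 where A: "A = l # A0" using y k by (cases A) auto
  obtain d es0 where d: "(p, d) \<in> edges r (ldeg l)" "trace r d A0 es0 s" using y(3) unfolding A by auto
  have "d \<le> s" using trace_le[OF d(2)] by simp
  show nz: "ldeg l \<noteq> 0" if vis: "visits r p (l # X) (mir r p)"
  proof -
    obtain A' B' e' where A': "l # X = A' @ B'" and tr': "trace r p A' e' (mir r p)"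
      using vis unfolding visits_def by blast
    have "normal_wd r (A' @ B')" using nw by (simp only: A')
    from symm_path_head[OF this tr'] A' show ?thesis by (cases A') simp_all
  qed
  show "idx l < k" if vis: "visits r p (l # X) (mir r p)" and pd': "p < d'"
  proof -
    \<comment> \<open>The path has left \<open>p\<close> already, so the variable \<open>k\<close>
      can only make its mirrored step. This step ends at \<open>mir r p\<close>, and (III) applies
      to the factor from \<open>l\<close> to \<open>y\<close>.\<close>
    have "p < d" using nz[OF vis] edges_nonzero[OF d(1)] by simp
    with \<open>d \<le> s\<close> st have st': "s = mir r d'" "t = mir r p" by auto
    have "ldeg y \<noteq> 0"
      using edges_nonzero[OF y(4)] st' pd' edgesD[OF d'] mir_less_mir[of d' r p] by simp
    moreover have "trace r s [y] [letter_edge r y s t] t" using y(4) edgesD[OF y(4)] by auto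
    then have "trace r p (A @ [y]) (esA @ [letter_edge r y s t]) (mir r p)"
      using y(3) st' unfolding trace_append by blast
    then have "symm_degree r (word_deg (A @ [y]))" by (rule trace_mir_symm)
    ultimately show ?thesis
      using normal_wordD(3)[OF nw, of "[]" l A0 y B] y A nz[OF vis] by simp
  qed
  \<comment> \<open>A mirrored step would end at \<open>mir r p\<close>. So the step starts at
    \<open>p\<close>, and all letters before it have degree 0.\<close>
  have nvis: "s = p \<and> t = d' \<and> d = p" if "\<not> visits r p (l # X) (mir r p)"
    using st visits_letter(2)[OF y(1,3,4)] that \<open>d \<le> s\<close> edgesD[OF d(1)] by auto
  show l0: "ldeg l = 0" if "\<not> visits r p (l # X) (mir r p)"
    using nvis[OF that] d(1) edges_nonzero[OF d(1)] by auto
  show "idx l < k" if "\<not> visits r p (l # X) (mir r p)" "p = d'"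
  proof -
    have "ldeg y = 0" using nvis[OF that(1)] that(2) edges_nonzero[OF y(4)] by auto
    moreover have "\<forall>z\<in>set A0. ldeg z = 0" using nvis[OF that(1)] d(2) trace_zero by blast
    ultimately show ?thesis
      using zero_run_sorted[of r l A0 y B] nw l0[OF that(1)] y(1,2) A by simp
  qed
qed

text \<open>If the heads have different variables, each of these occurs later in the other word, and
  \<open>normal_head_compare\<close> yields \<open>idx l < idx l'\<close> as well as the reverse. If
  they have the same variable, they can differ at most in the star, which (II) excludes.\<close>

lemma normal_word_unique:
  assumes "normal_wd r w" "normal_wd r w'"
    and "trace r p w es q" "trace r p w' es' q"
    and "trace_vars w es = trace_vars w' es'"
    and "distinct (map idx w)" "distinct (map idx w')"
  shows "w = w'"
  using assms
proof (induction w arbitrary: p w' es es')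
  case Nil
  then show ?case by (cases w') (auto simp: trace_vars_def)
next
  case (Cons l X)
  obtain l' X' where w': "w' = l' # X'"
    using Cons.prems by (cases w') (auto simp: trace_vars_def)
  obtain d f where d: "(p, d) \<in> edges r (ldeg l)" "trace r d X f q" and es: "es = letter_edge r l p d # f"
    using Cons.prems(3) by auto
  obtain d' f' where d': "(p, d') \<in> edges r (ldeg l')" "trace r d' X' f' q" and es': "es' = letter_edge r l' p d' # f'"
    using Cons.prems(4) w' by auto
  have v: "(idx l, letter_edge r l p d) \<in> trace_vars w' es'"
    "(idx l', letter_edge r l' p d') \<in> trace_vars (l # X) es"
    using Cons.prems(5) es es' w' by auto
  have p2: "p < 2 * r" using edgesD[OF d(1)] by simp
  show ?case
  proof (cases "idx l = idx l'")
    case True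
    have notin: "idx l \<notin> idx ` set X" "idx l' \<notin> idx ` set X'" using Cons.prems w' by auto
    have eq: "letter_edge r l p d = letter_edge r l' p d'"
    proof (rule ccontr)
      assume "letter_edge r l p d \<noteq> letter_edge r l' p d'"
      then have "(idx l, letter_edge r l p d) \<in> trace_vars X' f'"
        using v(1) unfolding w' es' trace_vars_Cons by blast
      then have "idx l \<in> idx ` set X'" by (rule trace_vars_idx)
      with notin True show False by simp
    qed
    have st: "\<not> starred m" if "normal_wd r (m # Y)" "(p, mir r p) \<in> edges r (ldeg m)" for m Y
    proof -
      have "symm_degree r (ldeg m)"
        unfolding symm_degree_def using edgesD[OF that(2)] mir_neq[OF p2] by (intro exI[of _ p]) auto
      then show ?thesis using normal_wordD(2)[OF that(1), of "[]" m Y] by simp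
    qed
    have nw: "normal_wd r (l # X)" "normal_wd r (l' # X')" using Cons.prems w' by auto
    have "starred l = starred l' \<and> d = d'"
    proof (cases "starred l = starred l'")
      case True
      then show ?thesis using eq edgesD[OF d(1)] edgesD[OF d'(1)] by (auto simp: letter_edge_def split: if_splits)
    next
      case False
      \<comment> \<open>One head uses the position directly and the other one mirrored, which is
        possible only for the step from \<open>p\<close> to \<open>mir r p\<close>, of symmetric
        degree.\<close>
      then have "d = mir r p \<and> d' = mir r p"
        using eq edgesD[OF d(1)] edgesD[OF d'(1)] p2 by (auto simp: letter_edge_def split: if_splits)
      then show ?thesis using st[OF nw(1)] st[OF nw(2)] d d' False by auto
    qed
    moreover from this have "ldeg l = ldeg l'" using edgesD[OF d(1)] edgesD[OF d'(1)] by simp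
    ultimately have "l = l'" "d = d'" using True by (auto intro: letter.expand)
    moreover have "trace_vars X f = trace_vars X' f'"
    proof -
      let ?x = "(idx l, letter_edge r l p d)"
      have "?x \<notin> trace_vars X f" "?x \<notin> trace_vars X' f'"
        using notin True trace_vars_idx by metis+
      moreover have "insert ?x (trace_vars X f) = insert ?x (trace_vars X' f')"
        using Cons.prems(5) eq True by (simp add: es es' w')
      ultimately show ?thesis by (metis insert_ident)
    qed
    ultimately have "X = X'"
      using Cons.IH[of X' d f f'] Cons.prems w' d d' normal_word_suffix[of _ "[l]" X]
        normal_word_suffix[of _ "[l']" X'] by simp
    with \<open>l = l'\<close> w' show ?thesis by simp
  next
    case False
    note 1 = normal_head_compare[OF Cons.prems(1,3) v(2) _ refl d'(1)]
    have tr': "trace r p (l' # X') es' q" and nw': "normal_wd r (l' # X')"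
      and v1: "(idx l, letter_edge r l p d) \<in> trace_vars (l' # X') es'"
      using Cons.prems v w' by auto
    note 2 = normal_head_compare[OF nw' tr' v1 _ refl d(1)]
    have vis: "visits r p (l # X) (mir r p) \<longleftrightarrow> visits r p (l' # X') (mir r p)"
      using visits_mir_transfer[OF Cons.prems(3) tr'] visits_mir_transfer[OF tr' Cons.prems(3)]
        Cons.prems(5,6,7) w' by auto
    show ?thesis
    proof (cases "visits r p (l # X) (mir r p)")
      case True
      then have "ldeg l \<noteq> 0" "ldeg l' \<noteq> 0" using 1(1) 2(1) vis False by auto
      then have "p < d" "p < d'" using edges_nonzero[OF d(1)] edges_nonzero[OF d'(1)] by auto
      then have "idx l < idx l'" "idx l' < idx l" using 1(2) 2(2) True vis False by auto
      then show ?thesis by simp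
    next
      case nv: False
      then have "ldeg l = 0" "ldeg l' = 0" using 1(3) 2(3) vis False by auto
      then have "p = d" "p = d'" using d(1) d'(1) by (auto simp: edges_zero)
      then have "idx l < idx l'" "idx l' < idx l" using 1(4) 2(4) nv vis False by auto
      then show ?thesis by simp
    qed
  qed
qed

section \<open>Rewriting modulo the identities\<close>

text \<open>Generic matrices with the value \<open>s (i, e)\<close> for the entry of variable
  \<open>i\<close> at position \<open>e\<close>. A position belongs to one degree only, so
  \<open>s\<close> does not depend on \<open>g\<close>.\<close>

definition generic_mats :: "nat \<Rightarrow> (nat \<times> nat \<times> nat \<Rightarrow> 'a) \<Rightarrow> nat \<Rightarrow> (nat \<Rightarrow>\<^sub>0 int) \<Rightarrow> 'a::field mat" where
  "generic_mats r s i g = mat (2 * r) (2 * r) (\<lambda>e. if e \<in> edges r g then s (i, e) else 0)"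

lemma generic_mats_comp: "r \<ge> 1 \<Longrightarrow> generic_mats r s i g \<in> UT_comp r g"
  by (auto simp: UT_comp_iff generic_mats_def split: if_splits)

lemma letter_edge_edges: "(c, d) \<in> edges r (ldeg l) \<Longrightarrow> letter_edge r l c d \<in> edges r (ldeg l)"
  using mirror_edge by (auto simp: letter_edge_def)

lemma trace_edges: "trace r p w es q \<Longrightarrow> list_all2 (\<lambda>l e. e \<in> edges r (ldeg l)) w es"
  by (induction w arbitrary: p es) (auto simp: letter_edge_edges)

lemma ueval_generic_mats:
  assumes r: "r \<ge> 1" and tr: "trace r p w es q"
  shows "ueval r (generic_mats r s) w $$ (p, q)
    = trace_sign r w es * prod_list (map s (zip (map idx w) es))"
proof -
  have "map (\<lambda>(l, e). generic_mats r s (idx l) (ldeg l) $$ e) (zip w es) = map s (zip (map idx w) es)"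
    using trace_edges[OF tr]
  proof (induction rule: list_all2_induct)
    case (Cons l w e es)
    obtain c d where "e = (c, d)" by (cases e)
    then show ?case using Cons edgesD[of c d r "ldeg l"] by (simp add: generic_mats_def)
  qed simp
  then show ?thesis
    using ueval_trace[where a="generic_mats r s", OF r generic_mats_comp[OF r] tr] by simp
qed

lemma word_mono_in_UT_identities:
  assumes r: "r \<ge> 1" and w: "w \<in> words (Zpow r)"
  shows "(word_mono w :: (_, 'a::field) falg) \<in> UT_identities r \<longleftrightarrow> (\<forall>p es q. \<not> trace r p w es q)"
proof
  assume T: "(word_mono w :: (_, 'a) falg) \<in> UT_identities r"
  show "\<forall>p es q. \<not> trace r p w es q"
  proof (intro allI notI)
    fix p es q assume tr: "trace r p w es q"
    \<comment> \<open>With every admissible entry equal to 1, a trace produces the nonzero entry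
      \<open>trace_sign r w es\<close>.\<close>
    let ?a = "generic_mats r (\<lambda>_. 1 :: 'a)"
    have "ueval_poly r ?a (word_mono w) = 0\<^sub>m (2 * r) (2 * r)"
      using T generic_mats_comp[OF r] unfolding UT_identities_iff[OF r] by blast
    moreover have "ueval_poly r ?a (word_mono w) = ueval r ?a w"
      by (rule ueval_poly_word_mono[OF ueval_carrier[where a="?a", OF r generic_mats_comp[OF r]]])
    moreover have one: "prod_list (map (\<lambda>_. 1 :: 'a) xs) = 1" for xs :: "'b list" by (induction xs) auto
    have "ueval r ?a w $$ (p, q) = trace_sign r w es"
      using ueval_generic_mats[OF r tr, of "\<lambda>_. 1 :: 'a"] by (simp add: one)
    moreover have "p < 2 * r" "q < 2 * r" using trace_le[OF tr] by auto
    ultimately have "trace_sign r w es = (0 :: 'a)" by simp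
    then show False using trace_sign_cases[of r w es, where 'a='a] by auto
  qed
next
  assume "\<forall>p es q. \<not> trace r p w es q"
  then have "ueval_poly r a (word_mono w) = 0\<^sub>m (2 * r) (2 * r)"
    if "\<And>i g. a i g \<in> UT_comp r g" for a :: "nat \<Rightarrow> _ \<Rightarrow> 'a mat"
    using ueval_no_trace[where a=a, OF r that, of _ w]
    by (intro eq_matI) (auto simp: word_mono_def ueval_poly_single)
  then show "(word_mono w :: (_, 'a) falg) \<in> UT_identities r"
    using w by (simp add: UT_identities_iff[OF r])
qed

section \<open>Existence of paths and monomial identities\<close>

fun chain :: "nat \<Rightarrow> nat \<Rightarrow> (nat \<Rightarrow>\<^sub>0 int) list \<Rightarrow> nat \<Rightarrow> bool" where
  "chain r p [] q \<longleftrightarrow> p = q \<and> p < 2 * r"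
| "chain r p (g # gs) q \<longleftrightarrow> (\<exists>d. (p, d) \<in> edges r g \<and> chain r d gs q)"

lemma trace_iff_chain: "(\<exists>es. trace r p w es q) \<longleftrightarrow> chain r p (map ldeg w) q"
  by (induction w arbitrary: p) (simp_all, blast)

lemma chain_le: "chain r p gs q \<Longrightarrow> p < 2 * r"
  by (induction gs arbitrary: p) (auto dest: edgesD)

text \<open>Degree 0 is realised by loops only. Together with \<open>trace_iff_chain\<close> this
  reduces the question which words are identities to their sequences of nonzero degrees.\<close>

lemma chain_filter: "chain r p (filter (\<lambda>g. g \<noteq> 0) gs) q \<longleftrightarrow> chain r p gs q"
proof (induction gs arbitrary: p)
  case (Cons g gs)
  then show ?case using chain_le by (auto simp: edges_zero)
qed simp

text \<open>Since states strictly increase, two consecutive degrees can be realised in at most one way;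
  this is why products of three letters suffice among the monomial identities.\<close>

lemma edge_pair_unique:
  assumes "(c, d) \<in> edges r g" "(d, e) \<in> edges r h" "(c', d') \<in> edges r g" "(d', e') \<in> edges r h"
    and "g \<noteq> 0" "h \<noteq> 0"
  shows "c' = c"
proof (cases "d' = d")
  case True
  then show ?thesis using edges_codet assms by blast
next
  case False
  have "c < d" "d < e" "c' < d'" "d' < e'"
    using assms edges_nonzero by blast+
  note l = edgesD[OF assms(1)] edgesD[OF assms(2)] edgesD[OF assms(3)] edgesD[OF assms(4)]
  have "c' = c \<and> d' = d \<or> c' = mir r d \<and> d' = mir r c"
    using gam_diff_eqD[of c d r c' d'] l \<open>c < d\<close> \<open>c' < d'\<close> by simp
  moreover have "d' = d \<and> e' = e \<or> d' = mir r e \<and> e' = mir r d"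
    using gam_diff_eqD[of d e r d' e'] l \<open>d < e\<close> \<open>d' < e'\<close> by simp
  \<comment> \<open>If both steps were mirrored, the middle state would be the mirror image of
    \<open>c\<close> as well as of \<open>e\<close>.\<close>
  ultimately have "mir r c = mir r e" using False by auto
  then have "c = e" using l by simp
  with \<open>c < d\<close> \<open>d < e\<close> show ?thesis by simp
qed

text \<open>The sign that is left open here is settled afterwards by
  \<open>mod_sign_trace_sign\<close>.\<close>

definition mod_sign :: "('g, 'a::field) falg set \<Rightarrow> 'g letter list \<Rightarrow> 'g letter list \<Rightarrow> bool" where
  "mod_sign I v w \<longleftrightarrow> word_mono v - word_mono w \<in> I \<or> word_mono v + word_mono w \<in> I"

lemma mod_sign_mono: "mod_sign I v w \<Longrightarrow> I \<subseteq> J \<Longrightarrow> mod_sign J v w"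
  by (auto simp: mod_sign_def)

context
  fixes G :: "'g::comm_monoid_add set" and I :: "('g, 'a::field) falg set"
  assumes I: "T_star_ideal G I"
begin

lemma mod_sign_refl: "mod_sign I w w"
  using T_star_ideal_zero[OF I] by (simp add: mod_sign_def)

lemma mod_sign_sym: "mod_sign I v w \<Longrightarrow> mod_sign I w v"
  using T_star_ideal_uminus[OF I, of "word_mono v - word_mono w"] by (auto simp: mod_sign_def add.commute)

lemma mod_sign_trans:
  assumes "mod_sign I u v" "mod_sign I v w"
  shows "mod_sign I u w"
proof -
  let ?u = "word_mono u :: ('g, 'a) falg" and ?v = "word_mono v" and ?w = "word_mono w"
  have e: "?u - ?w = (?u - ?v) + (?v - ?w)" "?u - ?w = (?u + ?v) - (?v + ?w)"
    "?u + ?w = (?u - ?v) + (?v + ?w)" "?u + ?w = (?u + ?v) - (?v - ?w)"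
    by (simp_all add: algebra_simps)
  consider "?u - ?v \<in> I" "?v - ?w \<in> I" | "?u - ?v \<in> I" "?v + ?w \<in> I"
    | "?u + ?v \<in> I" "?v - ?w \<in> I" | "?u + ?v \<in> I" "?v + ?w \<in> I"
    using assms unfolding mod_sign_def by blast
  then show ?thesis
    unfolding mod_sign_def using T_star_ideal_add[OF I] T_star_ideal_diff[OF I] e by cases metis+
qed

lemma T_star_ideal_context:
  assumes "p \<in> I" "U \<in> words G" "V \<in> words G"
  shows "word_mono U * p * word_mono V \<in> I"
  using assms T_star_ideal_lmult[OF I] T_star_ideal_rmult[OF I] by simp

lemma mod_sign_context:
  assumes "mod_sign I v w" "U \<in> words G" "V \<in> words G"
  shows "mod_sign I (U @ v @ V) (U @ w @ V)"
  using assms(1) T_star_ideal_context[OF _ assms(2,3), of "word_mono v - word_mono w"]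
    T_star_ideal_context[OF _ assms(2,3), of "word_mono v + word_mono w"]
  by (auto simp: mod_sign_def word_mono_append algebra_simps mult.assoc)

lemma mod_sign_subst:
  assumes "mod_sign I v w" "\<And>i g. g \<in> G \<Longrightarrow> \<sigma> i g \<in> words G \<and> word_deg (\<sigma> i g) = g"
  shows "mod_sign I (subst_word \<sigma> v) (subst_word \<sigma> w)"
proof -
  have endo: "map_words (subst_word \<sigma>) p \<in> I" if "p \<in> I" for p
    using T_star_ideal_endo[OF I that graded_star_endo_subst] assms(2) by blast
  from assms(1) show ?thesis
    unfolding mod_sign_def
  proof
    assume "word_mono v - word_mono w \<in> I"
    from endo[OF this] show "word_mono (subst_word \<sigma> v) - word_mono (subst_word \<sigma> w) \<in> I
        \<or> word_mono (subst_word \<sigma> v) + word_mono (subst_word \<sigma> w) \<in> I"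
      by (simp add: map_words_diff map_words_word_mono)
  next
    assume "word_mono v + word_mono w \<in> I"
    from endo[OF this] show "word_mono (subst_word \<sigma> v) - word_mono (subst_word \<sigma> w) \<in> I
        \<or> word_mono (subst_word \<sigma> v) + word_mono (subst_word \<sigma> w) \<in> I"
      by (simp add: map_words_add map_words_word_mono)
  qed
qed

end

section \<open>Consequences of the generators\<close>

context
  fixes r :: nat and I :: "(nat \<Rightarrow>\<^sub>0 int, 'a::field) falg set"
  assumes r: "r \<ge> 1" and I: "T_star_ideal (Zpow r) I" and gens: "generators r \<subseteq> I"
begin

lemma commute_zero_letters:
  assumes "ldeg y = 0" "ldeg z = 0"
  shows "mod_sign I [y, z] [z, y]"
proof -
  define \<sigma> where "\<sigma> i g = (if g = 0 \<and> i = 1 then [y] else if g = 0 \<and> i = 2 then [z] else [Letter i g False])"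
    for i and g :: "nat \<Rightarrow>\<^sub>0 int"
  have "mod_sign I [Letter 1 0 False, Letter 2 0 False] [Letter 2 0 False, Letter 1 0 False]"
    using gens unfolding mod_sign_def generators_def by blast
  moreover have "\<sigma> i g \<in> words (Zpow r) \<and> word_deg (\<sigma> i g) = g" if "g \<in> Zpow r" for i g
    using that assms by (simp add: \<sigma>_def)
  ultimately have "mod_sign I (subst_word \<sigma> [Letter 1 0 False, Letter 2 0 False])
      (subst_word \<sigma> [Letter 2 0 False, Letter 1 0 False])"
    by (rule mod_sign_subst[OF I])
  then show ?thesis by (simp add: \<sigma>_def)
qed

text \<open>The identity x* = -x in a symmetric degree is applied to a whole word at once: only the
  degree of \<open>u\<close> matters for the substitution.\<close>

lemma star_symm_word:
  assumes "symm_degree r (word_deg u)" "u \<in> words (Zpow r)"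
  shows "mod_sign I u (star_word u)"
proof -
  define \<sigma> where "\<sigma> i g = (if g = word_deg u \<and> i = 1 then u else [Letter i g False])"
    for i :: nat and g :: "nat \<Rightarrow>\<^sub>0 int"
  have "word_mono [Letter 1 (word_deg u) True] + word_mono [Letter 1 (word_deg u) False] \<in> I"
    using gens assms UT_dim_eq_1[OF r, where 'a='a] word_deg_Zpow[OF assms(2)]
    unfolding generators_def by blast
  then have "mod_sign I [Letter 1 (word_deg u) False] [Letter 1 (word_deg u) True]"
    by (simp add: mod_sign_def add.commute)
  moreover have "\<sigma> i g \<in> words (Zpow r) \<and> word_deg (\<sigma> i g) = g" if "g \<in> Zpow r" for i g
    using that assms by (simp add: \<sigma>_def)
  ultimately have "mod_sign I (subst_word \<sigma> [Letter 1 (word_deg u) False])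
      (subst_word \<sigma> [Letter 1 (word_deg u) True])"
    by (rule mod_sign_subst[OF I])
  then show ?thesis by (simp add: \<sigma>_def)
qed

text \<open>Modulo \<open>I\<close>, y u = - (y u)* = - u* y* = u y*; the word
  \<open>[y] @ u\<close> has symmetric degree as well because \<open>y\<close> has degree 0.\<close>

lemma move_zero_letter:
  assumes "symm_degree r (word_deg u)" "u \<in> words (Zpow r)" "ldeg y = 0"
  shows "mod_sign I ([y] @ u) (u @ [star_letter y])"
proof -
  have "mod_sign I ([y] @ u) (star_word u @ [star_letter y])"
    using star_symm_word[of "[y] @ u"] assms by (simp add: star_word_Cons)
  moreover have "mod_sign I (star_word u @ [star_letter y]) (u @ [star_letter y])"
    using mod_sign_context[OF I mod_sign_sym[OF I star_symm_word[OF assms(1,2)]], of "[]" "[star_letter y]"] assms(3)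
    by simp
  ultimately show ?thesis by (rule mod_sign_trans[OF I])
qed

text \<open>The variables of a monomial generator are distinct, so each can be replaced by a whole
  word of its degree. In this way letters of degree 0 are absorbed into the factors.\<close>

lemma no_chain_in_ideal:
  assumes len: "length ws \<in> {1..3}" and ws: "\<And>u. u \<in> set ws \<Longrightarrow> u \<in> words (Zpow r) \<and> word_deg u \<noteq> 0"
    and no: "\<And>p q. \<not> chain r p (map word_deg ws) q"
  shows "word_mono (concat ws) \<in> I"
proof -
  define n where "n = length ws"
  \<comment> \<open>The variables of the generators are numbered from 1, the list \<open>ws\<close>
    from 0.\<close>
  define g where "g i = word_deg (ws ! (i - 1))" for i
  define M where "M = map (\<lambda>i. Letter i (g i) False) [1..<Suc n]"
  have nth: "i \<in> {1..n} \<Longrightarrow> ws ! (i - 1) \<in> set ws" for i by (auto simp: n_def)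
  have map: "map (\<lambda>i. ws ! (i - 1)) [1..<Suc n] = ws"
    by (rule nth_equalityI) (auto simp: n_def nth_append simp del: upt_Suc)
  have "map ldeg M = map word_deg (map (\<lambda>i. ws ! (i - 1)) [1..<Suc n])"
    by (simp add: M_def g_def comp_def del: upt_Suc)
  then have "map ldeg M = map word_deg ws" unfolding map .
  then have "\<And>p es q. \<not> trace r p M es q" using no trace_iff_chain by metis
  moreover have gZ: "g i \<in> Zpow r \<and> g i \<noteq> 0" if "i \<in> {1..n}" for i
    using ws[OF nth[OF that]] word_deg_Zpow by (simp add: g_def)
  then have "M \<in> words (Zpow r)" by (auto simp: M_def words_def simp del: upt_Suc)
  ultimately have MT: "(word_mono M :: (_, 'a) falg) \<in> UT_identities r"
    using word_mono_in_UT_identities[OF r] by blast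
  have "n \<in> {1..3} \<and> (\<forall>i\<in>{1..n}. g i \<in> Zpow r \<and> g i \<noteq> 0) \<and>
      word_mono M = (word_mono (map (\<lambda>i. Letter i (g i) False) [1..<Suc n]) :: (_, 'a) falg) \<and>
      (word_mono M :: (_, 'a) falg) \<in> UT_identities r"
    using gZ len MT by (simp only: n_def[symmetric] M_def[symmetric]) simp
  then have "(word_mono M :: (_, 'a) falg) \<in> generators r"
    unfolding generators_def by (intro UnI2) (rule CollectI, intro exI)
  then have MI: "word_mono M \<in> I" using gens by blast
  define \<sigma> where "\<sigma> i h = (if i \<in> {1..n} \<and> h = g i then ws ! (i - 1) else [Letter i h False])" for i h
  have "\<sigma> i h \<in> words (Zpow r) \<and> word_deg (\<sigma> i h) = h" if "h \<in> Zpow r" for i h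
    using ws[OF nth[of i]] that by (auto simp: \<sigma>_def g_def)
  from T_star_ideal_endo[OF I MI graded_star_endo_subst[OF this]]
  have "word_mono (subst_word \<sigma> M) \<in> I" by (simp add: map_words_word_mono)
  moreover have "subst_word \<sigma> M = concat (map (\<lambda>i. ws ! (i - 1)) [1..<Suc n])"
    unfolding subst_word_def M_def map_map
    by (intro arg_cong[of _ _ concat] map_cong) (auto simp: \<sigma>_def simp del: upt_Suc)
  ultimately show ?thesis unfolding map by simp
qed

lemma filter_Cons_split:
  assumes "filter (\<lambda>g. g \<noteq> 0) (map ldeg w) = h # hs"
  obtains A y B where "w = A @ [y] @ B" "ldeg y = h" "h \<noteq> 0" "\<forall>l\<in>set A. ldeg l = 0"
    "filter (\<lambda>g. g \<noteq> 0) (map ldeg B) = hs"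
  using assms
proof (induction w arbitrary: thesis)
  case (Cons l w)
  show ?case
  proof (cases "ldeg l = 0")
    case True
    with Cons.prems have "filter (\<lambda>g. g \<noteq> 0) (map ldeg w) = h # hs" by simp
    from Cons.IH[OF _ this] obtain A y B where "w = A @ [y] @ B" "ldeg y = h" "h \<noteq> 0"
      "\<forall>l\<in>set A. ldeg l = 0" "filter (\<lambda>g. g \<noteq> 0) (map ldeg B) = hs" by metis
    with True show ?thesis using Cons.prems(1)[of "l # A" y B] by simp
  next
    case False
    then show ?thesis using Cons.prems(1)[of "[]" l w] Cons.prems(2) by simp
  qed
qed simp

text \<open>If \<open>l\<close> has nonzero degree, a path for \<open>w\<close> and a path for the
  first three letters of nonzero degree in \<open>l # w\<close> share two consecutive degrees; by
  \<open>edge_pair_unique\<close> they fit together. This gluing is the origin of the bound 3 on the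
  length of the monomial identities.\<close>

lemma chain_if_not_in_ideal:
  assumes "w \<in> words (Zpow r)" "word_mono w \<notin> I"
  shows "\<exists>p q. chain r p (map ldeg w) q"
  using assms
proof (induction w)
  case Nil
  show ?case using r by (intro exI[of _ 0]) simp
next
  case (Cons l w)
  have drop: "word_mono u \<notin> I" if "l # w = u @ v" for u v
  proof
    assume "word_mono u \<in> I"
    moreover have "v \<in> words (Zpow r)" using Cons.prems(1) unfolding that by simp
    ultimately have "word_mono (u @ v) \<in> I"
      unfolding word_mono_append by (intro T_star_ideal_rmult[OF I]) auto
    with Cons.prems(2) that show False by simp
  qed
  have lw: "l # w \<in> words (Zpow r)" by fact
  have "word_mono w \<notin> I"
  proof
    assume "word_mono w \<in> I"
    then have "word_mono ([l] @ w) \<in> I"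
      unfolding word_mono_append using Cons.prems(1) by (intro T_star_ideal_lmult[OF I]) auto
    with Cons.prems(2) show False by simp
  qed
  then obtain p q where IH: "chain r p (map ldeg w) q" using Cons by auto
  show ?case
  proof (cases "ldeg l = 0")
    case True
    then have "chain r p (map ldeg (l # w)) q" using IH chain_le[OF IH] by (auto simp: edges_zero)
    then show ?thesis by blast
  next
    case l: False
    have *: "\<exists>c d. (c, d) \<in> edges r (ldeg l) \<and> (\<exists>q. chain r d (filter (\<lambda>g. g \<noteq> 0) (map ldeg w)) q)"
    proof (cases "filter (\<lambda>g. g \<noteq> 0) (map ldeg w)")
      case Nil
      have "\<exists>p q. chain r p (map word_deg [[l]]) q"
        using no_chain_in_ideal[of "[[l]]"] drop[of "[l]" w] Cons.prems(1) l by auto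
      then show ?thesis unfolding Nil by auto
    next
      case (Cons h hs)
      then obtain A y B where w: "w = A @ [y] @ B" and h: "ldeg y = h" "h \<noteq> 0"
        and A: "\<forall>l\<in>set A. ldeg l = 0" and B: "filter (\<lambda>g. g \<noteq> 0) (map ldeg B) = hs"
        by (rule filter_Cons_split)
      show ?thesis
      proof (cases hs)
        case Nil
        \<comment> \<open>Letters of degree 0 are attached to the factor on their left.\<close>
        have "\<exists>p q. chain r p (map word_deg [[l] @ A, [y]]) q"
        proof (rule ccontr)
          assume "\<not> ?thesis"
          then have "word_mono (concat [[l] @ A, [y]]) \<in> I"
            using lw w l h word_deg_all_zero[OF A] by (intro no_chain_in_ideal) auto
          with drop[of "[l] @ A @ [y]" B] w show False by simp
        qed
        then show ?thesis
          using h word_deg_all_zero[OF A] unfolding \<open>filter _ _ = h # hs\<close> Nil by auto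
      next
        case (Cons h2 hs2)
        with B obtain A2 z C where B2: "B = A2 @ [z] @ C" and h2: "ldeg z = h2" "h2 \<noteq> 0"
          and A2: "\<forall>l\<in>set A2. ldeg l = 0"
          by (metis filter_Cons_split)
        have "\<exists>p q. chain r p (map word_deg [[l] @ A, [y] @ A2, [z]]) q"
        proof (rule ccontr)
          assume "\<not> ?thesis"
          then have "word_mono (concat [[l] @ A, [y] @ A2, [z]]) \<in> I"
            using lw w B2 l h h2 word_deg_all_zero[OF A] word_deg_all_zero[OF A2]
            by (intro no_chain_in_ideal) auto
          with drop[of "[l] @ A @ [y] @ A2 @ [z]" C] w B2 show False by simp
        qed
        then obtain c d e f where cd: "(c, d) \<in> edges r (ldeg l)" "(d, e) \<in> edges r h" "(e, f) \<in> edges r h2"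
          using h h2 word_deg_all_zero[OF A] word_deg_all_zero[OF A2] by auto
        have IH': "chain r p (h # h2 # hs2) q"
          using IH chain_filter[of r p "map ldeg w" q] \<open>filter _ _ = h # hs\<close> Cons by simp
        then obtain e' f' where "(p, e') \<in> edges r h" "(e', f') \<in> edges r h2" by auto
        \<comment> \<open>Both paths take steps of degrees \<open>h\<close> and \<open>h2\<close> in
          succession, so they meet in \<open>d\<close>.\<close>
        then have "p = d" using edge_pair_unique[OF cd(2,3)] h h2 by blast
        then show ?thesis
          using cd(1) IH' unfolding \<open>filter _ _ = h # hs\<close> Cons by blast
      qed
    qed
    then obtain c d q' where "(c, d) \<in> edges r (ldeg l)" "chain r d (map ldeg w) q'"
      unfolding chain_filter by blast
    then have "chain r c (map ldeg (l # w)) q'" by auto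
    then show ?thesis by blast
  qed
qed

lemma word_mono_identity_in_ideal:
  assumes "(word_mono w :: (_, 'a) falg) \<in> UT_identities r"
  shows "word_mono w \<in> I"
proof (rule ccontr)
  assume "word_mono w \<notin> I"
  moreover have w: "w \<in> words (Zpow r)"
  proof -
    have "(word_mono w :: (_, 'a) falg) \<in> fcarrier (Zpow r)"
      using assms by (simp only: UT_identities_iff[OF r])
    from fcarrierD[OF this, of "Word w"] show ?thesis by (simp add: word_mono_def)
  qed
  ultimately obtain p q where "chain r p (map ldeg w) q" using chain_if_not_in_ideal by blast
  then obtain es where "trace r p w es q" using trace_iff_chain by metis
  with assms show False using word_mono_in_UT_identities[OF r w] by blast
qed

end

section \<open>Termination of the rewriting\<close>

definition nonzero_letters :: "'g::zero letter list \<Rightarrow> 'g letter list" where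
  "nonzero_letters = filter (\<lambda>l. ldeg l \<noteq> 0)"

text \<open>The number of pairs of a letter of degree 0 and a later letter of nonzero degree, which
  drops when a degree-zero letter moves to the right across a letter of nonzero degree.\<close>

fun zero_before :: "'g::zero letter list \<Rightarrow> nat" where
  "zero_before [] = 0"
| "zero_before (l # w) = (if ldeg l = 0 then length (nonzero_letters w) else 0) + zero_before w"

lemma nonzero_letters_append [simp]: "nonzero_letters (u @ v) = nonzero_letters u @ nonzero_letters v"
  by (simp add: nonzero_letters_def)

lemma nonzero_letters_Cons [simp]:
  "nonzero_letters (l # w) = (if ldeg l = 0 then nonzero_letters w else l # nonzero_letters w)"
  "nonzero_letters [] = []"
  by (simp_all add: nonzero_letters_def)

lemma length_nonzero_star [simp]: "length (nonzero_letters (star_word w)) = length (nonzero_letters w)"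
  by (induction w) (simp_all add: star_word_Cons)

lemma zero_before_append:
  "zero_before (u @ v) = zero_before u + zero_before v
     + length (filter (\<lambda>l. ldeg l = 0) u) * length (nonzero_letters v)"
  by (induction u) auto

text \<open>Every rewriting step towards a normal word decreases this quadruple lexicographically.\<close>

definition word_measure :: "nat \<Rightarrow> (nat \<Rightarrow>\<^sub>0 int) letter list \<Rightarrow> nat list \<times> nat \<times> nat \<times> nat list" where
  "word_measure r w = (map idx (nonzero_letters w), zero_before w,
     length (filter (\<lambda>l. starred l \<and> symm_degree r (ldeg l)) w), map idx w)"

definition word_less :: "nat \<Rightarrow> ((nat \<Rightarrow>\<^sub>0 int) letter list \<times> (nat \<Rightarrow>\<^sub>0 int) letter list) set" where
  "word_less r = inv_image
     (lenlex less_than <*lex*> less_than <*lex*> less_than <*lex*> lenlex less_than) (word_measure r)"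

lemma wf_word_less: "wf (word_less r)"
  unfolding word_less_def by (intro wf_inv_image wf_lex_prod wf_lenlex wf_less_than)

lemma lenlex_first_less:
  "a < b \<Longrightarrow> length xs = length ys \<Longrightarrow> (P @ a # xs, P @ b # ys) \<in> lenlex less_than"
  by (auto simp: lenlex_conv lex_conv)

context
  fixes r :: nat and I :: "(nat \<Rightarrow>\<^sub>0 int, 'a::field) falg set"
  assumes r: "r \<ge> 1" and I: "T_star_ideal (Zpow r) I" and gens: "generators r \<subseteq> I"
begin

lemma move_zero_step:
  assumes w: "w = U @ [y] @ u @ V" "w \<in> words (Zpow r)" and y: "ldeg y = 0"
    and u: "symm_degree r (word_deg u)" "nonzero_letters u \<noteq> []"
  shows "\<exists>v. (v, w) \<in> word_less r \<and> mod_sign I w v \<and> mset (map idx v) = mset (map idx w) \<and> v \<in> words (Zpow r)"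
proof (intro exI conjI)
  let ?v = "U @ (u @ [star_letter y]) @ V"
  have "mod_sign I (U @ ([y] @ u) @ V) (U @ (u @ [star_letter y]) @ V)"
    using w y u by (intro mod_sign_context[OF I] move_zero_letter[OF r I gens]) auto
  then show "mod_sign I w ?v" using w by simp
  have "length (nonzero_letters u) > 0" using u by simp
  then have "zero_before ?v < zero_before w"
    using y by (simp add: w zero_before_append algebra_simps)
  then show "(?v, w) \<in> word_less r"
    using y by (simp add: w word_less_def word_measure_def)
qed (use w in auto)

text \<open>Each failing clause of \<open>normal_word\<close> offers a move. Swapping neighbours for
  (I) lowers the last component of \<open>word_measure\<close>; removing a star for (II) lowers the
  third; moving a degree-zero letter to the right across a symmetric factor lowers the second;
  reversing a symmetric factor for (III) puts the smaller index first and lowers the first. Earlier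
  components stay the same, later ones may grow.\<close>

lemma normalize_step:
  assumes w: "w \<in> words (Zpow r)" and dist: "distinct (map idx w)" and nn: "\<not> normal_wd r w"
  shows "\<exists>v. (v, w) \<in> word_less r \<and> mod_sign I w v \<and> mset (map idx v) = mset (map idx w) \<and> v \<in> words (Zpow r)"
proof -
  have ends: "\<exists>U' y. U = U' @ [y] \<and> ldeg y = 0" if "\<not> ends_nonzero U" for U :: "(nat \<Rightarrow>\<^sub>0 int) letter list"
    using that by (cases U rule: rev_cases) (auto simp: ends_nonzero_def)
  from nn consider
      (I) U y z V where "w = U @ [y, z] @ V" "ldeg y = 0" "ldeg z = 0" "\<not> idx y < idx z"
    | (II) U x V where "w = U @ [x] @ V" "symm_degree r (ldeg x)" "starred x"
    | (II') U x V where "w = U @ [x] @ V" "symm_degree r (ldeg x)" "\<not> ends_nonzero U"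
    | (III) U x A y V where "w = U @ [x] @ A @ [y] @ V" "ldeg x \<noteq> 0" "ldeg y \<noteq> 0"
        "symm_degree r (word_deg ([x] @ A @ [y]))" "\<not> idx x < idx y"
    | (III') U x A y V where "w = U @ [x] @ A @ [y] @ V" "ldeg x \<noteq> 0" "ldeg y \<noteq> 0"
        "symm_degree r (word_deg ([x] @ A @ [y]))" "\<not> ends_nonzero U"
    unfolding normal_word_def de_Morgan_conj not_all not_imp not_not
    by (elim disjE exE conjE) assumption+
  then show ?thesis
  proof cases
    case I: I
    let ?v = "U @ [z, y] @ V"
    have "mod_sign I w ?v"
      using w I commute_zero_letters[OF r \<open>T_star_ideal (Zpow r) I\<close> gens, of y z]
        mod_sign_context[OF \<open>T_star_ideal (Zpow r) I\<close>, of "[y, z]" "[z, y]" U V] by simp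
    moreover have "idx z < idx y" using I dist by auto
    then have "(map idx ?v, map idx w) \<in> lenlex less_than"
      using lenlex_first_less[of "idx z" "idx y" "idx y # map idx V" "idx z # map idx V" "map idx U"] I by simp
    then have "(?v, w) \<in> word_less r"
      using I symm_degree_nonzero by (auto simp: word_less_def word_measure_def zero_before_append)
    ultimately show ?thesis using w I by (intro exI[of _ ?v]) auto
  next
    case II
    let ?v = "U @ [star_letter x] @ V"
    have "mod_sign I [x] (star_word [x])"
      using II w by (intro star_symm_word[OF r I gens]) auto
    then have "mod_sign I w ?v"
      using w II mod_sign_context[OF I, of "[x]" "[star_letter x]" U V] by simp
    moreover have "ldeg x \<noteq> 0" using II symm_degree_nonzero by auto
    then have "(?v, w) \<in> word_less r"
      using II by (auto simp: word_less_def word_measure_def zero_before_append)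
    ultimately show ?thesis using w II by (intro exI[of _ ?v]) auto
  next
    case II'
    then obtain U' y where "U = U' @ [y]" "ldeg y = 0" using ends by blast
    moreover have "ldeg x \<noteq> 0" using II' symm_degree_nonzero by auto
    ultimately show ?thesis
      using II' w by (intro move_zero_step[of w U' y "[x]" V]) auto
  next
    case III
    let ?u = "[x] @ A @ [y]"
    let ?v = "U @ star_word ?u @ V"
    have "mod_sign I ?u (star_word ?u)"
      using III w by (intro star_symm_word[OF r I gens]) auto
    then have "mod_sign I w ?v"
      using w III mod_sign_context[OF I, of ?u "star_word ?u" U V] by simp
    moreover have "idx y < idx x" using III dist by auto
    then have "(map idx (nonzero_letters ?v), map idx (nonzero_letters w)) \<in> lenlex less_than"
      using lenlex_first_less[of "idx y" "idx x"
          "map idx (nonzero_letters (star_word A) @ [star_letter x] @ nonzero_letters V)"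
          "map idx (nonzero_letters A @ [y] @ nonzero_letters V)" "map idx (nonzero_letters U)"] III
      by (simp add: star_word_Cons)
    then have "(?v, w) \<in> word_less r"
      by (simp add: word_less_def word_measure_def)
    moreover have "mset (map idx (star_word u)) = mset (map idx u)" for u :: "(nat \<Rightarrow>\<^sub>0 int) letter list"
      by (induction u) (simp_all add: star_word_Cons)
    then have "mset (map idx ?v) = mset (map idx w)" using III by (simp add: star_word_Cons)
    ultimately show ?thesis using w III by (intro exI[of _ ?v]) (auto simp: star_word_Cons)
  next
    case III'
    then obtain U' z where "U = U' @ [z]" "ldeg z = 0" using ends by blast
    then show ?thesis
      using III' w by (intro move_zero_step[of w U' z "[x] @ A @ [y]" V]) auto
  qed
qed

lemma normal_form_exists:
  assumes "w \<in> words (Zpow r)" "distinct (map idx w)"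
  shows "\<exists>v. normal_wd r v \<and> mod_sign I w v \<and> mset (map idx v) = mset (map idx w) \<and> v \<in> words (Zpow r)"
  using wf_word_less[of r] assms
proof (induction w rule: wf_induct_rule)
  case (less w)
  show ?case
  proof (cases "normal_wd r w")
    case True
    then show ?thesis using less.prems mod_sign_refl[OF I] by blast
  next
    case False
    then obtain v where v: "(v, w) \<in> word_less r" "mod_sign I w v" "mset (map idx v) = mset (map idx w)"
      "v \<in> words (Zpow r)"
      using normalize_step less.prems by blast
    have "distinct (map idx v)" using v(3) less.prems(2) by (metis mset_eq_imp_distinct_iff)
    from less.IH[OF v(1,4) this] v show ?thesis using mod_sign_trans[OF I] by metis
  qed
qed

end

text \<open>Substituting a matrix unit for every variable of \<open>w\<close> singles out the words whose trace
  from \<open>p\<close> to \<open>q\<close> uses the same matrix units.\<close>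

definition unit_subst :: "(nat \<Rightarrow>\<^sub>0 int) letter list \<Rightarrow> (nat \<times> nat) list \<Rightarrow> nat \<times> nat \<times> nat \<Rightarrow> 'a::field" where
  "unit_subst w es x = (if x \<in> trace_vars w es then 1 else 0)"

lemma prod_list_unit_subst:
  "prod_list (map (unit_subst w es) xs) = (if set xs \<subseteq> trace_vars w es then 1 else (0 :: 'a::field))"
  by (induction xs) (auto simp: unit_subst_def)

text \<open>With distinct variables both sets have as many elements as the words have
  letters.\<close>

lemma trace_vars_eq:
  assumes "trace_vars w' es' \<subseteq> trace_vars w es" "length es = length w" "length es' = length w'"
    and "distinct (map idx w)" "mset (map idx w') = mset (map idx w)"
  shows "trace_vars w' es' = trace_vars w es"
proof (rule card_subset_eq)
  have "distinct (map idx w')" using assms(4,5) by (metis mset_eq_imp_distinct_iff)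
  moreover have "length w' = length w" using assms(5) by (metis length_map mset_eq_length)
  ultimately have "distinct (zip (map idx w') es')" "distinct (zip (map idx w) es)"
    using assms by (auto intro: distinct_zipI1)
  then show "card (trace_vars w' es') = card (trace_vars w es)"
    using \<open>length w' = length w\<close> assms(2,3) by (simp add: trace_vars_def distinct_card)
qed (use assms in \<open>simp_all add: trace_vars_def\<close>)

lemma unit_subst_value:
  assumes r: "r \<ge> 1" and w: "w \<in> words (Zpow r)" "distinct (map idx w)" and tr: "trace r p w es q"
    and w': "mset (map idx w') = mset (map idx w)"
    and nz: "ueval r (generic_mats r (unit_subst w es :: _ \<Rightarrow> 'a::field)) w' $$ (p, q) \<noteq> 0"
  obtains es' where "trace r p w' es' q" "trace_vars w' es' = trace_vars w es"
proof -
  let ?a = "generic_mats r (unit_subst w es :: _ \<Rightarrow> 'a)"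
  have pq: "p < 2 * r" "q < 2 * r" using trace_le[OF tr] by auto
  obtain es' where tr': "trace r p w' es' q"
    using ueval_no_trace[where a="?a", OF r generic_mats_comp[OF r], of p w' q] pq nz by blast
  have "trace_sign r w' es' * prod_list (map (unit_subst w es) (zip (map idx w') es')) \<noteq> (0 :: 'a)"
    using nz ueval_generic_mats[OF r tr', of "unit_subst w es :: _ \<Rightarrow> 'a"] by simp
  then have "trace_vars w' es' \<subseteq> trace_vars w es"
    unfolding prod_list_unit_subst trace_vars_def[of w'] by (auto split: if_splits)
  then have "trace_vars w' es' = trace_vars w es"
    using trace_vars_eq trace_length[OF tr] trace_length[OF tr'] w(2) w' by blast
  with tr' that show ?thesis by blast
qed

lemma unit_subst_self:
  assumes r: "r \<ge> 1" and tr: "trace r p w es q"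
  shows "ueval r (generic_mats r (unit_subst w es :: _ \<Rightarrow> 'a::field)) w $$ (p, q) \<noteq> 0"
  using ueval_generic_mats[OF r tr, of "unit_subst w es :: _ \<Rightarrow> 'a"] trace_sign_cases[of r w es, where 'a='a]
  by (auto simp: prod_list_unit_subst trace_vars_def)

lemma unit_subst_normal:
  assumes r: "r \<ge> 1" and w: "w \<in> words (Zpow r)" "distinct (map idx w)" and tr: "trace r p w es q"
    and w': "mset (map idx w') = mset (map idx w)"
    and nz: "ueval r (generic_mats r (unit_subst w es :: _ \<Rightarrow> 'a::field)) w' $$ (p, q) \<noteq> 0"
    and "normal_wd r w" "normal_wd r w'"
  shows "w' = w"
proof -
  obtain es' where "trace r p w' es' q" "trace_vars w' es' = trace_vars w es"
    using unit_subst_value[OF r w tr w' nz] .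
  moreover have "distinct (map idx w')" using w(2) w' by (metis mset_eq_imp_distinct_iff)
  ultimately show ?thesis using normal_word_unique[of r w' w p es' q es] assms by simp
qed

text \<open>A sign does not affect vanishing, and that is enough to transfer a trace from a word to
  its normal form.\<close>

lemma mod_sign_ueval:
  assumes r: "r \<ge> 1" and a: "\<And>i g. a i g \<in> UT_comp r g"
    and "mod_sign (UT_identities r :: (_, 'a::field) falg set) v w" "p < 2 * r" "q < 2 * r"
  shows "ueval r a v $$ (p, q) = 0 \<longleftrightarrow> ueval r a w $$ (p, q) = (0 :: 'a)"
proof -
  have m: "ueval_poly r a (word_mono u) $$ (p, q) = ueval r a u $$ (p, q)" for u
    using assms by (simp add: word_mono_def ueval_poly_single)
  have "ueval_poly r a (word_mono v - word_mono w) = 0\<^sub>m (2 * r) (2 * r) \<or>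
      ueval_poly r a (word_mono v + word_mono w) = 0\<^sub>m (2 * r) (2 * r)"
    using assms(3) a unfolding mod_sign_def UT_identities_iff[OF r] by blast
  then show ?thesis
  proof
    assume *: "ueval_poly r a (word_mono v - word_mono w) = 0\<^sub>m (2 * r) (2 * r)"
    have "ueval_poly r a (word_mono v) = ueval_poly r a (word_mono v - word_mono w) + ueval_poly r a (word_mono w)"
      by (simp flip: ueval_poly_add)
    then have "ueval_poly r a (word_mono v) $$ (p, q) = ueval_poly r a (word_mono w) $$ (p, q)"
      using assms(4,5) by (simp add: *)
    then show ?thesis by (simp add: m)
  next
    assume "ueval_poly r a (word_mono v + word_mono w) = 0\<^sub>m (2 * r) (2 * r)"
    then have "(ueval_poly r a (word_mono v) + ueval_poly r a (word_mono w)) $$ (p, q) = 0"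
      using assms(4,5) by (simp flip: ueval_poly_add)
    then have "ueval r a v $$ (p, q) + ueval r a w $$ (p, q) = 0"
      using assms(4,5) by (simp add: m)
    then show ?thesis by (metis add.right_neutral add.left_neutral)
  qed
qed

section \<open>The basis of the identities\<close>

text \<open>Independence of monomials as functions, by removing one variable \<open>v\<close> at a
  time: the value of \<open>v\<close> is varied alone, and a polynomial in one unknown that vanishes
  on a field of characteristic zero is 0.\<close>

lemma monomial_coeff_zero:
  fixes c :: "'w \<Rightarrow> 'a::field_char_0" and m :: "'w \<Rightarrow> 'v multiset"
  assumes "finite A" and "\<And>s. (\<Sum>w\<in>A. c w * prod_mset (image_mset s (m w))) = 0"
  shows "(\<Sum>w | w \<in> A \<and> m w = \<mu>. c w) = 0"
proof -
  have "finite (\<Union>w\<in>A. set_mset (m w))" using assms(1) by simp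
  then show ?thesis
    using assms
  proof (induction "\<Union>w\<in>A. set_mset (m w)" arbitrary: A m \<mu> rule: finite_psubset_induct)
    case psubset
    let ?X = "\<lambda>A m. \<Union>w\<in>A. set_mset (m w)"
    show ?case
    proof (cases "?X A m = {}")
      case True
      then have e: "m w = {#}" if "w \<in> A" for w using that by auto
      then have "(\<Sum>w\<in>A. c w) = (\<Sum>w\<in>A. c w * prod_mset (image_mset (\<lambda>_. 1) (m w)))"
        by (intro sum.cong) auto
      then have "(\<Sum>w\<in>A. c w) = 0" using psubset.prems(2)[of "\<lambda>_. 1"] by simp
      moreover have "{w. w \<in> A \<and> m w = \<mu>} = (if \<mu> = {#} then A else {})" using e by auto
      ultimately show ?thesis by simp
    next
      case False
      then obtain v where v: "v \<in> ?X A m" by blast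
      let ?A = "\<lambda>k. {w \<in> A. count (m w) v = k}"
      let ?m = "\<lambda>w. filter_mset (\<lambda>x. x \<noteq> v) (m w)"
      have zero: "(\<Sum>w\<in>?A k. c w * prod_mset (image_mset s (?m w))) = 0" for k s
      proof -
        \<comment> \<open>The polynomial in the value of \<open>v\<close>, the other values being
          given by \<open>s\<close>; its coefficient at \<open>k\<close> collects the words whose
          monomial contains \<open>v\<close> exactly \<open>k\<close> times.\<close>
        define P where "P = (\<Sum>w\<in>A. monom (c w * prod_mset (image_mset s (?m w))) (count (m w) v))"
        have "poly P t = 0" for t
        proof -
          have "prod_mset (image_mset (s(v := t)) (m w))
              = t ^ count (m w) v * prod_mset (image_mset s (?m w))" for w
          proof -
            have "m w = replicate_mset (count (m w) v) v + ?m w"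
              by (rule multiset_eqI) simp
            then have "prod_mset (image_mset (s(v := t)) (m w))
                = prod_mset (image_mset (s(v := t)) (replicate_mset (count (m w) v) v))
                  * prod_mset (image_mset (s(v := t)) (?m w))"
              by (metis image_mset_union prod_mset.union)
            moreover have "image_mset (s(v := t)) (?m w) = image_mset s (?m w)"
              by (intro image_mset_cong) auto
            ultimately show ?thesis by simp
          qed
          then have "poly P t = (\<Sum>w\<in>A. c w * prod_mset (image_mset (s(v := t)) (m w)))"
            by (simp add: P_def poly_sum poly_monom mult_ac)
          then show ?thesis using psubset.prems(2) by simp
        qed
        then have "P = 0" using poly_all_0_iff_0 by blast
        then have "coeff P k = 0" by simp
        then show ?thesis
          using psubset.prems(1) by (simp add: P_def coeff_sum sum.inter_filter)
      qed
      have sub: "?X (?A k) ?m \<subset> ?X A m" for k using v by auto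
      have "(\<Sum>w | w \<in> ?A (count \<mu> v) \<and> ?m w = filter_mset (\<lambda>x. x \<noteq> v) \<mu>. c w) = 0"
        by (rule psubset.hyps(2)[OF sub]) (use psubset.prems(1) zero in auto)
      moreover have "(w \<in> ?A (count \<mu> v) \<and> ?m w = filter_mset (\<lambda>x. x \<noteq> v) \<mu>) \<longleftrightarrow> w \<in> A \<and> m w = \<mu>" for w
      proof
        assume *: "w \<in> ?A (count \<mu> v) \<and> ?m w = filter_mset (\<lambda>x. x \<noteq> v) \<mu>"
        have "count (m w) x = count \<mu> x" for x
        proof (cases "x = v")
          case False
          then have "count (m w) x = count (?m w) x" by simp
          also have "\<dots> = count \<mu> x" using * False by simp
          finally show ?thesis .
        qed (use * in simp)
        then show "w \<in> A \<and> m w = \<mu>" using * by (simp add: multiset_eq_iff)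
      qed auto
      ultimately show ?thesis by simp
    qed
  qed
qed

lemma trace_relabel:
  "map ldeg u = map ldeg w \<Longrightarrow> map starred u = map starred w \<Longrightarrow> trace r p u es q \<longleftrightarrow> trace r p w es q"
proof (induction w arbitrary: u p es)
  case (Cons l w)
  then obtain m v where u: "u = m # v" "ldeg m = ldeg l" "starred m = starred l"
    "map ldeg v = map ldeg w" "map starred v = map starred w" by (cases u) auto
  then show ?case using Cons.IH[of v] by (simp add: letter_edge_def)
qed simp

context
  fixes r :: nat and I :: "(nat \<Rightarrow>\<^sub>0 int, 'a::field_char_0) falg set"
  assumes r: "r \<ge> 1" and I: "T_star_ideal (Zpow r) I" and gens: "generators r \<subseteq> I"
    and sub: "I \<subseteq> UT_identities r"
begin

text \<open>Since \<open>I\<close> consists of identities, the value at the matrix units of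
  \<open>w\<close> stays nonzero when a word is replaced by its normal form. Hence both normal forms
  have traces with the same variables, and \<open>normal_word_unique\<close> makes them
  equal.\<close>

lemma same_trace_distinct:
  assumes w: "w \<in> words (Zpow r)" and dist: "distinct (map idx w)"
    and w': "w' \<in> words (Zpow r)" and m: "mset (map idx w') = mset (map idx w)"
    and tr: "trace r p w es q" and tr': "trace r p w' es' q"
    and vars: "trace_vars w es = trace_vars w' es'"
  shows "mod_sign I w w'"
proof -
  let ?a = "generic_mats r (unit_subst w es :: _ \<Rightarrow> 'a)"
  have dist': "distinct (map idx w')" using dist m by (metis mset_eq_imp_distinct_iff)
  have pq: "p < 2 * r" "q < 2 * r" using trace_le[OF tr] by auto
  have nf: "\<exists>v f. normal_wd r v \<and> mod_sign I u v \<and> mset (map idx v) = mset (map idx w) \<and>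
      trace r p v f q \<and> trace_vars v f = trace_vars w es"
    if u: "u \<in> words (Zpow r)" "mset (map idx u) = mset (map idx w)" "trace r p u f q"
      "trace_vars u f = trace_vars w es" for u f
  proof -
    have "distinct (map idx u)" using dist u(2) by (metis mset_eq_imp_distinct_iff)
    then obtain v where v: "normal_wd r v" "mod_sign I u v" "mset (map idx v) = mset (map idx u)"
      using normal_form_exists[OF r I gens u(1)] by blast
    have "unit_subst w es = (unit_subst u f :: _ \<Rightarrow> 'a)"
      using u(4) by (simp add: unit_subst_def fun_eq_iff)
    then have "ueval r ?a u $$ (p, q) \<noteq> 0" using unit_subst_self[OF r u(3), where 'a='a] by simp
    then have "ueval r ?a v $$ (p, q) \<noteq> 0"
      using mod_sign_ueval[where a="?a", OF r generic_mats_comp[OF r] mod_sign_mono[OF v(2) sub] pq] by simp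
    then obtain f' where "trace r p v f' q" "trace_vars v f' = trace_vars w es"
      using unit_subst_value[OF r w dist tr, of v] v(3) u(2) by metis
    then show ?thesis using v u(2) by metis
  qed
  obtain v f where v: "normal_wd r v" "mod_sign I w v" "mset (map idx v) = mset (map idx w)"
    "trace r p v f q" "trace_vars v f = trace_vars w es" using nf[OF w refl tr refl] by blast
  obtain v' f' where v': "normal_wd r v'" "mod_sign I w' v'" "mset (map idx v') = mset (map idx w)"
    "trace r p v' f' q" "trace_vars v' f' = trace_vars w es" using nf[OF w' m tr' vars[symmetric]] by blast
  have "distinct (map idx v)" "distinct (map idx v')"
    using v(3) v'(3) dist by (metis mset_eq_imp_distinct_iff)+
  then have "v = v'" using normal_word_unique[OF v(1) v'(1) v(4) v'(4)] v(5) v'(5) by simp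
  then show ?thesis using mod_sign_trans[OF I v(2)] mod_sign_sym[OF I v'(2)] by simp
qed

text \<open>Repeated variables are reduced to the multilinear case by numbering the positions of the first
  word and transporting the numbers along the bijection between equal matrix units.\<close>

lemma same_trace_mod_sign:
  assumes w: "w \<in> words (Zpow r)" and w': "w' \<in> words (Zpow r)"
    and tr: "trace r p w es q" and tr': "trace r p w' es' q"
    and vars: "mset (zip (map idx w') es') = mset (zip (map idx w) es)"
  shows "mod_sign I w w'"
proof -
  define n where "n = length w"
  have les: "length es = n" "length es' = length w'"
    using trace_length[OF tr] trace_length[OF tr'] by (simp_all add: n_def)
  obtain \<pi> where \<pi>: "\<pi> permutes {..<length (zip (map idx w) es)}"
    and pl: "permute_list \<pi> (zip (map idx w) es) = zip (map idx w') es'"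
    using mset_eq_permutation[OF vars] by blast
  have lz: "length (zip (map idx w) es) = n" using les by (simp add: n_def)
  have n': "length w' = n" using arg_cong[OF pl, of length] lz les by simp
  have \<pi>n: "\<pi> i < n" if "i < n" for i
    using permutes_in_image[OF \<pi>, of i] that unfolding lz by simp
  have nth: "idx (w' ! i) = idx (w ! \<pi> i)" "es' ! i = es ! \<pi> i" if "i < n" for i
  proof -
    have "zip (map idx w') es' ! i = zip (map idx w) es ! \<pi> i"
      using permute_list_nth[OF \<pi>, of i] that unfolding pl lz by simp
    then show "idx (w' ! i) = idx (w ! \<pi> i)" "es' ! i = es ! \<pi> i"
      using that \<pi>n[OF that] les n' by (simp_all add: n_def)
  qed
  \<comment> \<open>In \<open>W\<close> the letter at position \<open>i\<close> gets the variable
    \<open>i\<close>; in \<open>W'\<close> it gets the position of the letter of \<open>w\<close>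
    that is its partner under the bijection, which uses the same generic entry.\<close>
  define W where "W = map (\<lambda>i. Letter i (ldeg (w ! i)) (starred (w ! i))) [0..<n]"
  define W' where "W' = map (\<lambda>i. Letter (\<pi> i) (ldeg (w' ! i)) (starred (w' ! i))) [0..<n]"
  have maps: "map ldeg W = map ldeg w" "map starred W = map starred w"
    "map ldeg W' = map ldeg w'" "map starred W' = map starred w'"
    by (rule nth_equalityI; simp add: W_def W'_def n_def n'[unfolded n_def])+
  have idxW: "map idx W = [0..<n]" "map idx W' = map \<pi> [0..<n]"
    by (simp_all add: W_def W'_def comp_def)
  have "mset (map \<pi> [0..<n]) = mset [0..<n]"
  proof -
    have "image_mset \<pi> (mset_set {..<n}) = mset_set (\<pi> ` {..<n})"
      using permutes_inj_on[OF \<pi>] by (rule image_mset_mset_set)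
    also have "\<pi> ` {..<n} = {..<n}" using permutes_image[OF \<pi>] lz by simp
    finally show ?thesis by (simp add: lessThan_atLeast0)
  qed
  then have mW: "mset (map idx W') = mset (map idx W)" unfolding idxW .
  have wW: "W \<in> words (Zpow r)" "W' \<in> words (Zpow r)"
    using w w' n' by (auto simp: words_def W_def W'_def n_def)
  have trW: "trace r p W es q" "trace r p W' es' q"
    using tr tr' trace_relabel[OF maps(1,2)] trace_relabel[OF maps(3,4)] by simp_all
  have "zip (map \<pi> [0..<n]) es' = map (\<lambda>i. (\<pi> i, es' ! i)) [0..<n]"
    "zip [0..<n] es = map (\<lambda>i. (i, es ! i)) [0..<n]"
    by (rule nth_equalityI; use les n' in simp)+
  then have tv: "trace_vars W' es' = (\<lambda>i. (\<pi> i, es' ! i)) ` {..<n}"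
    "trace_vars W es = (\<lambda>i. (i, es ! i)) ` {..<n}"
    by (simp_all add: trace_vars_def idxW lessThan_atLeast0)
  have "trace_vars W' es' = (\<lambda>i. (\<pi> i, es' ! i)) ` {..<n}" by (rule tv(1))
  also have "\<dots> = (\<lambda>i. (i, es ! i)) ` \<pi> ` {..<n}" unfolding image_image using nth by (intro image_cong) auto
  also have "\<pi> ` {..<n} = {..<n}" using permutes_image[OF \<pi>] lz by simp
  also have "(\<lambda>i. (i, es ! i)) ` {..<n} = trace_vars W es"
    by (rule tv(2)[symmetric])
  finally have "mod_sign I W W'"
    using same_trace_distinct[OF wW(1) _ wW(2) mW trW] idxW by simp
  \<comment> \<open>Maps the numbers back to the original variables.\<close>
  moreover define \<sigma> where "\<sigma> i g = [Letter (idx (w ! i)) g False]" for i and g :: "nat \<Rightarrow>\<^sub>0 int"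
  have "\<sigma> i g \<in> words (Zpow r) \<and> word_deg (\<sigma> i g) = g" if "g \<in> Zpow r" for i g
    using that by (simp add: \<sigma>_def)
  ultimately have "mod_sign I (subst_word \<sigma> W) (subst_word \<sigma> W')"
    by (rule mod_sign_subst[OF I])
  moreover have sw: "subst_word \<sigma> u = map (\<lambda>l. Letter (idx (w ! idx l)) (ldeg l) (starred l)) u" for u
    by (induction u) (simp_all add: \<sigma>_def star_letter_def)
  have "subst_word \<sigma> W = w" "subst_word \<sigma> W' = w'"
    unfolding sw by (rule nth_equalityI; simp add: W_def W'_def n_def[symmetric] n' flip: nth(1))+
  ultimately show ?thesis by simp
qed

text \<open>Evaluated at matrices with all admissible entries 1, the relation in \<open>I\<close>
  forces the two trace signs to be equal in the case of a difference and opposite in the case of a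
  sum; the combination is thus a multiple of that relation.\<close>

lemma mod_sign_trace_sign:
  assumes "mod_sign I u w" and tr: "trace r p u es q" "trace r p w es' q"
  shows "Poly_Mapping.single 0 (trace_sign r u es) * word_mono u
       - Poly_Mapping.single 0 (trace_sign r w es') * word_mono w \<in> I"
proof -
  let ?a = "generic_mats r (\<lambda>_. 1 :: 'a)"
  have one: "prod_list (map (\<lambda>_. 1 :: 'a) xs) = 1" for xs :: "(nat \<times> nat \<times> nat) list" by (induction xs) auto
  have pq: "p < 2 * r" "q < 2 * r" using trace_le[OF tr(1)] by auto
  have u: "ueval_poly r ?a (word_mono u) $$ (p, q) = trace_sign r u es"
    and w: "ueval_poly r ?a (word_mono w) $$ (p, q) = trace_sign r w es'"
    using pq ueval_generic_mats[OF r tr(1), of "\<lambda>_. 1 :: 'a"] ueval_generic_mats[OF r tr(2), of "\<lambda>_. 1 :: 'a"]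
    by (simp_all add: word_mono_def ueval_poly_single one)
  have T: "ueval_poly r ?a f = 0\<^sub>m (2 * r) (2 * r)" if "f \<in> I" for f
    using that sub generic_mats_comp[OF r] UT_identities_iff[OF r, of f] by blast
  from assms(1) show ?thesis
    unfolding mod_sign_def
  proof
    assume *: "word_mono u - word_mono w \<in> I"
    have "ueval_poly r ?a (word_mono u) = ueval_poly r ?a (word_mono u - word_mono w) + ueval_poly r ?a (word_mono w)"
      by (simp flip: ueval_poly_add)
    then have "ueval_poly r ?a (word_mono u) $$ (p, q) = ueval_poly r ?a (word_mono w) $$ (p, q)"
      using pq by (simp add: T[OF *])
    then have "trace_sign r u es = (trace_sign r w es' :: 'a)" by (simp add: u w)
    then show ?thesis
      using T_star_ideal_smult[OF I *, of "trace_sign r w es'"] by (simp add: right_diff_distrib)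
  next
    assume *: "word_mono u + word_mono w \<in> I"
    have "(ueval_poly r ?a (word_mono u) + ueval_poly r ?a (word_mono w)) $$ (p, q) = 0"
      using pq by (simp add: T[OF *] flip: ueval_poly_add)
    then have "trace_sign r u es + trace_sign r w es' = (0 :: 'a)" using pq by (simp add: u w)
    then have "trace_sign r w es' = - (trace_sign r u es :: 'a)" by (simp add: eq_neg_iff_add_eq_0 add.commute)
    then show ?thesis
      using T_star_ideal_smult[OF I *, of "trace_sign r u es"] by (simp add: distrib_left single_uminus)
  qed
qed

text \<open>Induction on the number of words in \<open>f\<close>: a nonempty part that lies in
  \<open>I\<close> is split off, which leaves an identity with fewer words. The part is a single
  word if that is an identity, and otherwise all words that yield a given monomial in a fixed matrix
  entry.\<close>

lemma UT_identities_subset: "f \<in> UT_identities r \<Longrightarrow> f \<in> I"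
proof (induction "card (Poly_Mapping.keys f)" arbitrary: f rule: less_induct)
  case less
  note T = T_star_ideal_UT_identities[OF r, where 'a='a]
  have "f \<in> fcarrier (Zpow r)"
    using less.prems by (simp only: UT_identities_iff[OF r])
  note carr = fcarrierD[OF this]
  have remove: "f \<in> I" if B: "B \<subseteq> Poly_Mapping.keys f" "B \<noteq> {}"
    and BI: "(\<Sum>u\<in>B. Poly_Mapping.single u (Poly_Mapping.lookup f u)) \<in> I" for B
  proof -
    let ?g = "\<Sum>u\<in>B. Poly_Mapping.single u (Poly_Mapping.lookup f u)"
    have fin: "finite B" using finite_subset[OF B(1) finite_keys] .
    have "Poly_Mapping.lookup ?g u = (if u \<in> B then Poly_Mapping.lookup f u else 0)" for u
      using fin by (simp add: lookup_sum lookup_single when_def)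
    then have "Poly_Mapping.keys (f - ?g) = Poly_Mapping.keys f - B"
      by (auto simp: in_keys_iff lookup_minus split: if_splits)
    then have "card (Poly_Mapping.keys (f - ?g)) < card (Poly_Mapping.keys f)"
      using B by (auto intro!: psubset_card_mono)
    moreover have "f - ?g \<in> UT_identities r"
      using T_star_ideal_diff[OF T less.prems] BI sub by blast
    ultimately have "f - ?g \<in> I" by (rule less.hyps)
    from T_star_ideal_add[OF I this BI] show ?thesis by simp
  qed
  show ?case
  proof (cases "f = 0")
    case True
    then show ?thesis using T_star_ideal_zero[OF I] by simp
  next
    case False
    then obtain w where w: "w \<in> Poly_Mapping.keys f" by (metis all_not_in_conv keys_eq_empty)
    show ?thesis
    proof (cases "(word_mono (letters w) :: (_, 'a) falg) \<in> UT_identities r")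
      case True
      then have "word_mono (letters w) \<in> I" by (rule word_mono_identity_in_ideal[OF r I gens])
      from T_star_ideal_smult[OF I this, of "Poly_Mapping.lookup f w"]
      show ?thesis using w by (intro remove[of "{w}"]) (simp_all flip: single_eq_smult)
    next
      case False
      then obtain p es q where tr: "trace r p (letters w) es q"
        using word_mono_in_UT_identities[OF r carr[OF w]] by blast
      then have pq: "p < 2 * r" "q < 2 * r" using trace_le[OF tr] by auto
      define A where "A = {u \<in> Poly_Mapping.keys f. \<exists>es. trace r p (letters u) es q}"
      \<comment> \<open>By \<open>trace_det\<close> there is only one trace to choose.\<close>
      define E where "E u = (SOME es. trace r p (letters u) es q)" for u
      have E: "trace r p (letters u) (E u) q" if "u \<in> A" for u
      proof -
        have "\<exists>es. trace r p (letters u) es q" using that by (simp add: A_def)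
        then show ?thesis unfolding E_def by (rule someI_ex)
      qed
      have wA: "w \<in> A" using w tr by (auto simp: A_def)
      define m where "m u = mset (zip (map idx (letters u)) (E u))" for u
      define \<epsilon> where "\<epsilon> u = (trace_sign r (letters u) (E u) :: 'a)" for u
      have finA: "finite A" by (simp add: A_def)
      have sum0: "(\<Sum>u\<in>A. Poly_Mapping.lookup f u * \<epsilon> u * prod_mset (image_mset s (m u))) = 0" for s
      proof -
        let ?a = "generic_mats r s"
        have "0 = ueval_poly r ?a f $$ (p, q)"
        proof -
          have "ueval_poly r ?a f = 0\<^sub>m (2 * r) (2 * r)"
            using less.prems generic_mats_comp[OF r] unfolding UT_identities_iff[OF r] by blast
          then show ?thesis using pq by simp
        qed
        also have "\<dots> = (\<Sum>u\<in>Poly_Mapping.keys f. Poly_Mapping.lookup f u * ueval r ?a (letters u) $$ (p, q))"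
          using pq by (simp add: ueval_poly_index lin_ext_def)
        also have "\<dots> = (\<Sum>u\<in>A. Poly_Mapping.lookup f u * ueval r ?a (letters u) $$ (p, q))"
        proof (rule sum.mono_neutral_right)
          show "\<forall>u\<in>Poly_Mapping.keys f - A. Poly_Mapping.lookup f u * ueval r ?a (letters u) $$ (p, q) = 0"
          proof
            fix u assume "u \<in> Poly_Mapping.keys f - A"
            then have "\<not> trace r p (letters u) es q" for es by (simp add: A_def)
            from ueval_no_trace[where a="?a", OF r generic_mats_comp[OF r] this pq]
            show "Poly_Mapping.lookup f u * ueval r ?a (letters u) $$ (p, q) = 0" by simp
          qed
        qed (auto simp: A_def)
        also have "\<dots> = (\<Sum>u\<in>A. Poly_Mapping.lookup f u * \<epsilon> u * prod_mset (image_mset s (m u)))"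
        proof (intro sum.cong refl)
          fix u assume "u \<in> A"
          have "prod_mset (image_mset s (m u)) = prod_list (map s (zip (map idx (letters u)) (E u)))"
            by (simp only: m_def mset_map[symmetric] prod_mset_prod_list)
          with ueval_generic_mats[OF r E[OF \<open>u \<in> A\<close>], of s]
          show "Poly_Mapping.lookup f u * ueval r ?a (letters u) $$ (p, q)
              = Poly_Mapping.lookup f u * \<epsilon> u * prod_mset (image_mset s (m u))"
            by (simp add: \<epsilon>_def mult.assoc)
        qed
        finally show ?thesis by simp
      qed
      let ?B = "{u. u \<in> A \<and> m u = m w}"
      have coeff: "(\<Sum>u\<in>?B. Poly_Mapping.lookup f u * \<epsilon> u) = 0"
        by (rule monomial_coeff_zero[OF finA sum0])
      let ?s = "\<lambda>c. Poly_Mapping.single 0 (c :: 'a) :: (nat \<Rightarrow>\<^sub>0 int, 'a) falg"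
      have eps: "\<epsilon> u * \<epsilon> u = 1" for u
        using trace_sign_cases[of r "letters u" "E u", where 'a='a] by (auto simp: \<epsilon>_def)
      \<comment> \<open>Each term is congruent to a multiple of the one word
        \<open>letters w\<close>; by \<open>coeff\<close> these multiples add up to 0.\<close>
      have "Poly_Mapping.single u (Poly_Mapping.lookup f u)
          - ?s (Poly_Mapping.lookup f u * \<epsilon> u) * (?s (\<epsilon> w) * word_mono (letters w)) \<in> I" if u: "u \<in> ?B" for u
      proof -
        have "mod_sign I (letters u) (letters w)"
          by (rule same_trace_mod_sign[OF carr carr E E]) (use u wA w in \<open>auto simp: m_def A_def\<close>)
        from mod_sign_trace_sign[OF this E E] u wA
        have "?s (\<epsilon> u) * word_mono (letters u) - ?s (\<epsilon> w) * word_mono (letters w) \<in> I"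
          by (simp add: \<epsilon>_def)
        from T_star_ideal_smult[OF I this, of "Poly_Mapping.lookup f u * \<epsilon> u"]
        have "?s (Poly_Mapping.lookup f u * \<epsilon> u) * (?s (\<epsilon> u) * word_mono (letters u))
            - ?s (Poly_Mapping.lookup f u * \<epsilon> u) * (?s (\<epsilon> w) * word_mono (letters w)) \<in> I"
          by (simp add: right_diff_distrib)
        moreover have "?s (Poly_Mapping.lookup f u * \<epsilon> u) * (?s (\<epsilon> u) * word_mono (letters u))
            = Poly_Mapping.single u (Poly_Mapping.lookup f u)"
          by (simp add: word_mono_def smult_single mult.assoc eps)
        ultimately show ?thesis by simp
      qed
      then have "(\<Sum>u\<in>?B. Poly_Mapping.single u (Poly_Mapping.lookup f u)
          - ?s (Poly_Mapping.lookup f u * \<epsilon> u) * (?s (\<epsilon> w) * word_mono (letters w))) \<in> I"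
        by (rule T_star_ideal_sum[OF I])
      moreover have "(\<Sum>u\<in>?B. ?s (Poly_Mapping.lookup f u * \<epsilon> u) * (?s (\<epsilon> w) * word_mono (letters w))) = 0"
      proof -
        have "(\<Sum>u\<in>?B. ?s (Poly_Mapping.lookup f u * \<epsilon> u)) = ?s (\<Sum>u\<in>?B. Poly_Mapping.lookup f u * \<epsilon> u)"
          by (rule poly_mapping_eqI) (simp add: lookup_sum lookup_single when_def)
        then show ?thesis by (simp add: coeff flip: sum_distrib_right)
      qed
      ultimately have "(\<Sum>u\<in>?B. Poly_Mapping.single u (Poly_Mapping.lookup f u)) \<in> I"
        by (simp add: sum_subtractf)
      then show ?thesis using wA by (intro remove[of ?B]) (auto simp: A_def)
    qed
  qed
qed

end

section \<open>Multilinear polynomials modulo the identities\<close>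

text \<open>Replaces the permutation by the multiset of indices, which the rewriting steps visibly
  preserve.\<close>

lemma multilinear_words_iff:
  "w \<in> multilinear_words G n \<longleftrightarrow> w \<in> words G \<and> mset (map idx w) = mset [1..<Suc n]"
proof
  assume "w \<in> multilinear_words G n"
  then obtain \<sigma> g \<delta> where w: "w = map (\<lambda>i. Letter (\<sigma> i) (g i) (\<delta> i)) [1..<Suc n]"
    and \<sigma>: "\<sigma> permutes {1..n}" and g: "\<forall>i\<in>{1..n}. g i \<in> G"
    unfolding multilinear_words_def by blast
  have "mset (map idx w) = image_mset \<sigma> (mset_set {1..n})"
    by (simp add: w comp_def atLeastLessThanSuc_atLeastAtMost del: upt_Suc)
  also have "\<dots> = mset_set (\<sigma> ` {1..n})"
    using permutes_inj_on[OF \<sigma>] by (rule image_mset_mset_set)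
  also have "\<dots> = mset [1..<Suc n]"
    using permutes_image[OF \<sigma>] by (simp add: atLeastLessThanSuc_atLeastAtMost del: upt_Suc)
  finally show "w \<in> words G \<and> mset (map idx w) = mset [1..<Suc n]"
    using g by (auto simp: w words_def)
next
  assume *: "w \<in> words G \<and> mset (map idx w) = mset [1..<Suc n]"
  then have len: "length w = n" by (metis diff_Suc_1 length_map length_upt mset_eq_length)
  have dist: "distinct (map idx w)" using * by (metis distinct_upt mset_eq_imp_distinct_iff)
  have set: "idx ` set w = {1..n}"
    using * by (metis atLeastLessThanSuc_atLeastAtMost mset_eq_setD set_map set_upt)
  \<comment> \<open>\<open>permutes\<close> requires the identity outside {1..n}; the shift arises
    because positions count from 1 and lists from 0.\<close>
  define \<sigma> where "\<sigma> i = (if i \<in> {1..n} then idx (w ! (i - 1)) else i)" for i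
  have "\<sigma> permutes {1..n}"
  proof (rule bij_imp_permutes)
    have "inj_on \<sigma> {1..n}"
    proof (rule inj_onI)
      fix i j assume "i \<in> {1..n}" "j \<in> {1..n}" "\<sigma> i = \<sigma> j"
      then have "map idx w ! (i - 1) = map idx w ! (j - 1)" "i - 1 < n" "j - 1 < n" "i \<ge> 1" "j \<ge> 1"
        by (auto simp: \<sigma>_def len)
      then show "i = j" using nth_eq_iff_index_eq[OF dist, of "i - 1" "j - 1"] len by simp
    qed
    moreover have "\<sigma> ` {1..n} \<subseteq> {1..n}"
    proof
      fix k assume "k \<in> \<sigma> ` {1..n}"
      then obtain i where "i \<in> {1..n}" "k = idx (w ! (i - 1))" by (auto simp: \<sigma>_def)
      then have "k \<in> idx ` set w" using len by auto
      then show "k \<in> {1..n}" using set by simp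
    qed
    ultimately show "bij_betw \<sigma> {1..n} {1..n}"
      by (simp add: bij_betw_def endo_inj_surj)
  qed (unfold \<sigma>_def, rule if_not_P)
  moreover have "w = map (\<lambda>i. Letter (\<sigma> i) (ldeg (w ! (i - 1))) (starred (w ! (i - 1)))) [1..<Suc n]"
    by (rule nth_equalityI) (auto simp: \<sigma>_def len nth_append simp del: upt_Suc)
  moreover have "\<forall>i\<in>{1..n}. ldeg (w ! (i - 1)) \<in> G"
    using * len by (auto simp: words_def)
  ultimately show "w \<in> multilinear_words G n"
    unfolding multilinear_words_def by - (intro CollectI exI conjI; assumption)
qed

lemma multilinear_words_distinct: "w \<in> multilinear_words G n \<Longrightarrow> distinct (map idx w)"
  unfolding multilinear_words_iff by (metis distinct_upt mset_eq_imp_distinct_iff)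

abbreviation fscale :: "'a::field \<Rightarrow> ('g, 'a) falg \<Rightarrow> ('g, 'a) falg" where
  "fscale c p \<equiv> Poly_Mapping.single 0 c * p"

lemma fscale_one [simp]: "fscale 1 p = p"
  by simp

lemma fscale_add: "fscale (c + d) p = fscale c p + fscale d p"
  by (simp add: single_add distrib_right)

lemma fscale_fscale: "fscale c (fscale d p) = fscale (c * d) p"
  by (metis mult.assoc smult_single)

lemma fscale_minus_one: "fscale (- 1) p = - p"
  by (simp add: single_uminus)

text \<open>Subspaces described without module records, so that cosets, supports and ideals are
  handled by plain membership facts.\<close>

definition fsubspace :: "('g, 'a::field) falg set \<Rightarrow> bool" where
  "fsubspace M \<longleftrightarrow> 0 \<in> M \<and> (\<forall>p\<in>M. \<forall>q\<in>M. p + q \<in> M) \<and> (\<forall>c. \<forall>p\<in>M. fscale c p \<in> M)"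

lemma
  assumes "fsubspace M"
  shows fsubspace_zero: "0 \<in> M"
    and fsubspace_add: "p \<in> M \<Longrightarrow> q \<in> M \<Longrightarrow> p + q \<in> M"
    and fsubspace_scale: "p \<in> M \<Longrightarrow> fscale c p \<in> M"
    and fsubspace_uminus: "p \<in> M \<Longrightarrow> - p \<in> M"
    and fsubspace_diff: "p \<in> M \<Longrightarrow> q \<in> M \<Longrightarrow> p - q \<in> M"
    and fsubspace_sum: "(\<And>x. x \<in> A \<Longrightarrow> f x \<in> M) \<Longrightarrow> sum f A \<in> M"
proof -
  show zero: "0 \<in> M" and add: "p \<in> M \<Longrightarrow> q \<in> M \<Longrightarrow> p + q \<in> M" and sc: "p \<in> M \<Longrightarrow> fscale c p \<in> M" for p q c
    using assms by (auto simp: fsubspace_def)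
  show un: "p \<in> M \<Longrightarrow> - p \<in> M" for p using sc[of p "- 1"] by (simp only: fscale_minus_one)
  show "p \<in> M \<Longrightarrow> q \<in> M \<Longrightarrow> p - q \<in> M" for p q using add[of p "- q"] un[of q] by simp
  show "(\<And>x. x \<in> A \<Longrightarrow> f x \<in> M) \<Longrightarrow> sum f A \<in> M"
    by (induction A rule: infinite_finite_induct) (auto intro: zero add)
qed

lemma fsubspace_T_star_ideal: "T_star_ideal G I \<Longrightarrow> fsubspace I"
  unfolding fsubspace_def
  using T_star_ideal_zero T_star_ideal_add T_star_ideal_smult by blast

lemma fsubspace_Int: "fsubspace M \<Longrightarrow> fsubspace N \<Longrightarrow> fsubspace (M \<inter> N)"
  by (simp add: fsubspace_def)

definition falg_supported :: "'g letter list set \<Rightarrow> ('g, 'a::field) falg set" where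
  "falg_supported L = {p. \<forall>w\<in>Poly_Mapping.keys p. letters w \<in> L}"

lemma fsubspace_supported: "fsubspace (falg_supported L :: ('g, 'a::field) falg set)"
  unfolding fsubspace_def
proof (intro conjI ballI allI)
  fix p q :: "('g, 'a) falg" assume "p \<in> falg_supported L" "q \<in> falg_supported L"
  then show "p + q \<in> falg_supported L"
    using Poly_Mapping.keys_add[of p q] by (auto simp: falg_supported_def)
next
  fix c and p :: "('g, 'a) falg" assume p: "p \<in> falg_supported L"
  have "Poly_Mapping.keys (fscale c p) \<subseteq> Poly_Mapping.keys p"
    using keys_mult[of "Poly_Mapping.single 0 c" p] by (auto split: if_splits)
  with p show "fscale c p \<in> falg_supported L" by (auto simp: falg_supported_def)
qed (simp add: falg_supported_def)

section \<open>The quotient by a subspace\<close>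

context
  fixes G :: "'g set" and M W :: "('g, 'a::field) falg set"
  assumes M: "fsubspace M" and W: "fsubspace W" and WM: "W \<subseteq> M"
begin

definition fcoset :: "('g, 'a) falg \<Rightarrow> ('g, 'a) falg set" where
  "fcoset v = (\<lambda>w. w + v) ` W"

abbreviation (input) "fspace \<equiv> (free_alg G :: ('a, ('g, 'a) falg) module)\<lparr>carrier := M\<rparr>"

lemma fcoset_eq_iff: "fcoset u = fcoset v \<longleftrightarrow> u - v \<in> W"
proof
  assume eq: "fcoset u = fcoset v"
  have "u \<in> fcoset u" using fsubspace_zero[OF W] by (auto simp: fcoset_def intro: image_eqI[of _ _ 0])
  then show "u - v \<in> W" unfolding eq by (auto simp: fcoset_def)
next
  assume *: "u - v \<in> W"
  have sub: "fcoset a \<subseteq> fcoset b" if "a - b \<in> W" for a b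
  proof
    fix x assume "x \<in> fcoset a"
    then obtain w where "w \<in> W" "x = w + a" by (auto simp: fcoset_def)
    then have "x = (w + (a - b)) + b" "w + (a - b) \<in> W" using fsubspace_add[OF W _ that] by simp_all
    then show "x \<in> fcoset b" unfolding fcoset_def by (rule image_eqI)
  qed
  have "v - u \<in> W" using fsubspace_uminus[OF W *] by simp
  then show "fcoset u = fcoset v" using sub[of u v] sub[of v u] * by auto
qed

lemma r_coset_fspace: "W +>\<^bsub>fspace\<^esub> v = fcoset v"
  by (auto simp: a_r_coset_def' fcoset_def)

lemma fcoset_zero: "fcoset 0 = W"
  by (simp add: fcoset_def)

lemma set_add_fspace: "fcoset u <+>\<^bsub>fspace\<^esub> fcoset v = fcoset (u + v)"
proof -
  have "\<exists>w\<in>W. a + u + (b + v) = w + (u + v)" if "a \<in> W" "b \<in> W" for a b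
    using fsubspace_add[OF W that] by (intro bexI[of _ "a + b"]) (simp_all add: algebra_simps)
  moreover have "\<exists>a\<in>W. \<exists>b\<in>W. w + (u + v) = a + u + (b + v)" if "w \<in> W" for w
    using that fsubspace_zero[OF W] by (intro bexI[of _ w] bexI[of _ 0]) (simp_all add: algebra_simps)
  ultimately show ?thesis
    by (auto simp: set_add_def' fcoset_def image_iff)
qed

lemma smult_fspace: "W <+>\<^bsub>fspace\<^esub> ((\<lambda>x. c \<odot>\<^bsub>fspace\<^esub> x) ` fcoset v) = fcoset (fscale c v)"
proof -
  have "\<exists>w\<in>W. a + fscale c (b + v) = w + fscale c v" if "a \<in> W" "b \<in> W" for a b
    using fsubspace_add[OF W that(1) fsubspace_scale[OF W that(2), of c]]
    by (intro bexI[of _ "a + fscale c b"]) (simp_all add: algebra_simps)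
  moreover have "\<exists>a\<in>W. \<exists>b\<in>W. w + fscale c v = a + fscale c (b + v)" if "w \<in> W" for w
    using that fsubspace_zero[OF W] by (intro bexI[of _ w] bexI[of _ 0]) (simp_all add: algebra_simps)
  ultimately show ?thesis
    by (auto simp: set_add_def' fcoset_def image_iff)
qed

abbreviation "fquot \<equiv> quot_space fspace W"

lemma fquot_simps [simp]:
  "carrier fquot = fcoset ` M" "\<zero>\<^bsub>fquot\<^esub> = fcoset 0"
  "fcoset u \<oplus>\<^bsub>fquot\<^esub> fcoset v = fcoset (u + v)"
  "c \<odot>\<^bsub>fquot\<^esub> fcoset v = fcoset (fscale c v)"
proof -
  show "carrier fquot = fcoset ` M"
    by (auto simp: quot_space_def A_RCOSETS_def' r_coset_fspace)
  show "\<zero>\<^bsub>fquot\<^esub> = fcoset 0" by (simp add: quot_space_def fcoset_zero)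
  show "fcoset u \<oplus>\<^bsub>fquot\<^esub> fcoset v = fcoset (u + v)"
    by (simp add: quot_space_def set_add_fspace)
  show "c \<odot>\<^bsub>fquot\<^esub> fcoset v = fcoset (fscale c v)"
    using smult_fspace[of c v] by (simp add: quot_space_def)
qed

lemma vectorspace_fquot: "vectorspace class_ring fquot"
proof -
  have "abelian_group fquot"
  proof (rule abelian_groupI)
    fix x assume "x \<in> carrier fquot"
    then obtain u where u: "u \<in> M" "x = fcoset u" by auto
    then have "fcoset (- u) \<in> carrier fquot" "fcoset (- u) \<oplus>\<^bsub>fquot\<^esub> x = \<zero>\<^bsub>fquot\<^esub>"
      using fsubspace_uminus[OF M u(1)] by simp_all
    then show "\<exists>y\<in>carrier fquot. y \<oplus>\<^bsub>fquot\<^esub> x = \<zero>\<^bsub>fquot\<^esub>" by blast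
  qed (use fsubspace_zero[OF M] fsubspace_add[OF M] in \<open>auto simp: algebra_simps\<close>)
  moreover have "cring (class_ring :: 'a ring)" by (rule class_cring.cring_axioms)
  ultimately have "Module.module class_ring fquot"
    by (intro Module.module.intro Module.module_axioms.intro)
      (use fsubspace_scale[OF M] in \<open>auto simp: fscale_add distrib_left fscale_fscale\<close>)
  then show ?thesis
    by (simp add: vectorspace_def class_field)
qed

lemma finsum_fquot:
  assumes "finite A" "\<And>x. x \<in> A \<Longrightarrow> h x \<in> M \<and> f x = fcoset (h x)"
  shows "finsum fquot f A = fcoset (sum h A)"
proof -
  interpret V: vectorspace class_ring fquot by (rule vectorspace_fquot)
  show ?thesis
    using assms
  proof (induction A rule: finite_induct)
    case (insert x A)
    then have "finsum fquot f (insert x A) = f x \<oplus>\<^bsub>fquot\<^esub> finsum fquot f A"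
      by (intro V.finsum_insert) auto
    then show ?case using insert by simp
  qed simp
qed

text \<open>Reduces \<open>basis_mod\<close> to independence and generation modulo \<open>W\<close>,
  stated with ordinary finite sums. That distinct elements of \<open>B\<close> stay distinct in the
  quotient is a case of independence.\<close>

lemma basis_mod_fspaceI:
  assumes B: "B \<subseteq> M"
    and indep: "\<And>S c b. finite S \<Longrightarrow> S \<subseteq> B \<Longrightarrow> (\<Sum>b\<in>S. fscale (c b) b) \<in> W \<Longrightarrow> b \<in> S \<Longrightarrow> c b = 0"
    and gen: "\<And>v. v \<in> M \<Longrightarrow> \<exists>S c. finite S \<and> S \<subseteq> B \<and> v - (\<Sum>b\<in>S. fscale (c b) b) \<in> W"
  shows "basis_mod fspace W B"
proof -
  interpret V: vectorspace class_ring fquot by (rule vectorspace_fquot)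
  have inj: "inj_on fcoset B"
  proof (rule inj_onI, rule ccontr)
    fix x y assume xy: "x \<in> B" "y \<in> B" "fcoset x = fcoset y" "x \<noteq> y"
    \<comment> \<open>Equal cosets would give the nontrivial relation x - y.\<close>
    define c where "c b = (if b = x then 1 else - 1 :: 'a)" for b
    have "(\<Sum>b\<in>{x, y}. fscale (c b) b) = x - y"
      using xy(4) by (simp add: c_def fscale_minus_one del: single_uminus)
    also have "\<dots> \<in> W" using xy(3) by (simp add: fcoset_eq_iff)
    finally have "c x = 0" using xy by (intro indep[of "{x, y}"]) auto
    then show False by (simp add: c_def)
  qed
  have lincomb: "V.lincomb a (fcoset ` S) = fcoset (\<Sum>b\<in>S. fscale (a (fcoset b)) b)"
    if "finite S" "S \<subseteq> B" for a S
  proof -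
    \<comment> \<open>Recovers the representative in \<open>B\<close>, so that sums over cosets
      become sums over \<open>B\<close>.\<close>
    let ?g = "the_inv_into B fcoset"
    have g: "?g (fcoset b) = b" if "b \<in> B" for b using the_inv_into_f_f[OF inj that] .
    have "V.lincomb a (fcoset ` S) = fcoset (\<Sum>X\<in>fcoset ` S. fscale (a X) (?g X))"
      unfolding V.lincomb_def
    proof (rule finsum_fquot)
      fix X assume "X \<in> fcoset ` S"
      then obtain b where b: "b \<in> S" "X = fcoset b" by blast
      with that have "b \<in> B" by blast
      with b B g[OF this] show "fscale (a X) (?g X) \<in> M \<and> a X \<odot>\<^bsub>fquot\<^esub> X = fcoset (fscale (a X) (?g X))"
        using fsubspace_scale[OF M] by auto
    qed (use that in simp)
    also have "(\<Sum>X\<in>fcoset ` S. fscale (a X) (?g X)) = (\<Sum>b\<in>S. fscale (a (fcoset b)) (?g (fcoset b)))"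
      using inj_on_subset[OF inj that(2)] by (simp add: sum.reindex)
    also have "\<dots> = (\<Sum>b\<in>S. fscale (a (fcoset b)) b)"
      using that(2) g by (intro sum.cong) auto
    finally show ?thesis .
  qed
  have "V.basis (fcoset ` B)"
    unfolding V.basis_def
  proof (intro conjI)
    show "V.lin_indpt (fcoset ` B)"
    proof
      assume "V.lin_dep (fcoset ` B)"
      then obtain A a X where A: "finite A" "A \<subseteq> fcoset ` B" "V.lincomb a A = \<zero>\<^bsub>fquot\<^esub>" "X \<in> A" "a X \<noteq> 0"
        unfolding V.lin_dep_def by (auto simp del: fquot_simps)
      obtain S where S: "S \<subseteq> B" "A = fcoset ` S" using A(2) by (auto simp: subset_image_iff)
      then have fin: "finite S" using A(1) inj_on_subset[OF inj S(1)] by (simp add: finite_image_iff)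
      have "fcoset (\<Sum>b\<in>S. fscale (a (fcoset b)) b) = fcoset 0"
        using A(3) lincomb[OF fin S(1)] S(2) by simp
      then have W: "(\<Sum>b\<in>S. fscale (a (fcoset b)) b) \<in> W" by (simp add: fcoset_eq_iff)
      obtain b where "b \<in> S" "X = fcoset b" using A(4) S(2) by blast
      with indep[OF fin S(1) W] A(5) show False by simp
    qed
    show "fcoset ` B \<subseteq> carrier fquot" using B by auto
    show "V.gen_set (fcoset ` B)"
    proof
      show "V.span (fcoset ` B) \<subseteq> carrier fquot"
        using V.span_is_subset2[of "fcoset ` B"] B by auto
      show "carrier fquot \<subseteq> V.span (fcoset ` B)"
      proof
        fix X assume "X \<in> carrier fquot"
        then obtain v where v: "v \<in> M" "X = fcoset v" by auto
        obtain S c where S: "finite S" "S \<subseteq> B" "v - (\<Sum>b\<in>S. fscale (c b) b) \<in> W"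
          using gen[OF v(1)] by blast
        let ?a = "c \<circ> the_inv_into B fcoset"
        have "V.lincomb ?a (fcoset ` S) = fcoset (\<Sum>b\<in>S. fscale (c b) b)"
          unfolding lincomb[OF S(1,2)]
          using S(2) by (intro arg_cong[of _ _ fcoset] sum.cong) (auto simp: the_inv_into_f_f[OF inj])
        then have "X = V.lincomb ?a (fcoset ` S)" using S(3) v(2) by (simp add: fcoset_eq_iff)
        then show "X \<in> V.span (fcoset ` B)"
          unfolding V.span_def using S(1,2) by (intro CollectI exI[of _ ?a] exI[of _ "fcoset ` S"]) auto
      qed
    qed
  qed
  then show ?thesis
    unfolding basis_mod_def r_coset_fspace using inj by blast
qed

end

lemma vectorspace_free_alg: "Module.module class_ring (free_alg G :: ('a::field, ('g, 'a) falg) module)"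
proof -
  interpret ring "free_alg G :: ('a, ('g, 'a) falg) module" by (rule ring_free_alg)
  have "cring (class_ring :: 'a ring)" by (rule class_cring.cring_axioms)
  then show ?thesis
    by (intro Module.module.intro Module.module_axioms.intro abelian_group_axioms)
      (auto simp: fscale_add distrib_left fscale_fscale)
qed

text \<open>Membership in a span of words can be read off the support, which avoids abstract linear
  combinations later.\<close>

lemma multilinear_eq: "multilinear G n = (falg_supported (multilinear_words G n) :: ('g, 'a::field) falg set)"
proof -
  interpret V: Module.module class_ring "free_alg G :: ('a, ('g, 'a) falg) module" by (rule vectorspace_free_alg)
  let ?B = "word_mono ` multilinear_words G n :: ('g, 'a) falg set"
  have Bc: "?B \<subseteq> fcarrier G" by (auto simp: multilinear_words_iff)
  have fs: "finsum (free_alg G) f A = sum f A" if "finite A" "f \<in> A \<rightarrow> fcarrier G"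
    for f :: "_ \<Rightarrow> ('g, 'a) falg" and A :: "('g, 'a) falg set"
    using that
  proof (induction A rule: finite_induct)
    case (insert x A)
    then have "finsum (free_alg G) f (insert x A) = f x \<oplus>\<^bsub>free_alg G\<^esub> finsum (free_alg G) f A"
      by (intro V.finsum_insert) auto
    then show ?case using insert by simp
  qed simp
  have lc: "V.lincomb a A = (\<Sum>v\<in>A. fscale (a v) v)" if "finite A" "A \<subseteq> ?B" for a A
    unfolding V.lincomb_def using fs[OF that(1), of "\<lambda>v. fscale (a v) v"] that(2) Bc by (auto simp: subset_iff)
  have "multilinear G n = V.span ?B" by (simp add: multilinear_def)
  also have "\<dots> = falg_supported (multilinear_words G n)"
  proof
    show "V.span ?B \<subseteq> falg_supported (multilinear_words G n)"
    proof
      fix v assume "v \<in> V.span ?B"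
      then obtain a A where A: "finite A" "A \<subseteq> ?B" "v = V.lincomb a A" unfolding V.span_def by auto
      have "(\<Sum>v\<in>A. fscale (a v) v) \<in> falg_supported (multilinear_words G n)"
        using A(2) by (intro fsubspace_sum[OF fsubspace_supported] fsubspace_scale[OF fsubspace_supported])
          (auto simp: falg_supported_def word_mono_def)
      then show "v \<in> falg_supported (multilinear_words G n)" using A lc by simp
    qed
    show "falg_supported (multilinear_words G n) \<subseteq> V.span ?B"
    proof
      fix v :: "('g, 'a) falg" assume v: "v \<in> falg_supported (multilinear_words G n)"
      let ?f = "\<lambda>w. word_mono (letters w) :: ('g, 'a) falg"
      have inj: "inj_on ?f (Poly_Mapping.keys v)"
        by (rule inj_onI) (auto simp: word_mono_def dest!: injD[OF inj_single] intro: word.expand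
            dest: arg_cong[of _ _ Poly_Mapping.keys])
      let ?a = "\<lambda>b. Poly_Mapping.lookup v (the_inv_into (Poly_Mapping.keys v) ?f b)"
      have "v = (\<Sum>w\<in>Poly_Mapping.keys v. fscale (?a (?f w)) (?f w))"
        by (subst sum_singles[of v]) (auto intro!: sum.cong simp: the_inv_into_f_f[OF inj] single_eq_smult[symmetric])
      also have "\<dots> = (\<Sum>b\<in>?f ` Poly_Mapping.keys v. fscale (?a b) b)"
        by (simp add: sum.reindex[OF inj])
      also have "\<dots> = V.lincomb ?a (?f ` Poly_Mapping.keys v)"
        using v by (intro lc[symmetric]) (auto simp: falg_supported_def)
      finally show "v \<in> V.span ?B"
        unfolding V.span_def using v
        by (intro CollectI exI[of _ ?a] exI[of _ "?f ` Poly_Mapping.keys v"]) (auto simp: falg_supported_def)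
    qed
  qed
  finally show ?thesis .
qed

text \<open>Only one entry of \<open>A\<close> can be nonzero. Its position is fixed by mirroring,
  and D has opposite signs in the row and the column of that position.\<close>

lemma symplectic_symm_degree:
  assumes r: "r \<ge> 1" and g: "symm_degree r g" and A: "A \<in> UT_comp r g"
  shows "symplectic r A = - A"
proof (rule eq_matI)
  have carr: "A \<in> carrier_mat (2 * r) (2 * r)" using UT_compD(1)[OF r A] .
  then show "dim_row (symplectic r A) = dim_row (- A)" "dim_col (symplectic r A) = dim_col (- A)"
    by simp_all
  fix i j assume "i < dim_row (- A)" "j < dim_col (- A)"
  then have ij: "i < 2 * r" "j < 2 * r" using carr by simp_all
  show "symplectic r A $$ (i, j) = (- A) $$ (i, j)"
  proof (cases "(i, j) \<in> edges r g")
    case True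
    then have "j = mir r i" using g by (auto simp: symm_degree_def edges_symm_degree)
    then have "symplectic r A $$ (i, j) = - A $$ (i, j)"
      using ij by (simp add: symplectic_index sgn_half_mir)
    then show ?thesis using ij carr by simp
  next
    case False
    then show ?thesis
      using UT_compD(2)[OF r A ij] UT_compD(2)[OF r UT_comp_symplectic[OF r A] ij] ij carr by simp
  qed
qed

lemma generators_subset:
  assumes r: "r \<ge> 1"
  shows "generators r \<subseteq> (UT_identities r :: (_, 'a::field) falg set)"
proof -
  note T = T_star_ideal_UT_identities[OF r, where 'a='a]
  let ?x = "Letter 1 (0 :: nat \<Rightarrow>\<^sub>0 int) False" and ?y = "Letter 2 (0 :: nat \<Rightarrow>\<^sub>0 int) False"
  have "word_mono [?x, ?y] - word_mono [?y, ?x] \<in> (UT_identities r :: (_, 'a) falg set)"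
    unfolding UT_identities_iff[OF r]
  proof (intro conjI allI impI)
    fix a :: "nat \<Rightarrow> _ \<Rightarrow> 'a mat" assume *: "\<forall>i g. a i g \<in> UT_comp r g"
    then have a: "\<And>i g. a i g \<in> UT_comp r g" by blast
    \<comment> \<open>Matrices of degree 0 are diagonal, so the only traces stay at
      \<open>p\<close>.\<close>
    have eq: "ueval r a [?x, ?y] $$ (p, q) = ueval r a [?y, ?x] $$ (p, q)" if pq: "p < 2 * r" "q < 2 * r" for p q
    proof (cases "p = q")
      case True
      then have "trace r p [?x, ?y] [(p, p), (p, p)] q" "trace r p [?y, ?x] [(p, p), (p, p)] q"
        using pq by (auto simp: edges_zero letter_edge_def)
      from this[THEN ueval_trace[where a=a, OF r a]] show ?thesis
        by (simp add: trace_sign_def mult.commute del: ueval_simps)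
    next
      case False
      then have no: "\<not> trace r p [?x, ?y] es q" "\<not> trace r p [?y, ?x] es q" for es
        by (auto simp: edges_zero)
      show ?thesis
        using ueval_no_trace[where a=a, OF r a no(1) pq] ueval_no_trace[where a=a, OF r a no(2) pq] by simp
    qed
    show "ueval_poly r a (word_mono [?x, ?y] - word_mono [?y, ?x]) = 0\<^sub>m (2 * r) (2 * r)"
    proof (rule eq_matI)
      fix p q assume "p < dim_row (0\<^sub>m (2 * r) (2 * r) :: 'a mat)" "q < dim_col (0\<^sub>m (2 * r) (2 * r) :: 'a mat)"
      then have pq: "p < 2 * r" "q < 2 * r" by simp_all
      have "word_mono [?x, ?y] - word_mono [?y, ?x]
          = (Poly_Mapping.single (Word [?x, ?y]) 1 + Poly_Mapping.single (Word [?y, ?x]) (- 1) :: (_, 'a) falg)"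
        by (simp add: word_mono_def single_uminus)
      then have "ueval_poly r a (word_mono [?x, ?y] - word_mono [?y, ?x]) $$ (p, q)
          = ueval r a [?x, ?y] $$ (p, q) - ueval r a [?y, ?x] $$ (p, q)"
        using pq by (simp only: ueval_poly_add) (simp add: ueval_poly_single del: ueval_simps)
      then show "ueval_poly r a (word_mono [?x, ?y] - word_mono [?y, ?x]) $$ (p, q) = 0\<^sub>m (2 * r) (2 * r) $$ (p, q)"
        using pq eq[OF pq] by simp
    qed simp_all
  qed (intro fcarrier_diff fcarrier_word_mono; simp)
  moreover have "word_mono [Letter 1 g True] + word_mono [Letter 1 g False] \<in> (UT_identities r :: (_, 'a) falg set)"
    if g: "g \<in> Zpow r" "symm_degree r g" for g
    unfolding UT_identities_iff[OF r]
  proof (intro conjI allI impI)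
    fix a :: "nat \<Rightarrow> _ \<Rightarrow> 'a mat" assume *: "\<forall>i g. a i g \<in> UT_comp r g"
    then have a: "\<And>i g. a i g \<in> UT_comp r g" by blast
    have carr: "a 1 g \<in> carrier_mat (2 * r) (2 * r)" using UT_compD(1)[OF r a] .
    have "ueval_poly r a (word_mono [Letter 1 g True] + word_mono [Letter 1 g False])
        = ueval r a [Letter 1 g True] + ueval r a [Letter 1 g False]"
      unfolding ueval_poly_add by (simp only: ueval_poly_word_mono[OF ueval_carrier[where a=a, OF r a]])
    also have "\<dots> = symplectic r (a 1 g) + a 1 g"
      using carr by (simp add: letter_val_def right_mult_one_mat[OF symplectic_carrier])
    also have "\<dots> = 0\<^sub>m (2 * r) (2 * r)"
      using carr symplectic_symm_degree[OF r g(2) a, of 1] by simp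
    finally show "ueval_poly r a (word_mono [Letter 1 g True] + word_mono [Letter 1 g False]) = 0\<^sub>m (2 * r) (2 * r)" .
  qed (use g in \<open>intro fcarrier_add fcarrier_word_mono; simp\<close>)
  ultimately show ?thesis
    unfolding generators_def UT_dim_eq_1[OF r] by blast
qed

section \<open>Good monomials as a basis\<close>

lemma good_monomials_eq:
  assumes r: "r \<ge> 1"
  shows "good_monomials r n = {word_mono w :: (_, 'a::field) falg | w. w \<in> multilinear_words (Zpow r) n \<and>
    word_mono w \<notin> (UT_identities r :: (_, 'a) falg set) \<and> normal_wd r w}"
proof -
  have "good_word (UT_dim TYPE('a) r) w \<longleftrightarrow> normal_wd r w" for w
    by (rule good_word_iff_normal_word) (use UT_dim_eq_1[OF r] symm_degree_nonzero in auto)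
  then show ?thesis by (simp add: good_monomials_def)
qed

text \<open>Evaluating at the matrix units of one good word and reading the entry at the end points
  of its trace gives a functional that vanishes on the identities and on all other good words of
  degree \<open>n\<close>, but not on the chosen one.\<close>

lemma good_monomials_independent:
  fixes c :: "(_, 'a::field) falg \<Rightarrow> 'a"
  assumes r: "r \<ge> 1" and S: "finite S" "S \<subseteq> good_monomials r n"
    and T: "(\<Sum>b\<in>S. fscale (c b) b) \<in> UT_identities r" and b: "b \<in> S"
  shows "c b = 0"
proof -
  have rep: "\<exists>w. x = word_mono w \<and> w \<in> multilinear_words (Zpow r) n \<and>
      x \<notin> UT_identities r \<and> normal_wd r w" if "x \<in> S" for x
    using S(2) that unfolding good_monomials_eq[OF r] by blast
  obtain w where w: "b = word_mono w" "w \<in> multilinear_words (Zpow r) n"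
    "b \<notin> UT_identities r" "normal_wd r w" using rep[OF b] by blast
  have ww: "w \<in> words (Zpow r)" "distinct (map idx w)"
    using w(2) multilinear_words_iff multilinear_words_distinct by blast+
  obtain p es q where tr: "trace r p w es q"
    using w(1,3) word_mono_in_UT_identities[OF r ww(1), where 'a='a] by blast
  have pq: "p < 2 * r" "q < 2 * r" using trace_le[OF tr] by auto
  let ?a = "generic_mats r (unit_subst w es :: _ \<Rightarrow> 'a)"
  have entry: "ueval_poly r ?a (fscale k (word_mono u)) $$ (p, q) = k * ueval r ?a u $$ (p, q)" for k u
    using pq by (simp add: word_mono_def smult_single ueval_poly_single)
  have sum: "ueval_poly r ?a (\<Sum>x\<in>X. f x) $$ (p, q) = (\<Sum>x\<in>X. ueval_poly r ?a (f x) $$ (p, q))"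
    if "finite X" for X and f :: "(_, 'a) falg \<Rightarrow> (_, 'a) falg"
    using that pq by (induction X rule: finite_induct) (simp_all add: ueval_poly_zero ueval_poly_add)
  have other: "ueval_poly r ?a (fscale (c x) x) $$ (p, q) = 0" if x: "x \<in> S - {b}" for x
  proof -
    obtain u where u: "x = word_mono u" "u \<in> multilinear_words (Zpow r) n" "normal_wd r u"
      using rep[of x] x by blast
    have "mset (map idx u) = mset (map idx w)" using u(2) w(2) by (simp add: multilinear_words_iff)
    then have "ueval r ?a u $$ (p, q) = 0"
      using unit_subst_normal[OF r ww tr _ _ w(4) u(3)] u(1) w(1) x by blast
    then show ?thesis by (simp add: u(1) entry)
  qed
  have "ueval_poly r ?a (\<Sum>b\<in>S. fscale (c b) b) = 0\<^sub>m (2 * r) (2 * r)"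
    using T generic_mats_comp[OF r] unfolding UT_identities_iff[OF r] by blast
  then have "0 = (\<Sum>x\<in>S. ueval_poly r ?a (fscale (c x) x) $$ (p, q))"
    using pq by (simp flip: sum[OF S(1)])
  also have "\<dots> = ueval_poly r ?a (fscale (c b) b) $$ (p, q)"
    using other by (subst sum.remove[OF S(1) b]) (simp add: sum.neutral)
  finally have "c b * ueval r ?a w $$ (p, q) = 0" by (simp add: w(1) entry)
  then show "c b = 0" using unit_subst_self[OF r tr, where 'a='a] by simp
qed

lemma good_monomials_generate:
  fixes v :: "(_, 'a::field) falg"
  assumes r: "r \<ge> 1" and v: "v \<in> multilinear (Zpow r) n"
  shows "\<exists>S c. finite S \<and> S \<subseteq> good_monomials r n \<and>
    v - (\<Sum>b\<in>S. fscale (c b) b) \<in> multilinear (Zpow r) n \<inter> UT_identities r"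
proof -
  let ?T = "UT_identities r :: (_, 'a) falg set" and ?L = "multilinear_words (Zpow r) n"
  note T = T_star_ideal_UT_identities[OF r, where 'a='a]
  have supp: "letters w \<in> ?L" if "w \<in> Poly_Mapping.keys v" for w
    using v that by (simp add: multilinear_eq falg_supported_def)
  let ?ok = "\<lambda>u w s. u \<in> ?L \<and> normal_wd r u \<and> word_mono w - fscale s (word_mono u) \<in> ?T"
  have nf: "\<exists>u s. ?ok u w s" if w: "w \<in> ?L" for w
  proof -
    have ww: "w \<in> words (Zpow r)" "distinct (map idx w)"
      using w multilinear_words_iff multilinear_words_distinct by blast+
    obtain u where u: "normal_wd r u" "mod_sign ?T w u" "mset (map idx u) = mset (map idx w)" "u \<in> words (Zpow r)"
      using normal_form_exists[OF r T generators_subset[OF r] ww] by blast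
    have "u \<in> ?L" using u(3,4) w by (simp add: multilinear_words_iff)
    moreover have "word_mono w - fscale 1 (word_mono u) \<in> ?T \<or> word_mono w - fscale (- 1) (word_mono u) \<in> ?T"
      using u(2) unfolding mod_sign_def fscale_one fscale_minus_one by simp
    ultimately show ?thesis using u(1) by blast
  qed
  then obtain U s where Us: "\<And>w. w \<in> ?L \<Longrightarrow> ?ok (U w) w (s w)" by metis
  \<comment> \<open>Words whose normal form is an identity contribute nothing modulo the identities,
    and their normal forms are not good monomials.\<close>
  define K where "K = {w \<in> Poly_Mapping.keys v. word_mono (U (letters w)) \<notin> ?T}"
  define h where "h w = (word_mono (U (letters w)) :: (_, 'a) falg)" for w
  define k where "k w = Poly_Mapping.lookup v w * s (letters w)" for w
  define S where "S = h ` K"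
  \<comment> \<open>Several words may have the same normal form; their coefficients are
    added.\<close>
  define c where "c b = (\<Sum>w | w \<in> K \<and> h w = b. k w)" for b
  have fin: "finite K" "finite S" by (simp_all add: K_def S_def)
  have SB: "S \<subseteq> good_monomials r n"
    using Us supp unfolding good_monomials_eq[OF r] by (auto simp: S_def K_def h_def)
  have "(\<Sum>b\<in>S. fscale (c b) b) = (\<Sum>b\<in>S. \<Sum>w | w \<in> K \<and> h w = b. fscale (k w) (h w))"
  proof (intro sum.cong refl)
    fix b
    have "fscale (c b) b = (\<Sum>w | w \<in> K \<and> h w = b. fscale (k w) b)"
    proof -
      have "(Poly_Mapping.single 0 (sum k X) :: (nat \<Rightarrow>\<^sub>0 int, 'a) falg)
          = (\<Sum>w\<in>X. Poly_Mapping.single 0 (k w))" for X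
        by (rule poly_mapping_eqI) (simp add: lookup_sum lookup_single when_def)
      then show ?thesis by (simp add: c_def sum_distrib_right)
    qed
    then show "fscale (c b) b = (\<Sum>w | w \<in> K \<and> h w = b. fscale (k w) (h w))" by simp
  qed
  also have "\<dots> = (\<Sum>w\<in>K. fscale (k w) (h w))"
    unfolding S_def by (rule sum.image_gen[symmetric, OF fin(1)])
  finally have sumK: "(\<Sum>b\<in>S. fscale (c b) b) = (\<Sum>w\<in>K. fscale (k w) (h w))" .
  have "Poly_Mapping.single w (Poly_Mapping.lookup v w) - (if w \<in> K then fscale (k w) (h w) else 0) \<in> ?T"
    if w: "w \<in> Poly_Mapping.keys v" for w
  proof -
    let ?l = "letters w"
    have "fscale (Poly_Mapping.lookup v w) (word_mono ?l - fscale (s ?l) (h w)) \<in> ?T"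
      using T_star_ideal_smult[OF T] Us[OF supp[OF w]] unfolding h_def by blast
    then have *: "Poly_Mapping.single w (Poly_Mapping.lookup v w) - fscale (k w) (h w) \<in> ?T"
      by (simp only: right_diff_distrib fscale_fscale k_def single_eq_smult[symmetric])
    show ?thesis
    proof (cases "w \<in> K")
      case False
      then have "h w \<in> ?T" using w by (simp add: K_def h_def)
      from T_star_ideal_add[OF T * T_star_ideal_smult[OF T this, of "k w"]] False show ?thesis by simp
    qed (use * in simp)
  qed
  then have "(\<Sum>w\<in>Poly_Mapping.keys v. Poly_Mapping.single w (Poly_Mapping.lookup v w)
      - (if w \<in> K then fscale (k w) (h w) else 0)) \<in> ?T"
    by (rule T_star_ideal_sum[OF T])
  moreover have "(\<Sum>w\<in>Poly_Mapping.keys v. if w \<in> K then fscale (k w) (h w) else 0) = (\<Sum>b\<in>S. fscale (c b) b)"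
    unfolding sumK by (rule sum.mono_neutral_cong_right) (auto simp: K_def)
  ultimately have "v - (\<Sum>b\<in>S. fscale (c b) b) \<in> ?T"
    by (simp add: sum_subtractf flip: sum_singles)
  moreover have "S \<subseteq> multilinear (Zpow r) n"
    using SB unfolding good_monomials_eq[OF r] multilinear_eq by (auto simp: falg_supported_def word_mono_def)
  then have "v - (\<Sum>b\<in>S. fscale (c b) b) \<in> multilinear (Zpow r) n"
    using v unfolding multilinear_eq
    by (intro fsubspace_diff[OF fsubspace_supported] fsubspace_sum[OF fsubspace_supported]
        fsubspace_scale[OF fsubspace_supported]) auto
  ultimately show ?thesis using fin SB by blast
qed

theorem theorem2p20:
  fixes r :: nat
  assumes "r \<ge> 1"
  shows "T_star_basis (Zpow r) (generators r)
      (UT_identities r :: (nat \<Rightarrow>\<^sub>0 int, 'a::field_char_0) falg set) \<and>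
    (\<forall>n\<ge>1. basis_mod
      ((free_alg (Zpow r))\<lparr>carrier := multilinear (Zpow r) n\<rparr>)
      (multilinear (Zpow r) n \<inter> (UT_identities r :: (nat \<Rightarrow>\<^sub>0 int, 'a) falg set))
      (good_monomials r n))"
proof (intro conjI allI impI)
  let ?T = "UT_identities r :: (nat \<Rightarrow>\<^sub>0 int, 'a) falg set"
  note T = T_star_ideal_UT_identities[OF assms, where 'a='a]
  note gens = generators_subset[OF assms, where 'a='a]
  \<comment> \<open>The intersection of \<open>J\<close> with the identities still contains the
    generators, and it meets the requirement of \<open>UT_identities_subset\<close> that the ideal
    consist of identities.\<close>
  have "?T \<subseteq> J" if "T_star_ideal (Zpow r) J" "generators r \<subseteq> J" for J
    using UT_identities_subset[OF assms T_star_ideal_Int[OF that(1) T]] that(2) gens by blast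
  with T gens show "T_star_basis (Zpow r) (generators r) ?T"
    unfolding T_star_basis_def by blast
next
  fix n :: nat
  let ?M = "multilinear (Zpow r) n :: (nat \<Rightarrow>\<^sub>0 int, 'a) falg set"
  let ?T = "UT_identities r :: (nat \<Rightarrow>\<^sub>0 int, 'a) falg set"
  have M: "fsubspace ?M" unfolding multilinear_eq by (rule fsubspace_supported)
  have W: "fsubspace (?M \<inter> ?T)"
    using fsubspace_Int[OF M fsubspace_T_star_ideal[OF T_star_ideal_UT_identities[OF assms]]] .
  show "basis_mod ((free_alg (Zpow r))\<lparr>carrier := ?M\<rparr>) (?M \<inter> ?T) (good_monomials r n)"
  proof (rule basis_mod_fspaceI[OF M W])
    show "good_monomials r n \<subseteq> ?M"
      unfolding good_monomials_eq[OF assms] multilinear_eq by (auto simp: falg_supported_def word_mono_def)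
    show "c b = 0" if "finite S" "S \<subseteq> good_monomials r n" "(\<Sum>b\<in>S. fscale (c b) b) \<in> ?M \<inter> ?T" "b \<in> S"
      for S b and c :: "_ \<Rightarrow> 'a"
      using good_monomials_independent[OF assms that(1,2) _ that(4)] that(3) by blast
    show "\<exists>S c. finite S \<and> S \<subseteq> good_monomials r n \<and> v - (\<Sum>b\<in>S. fscale (c b) b) \<in> ?M \<inter> ?T"
      if "v \<in> ?M" for v
      by (rule good_monomials_generate[OF assms that])
  qed simp
qed

end
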